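(* Let $\tilde\alpha_1,\tilde\beta_1,\ldots,\tilde\alpha_g,\tilde\beta_g,\tilde\gamma_1,\ldots,\tilde\gamma_n\in\widetilde{PSL_2\mathbb R}$, with images $\alpha_i,\beta_i,\gamma_i\in PSL_2\mathbb R=\mathrm{Isom}^+\mathbb H^2$, and let $p\in\overline{\mathbb H}^2=\mathbb H^2\cup S^1_\infty$. Suppose that $\mathcal D(\boldsymbol\alpha,\boldsymbol\beta,\boldsymbol\gamma;p)$ is a convex polygon. Then $$\mathrm{Tw}\left([\tilde\alpha_1,\tilde\beta_1]\cdots[\tilde\alpha_g,\tilde\beta_g]\,\tilde\gamma_1\cdots\tilde\gamma_n,\;p\right)=\sum_{i=1}^n\mathrm{Tw}\left(\tilde\gamma_i,\;\gamma_{i+1}\gamma_{i+2}\cdots\gamma_n p\right)+\Delta\left[\mathcal D(\boldsymbol\alpha,\boldsymbol\beta,\boldsymbol\gamma;p)\right].$$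
   Context: $\mathbb H^2$ is the oriented hyperbolic plane (curvature $-1$), $S^1_\infty$ its circle at infinity. $PSL_2\mathbb R$ is identified with $\mathrm{Isom}^+\mathbb H^2$ (acting on the left), and $\widetilde{PSL_2\mathbb R}$ is its universal covering group, whose elements are homotopy classes rel endpoints of paths $(g_t)_{t\in[0,1]}$ in $PSL_2\mathbb R$ with $g_0=1$; the image of such a class in $PSL_2\mathbb R$ is $g_1$. Commutators are $[x,y]=xyx^{-1}y^{-1}$. Twist at $y\in\mathbb H^2$: let $\tilde\alpha\in\widetilde{PSL_2\mathbb R}$ be represented by $(g_t)$, with image $\alpha=g_1$. Let $c:[0,1]\to\mathbb H^2$ be the constant speed (possibly constant) geodesic from $y$ to $\alpha(y)$. For a unit tangent vector $u$ at $y$, choose a path $\mathcal V:[0,1]\to UT\mathbb H^2$ of unit tangent vectors along $c$ (that is, $\mathcal V(t)$ is based at $c(t)$) which is homotopic rel endpoints in $UT\mathbb H^2$ to $t\mapsto Dg_t(u)$. Then $\mathrm{Tw}(\tilde\alpha,y)\in\mathbb R$ is the total change $\theta(1)-\theta(0)$ of a continuous determination $\theta(t)$ of the anticlockwise angle from the unit velocity vector of $c$ (if $c$ is constant: from a fixed unit tangent vector at $y$) to $\mathcal V(t)$. This is independent of choices. For $p\in S^1_\infty$, $\mathrm{Tw}(\tilde\alpha,p)$ is the limit of $\mathrm{Tw}(\tilde\alpha,x)$ as $x\to p$ along any geodesic with endpoint $p$ (the limit exists and is independent of the geodesic). The polygon $\mathcal D(\boldsymbol\alpha,\boldsymbol\beta,\boldsymbol\gamma;p)$: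 for $1\le i\le g$ put $q_i=[\alpha_{i+1},\beta_{i+1}]\cdots[\alpha_g,\beta_g]\gamma_1\cdots\gamma_n p$ (so $q_g=\gamma_1\cdots\gamma_n p$), and $q_0=[\alpha_1,\beta_1]\cdots[\alpha_g,\beta_g]\gamma_1\cdots\gamma_n p$, so that $q_{i-1}=[\alpha_i,\beta_i]q_i$. Then $\mathcal D(\boldsymbol\alpha,\boldsymbol\beta,\boldsymbol\gamma;p)$ is the closed geodesic $(4g+n+1)$-gon whose vertices in order along its oriented boundary are: first $p$, then $q_0$; then, for $i=1,\ldots,g$ successively, $\beta_i^{-1}q_i\to\alpha_i^{-1}\beta_i^{-1}q_i\to\beta_i\alpha_i^{-1}\beta_i^{-1}q_i\to q_i$; then $\gamma_2\cdots\gamma_n p\to\gamma_3\cdots\gamma_n p\to\cdots\to\gamma_n p$; and finally back to $p$. (If $[\alpha_1,\beta_1]\cdots[\alpha_g,\beta_g]\gamma_1\cdots\gamma_n=1$ then $q_0=p$ and it is regarded as a $(4g+n)$-gon.) $\Delta[\mathcal D]$ is its signed hyperbolic area, positive if the boundary orientation given by this order of vertices is anticlockwise, negative if clockwise. *)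

theory Defs
  imports "HOL-Complex_Analysis.Complex_Analysis" "HOL-Algebra.Group"
begin

text \<open>
  The hyperbolic plane is the Poincare disc \<open>ball 0 1\<close> with the orientation of the complex plane
  and the metric \<open>2 \<bar>dz\<bar> / (1 - \<bar>z\<bar>\<^sup>2)\<close> of curvature \<open>-1\<close>; its circle at infinity is \<open>sphere 0 1\<close>
  and its compactification is \<open>cball 0 1\<close>. The model is conformal, so hyperbolic angles are
  Euclidean angles.
\<close>

abbreviation hplane :: "complex set" where
  "hplane \<equiv> ball 0 1"

definition hdist :: "complex \<Rightarrow> complex \<Rightarrow> real" where
  "hdist z w = arcosh (1 + 2 * (cmod (z - w))\<^sup>2 / ((1 - (cmod z)\<^sup>2) * (1 - (cmod w)\<^sup>2)))"

definition unit_tangent_bundle :: "(complex \<times> complex) set" where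
  "unit_tangent_bundle = {(z, u). z \<in> hplane \<and> 2 * cmod u / (1 - (cmod z)\<^sup>2) = 1}"

text \<open>The unit tangent vector at \<open>z\<close> in the direction of \<open>v \<noteq> 0\<close>.\<close>

definition hunit :: "complex \<Rightarrow> complex \<Rightarrow> complex" where
  "hunit z v = ((1 - (cmod z)\<^sup>2) / 2) *\<^sub>R sgn v"


section \<open>Geodesics\<close>

text \<open>Constant speed geodesics between points of the plane; they are constant if \<open>x = y\<close>.\<close>

definition hgeodesic :: "(real \<Rightarrow> complex) \<Rightarrow> complex \<Rightarrow> complex \<Rightarrow> bool" where
  "hgeodesic c x y \<longleftrightarrow> c 0 = x \<and> c 1 = y \<and> c ` {0..1} \<subseteq> hplane \<and>
     (\<forall>s\<in>{0..1}. \<forall>t\<in>{0..1}. hdist (c s) (c t) = \<bar>s - t\<bar> * hdist x y)"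

definition geodesic_ray :: "(real \<Rightarrow> complex) \<Rightarrow> complex \<Rightarrow> bool" where
  "geodesic_ray c p \<longleftrightarrow> c ` {0..} \<subseteq> hplane \<and>
     (\<forall>s\<ge>0. \<forall>t\<ge>0. hdist (c s) (c t) = \<bar>s - t\<bar>) \<and> (c \<longlongrightarrow> p) at_top"

text \<open>
  A nondegenerate geodesic between points of \<open>cball 0 1\<close>, parametrised by \<open>{0..1}\<close>. Since an endpoint
  may be ideal, no condition is put on the speed: an unparametrised geodesic is a path along
  which distance is additive.
\<close>

definition geodesic_arc :: "(real \<Rightarrow> complex) \<Rightarrow> complex \<Rightarrow> complex \<Rightarrow> bool" where
  "geodesic_arc c x y \<longleftrightarrow> arc c \<and> pathstart c = x \<and> pathfinish c = y \<and> c ` {0<..<1} \<subseteq> hplane \<and>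
     (\<forall>s t u. 0 < s \<and> s \<le> t \<and> t \<le> u \<and> u < 1 \<longrightarrow>
        hdist (c s) (c u) = hdist (c s) (c t) + hdist (c t) (c u))"

definition hconvex :: "complex set \<Rightarrow> bool" where
  "hconvex S \<longleftrightarrow> S \<subseteq> hplane \<and>
     (\<forall>x\<in>S. \<forall>y\<in>S. \<forall>c. hgeodesic c x y \<longrightarrow> c ` {0..1} \<subseteq> S)"


section \<open>Orientation preserving isometries and their universal covering group\<close>

text \<open>
  An isometry of the plane preserves orientation iff it is holomorphic. It acts on \<open>sphere 0 1\<close> by
  its continuous extension to \<open>cball 0 1\<close>. Outside \<open>cball 0 1\<close> the values are normalised to the
  identity, so that the group operation is composition of functions. The topology is that of
  pointwise convergence on the type \<open>complex \<Rightarrow> complex\<close>, which on this set is the usual topology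
  of \<open>PSL\<^sub>2\<real>\<close>.
\<close>

definition isom_plus :: "(complex \<Rightarrow> complex) set" where
  "isom_plus = {f. f ` hplane = hplane \<and> (\<forall>z\<in>hplane. \<forall>w\<in>hplane. hdist (f z) (f w) = hdist z w) \<and>
     f holomorphic_on hplane \<and> continuous_on (cball 0 1) f \<and> (\<forall>z. z \<notin> cball 0 1 \<longrightarrow> f z = z)}"

definition PSL2R :: "(complex \<Rightarrow> complex) monoid" where
  "PSL2R = \<lparr>carrier = isom_plus, mult = (\<circ>), one = id\<rparr>"

type_synonym isom_path_class = "(real \<Rightarrow> complex \<Rightarrow> complex) set"

definition isom_homotopy :: "((real \<Rightarrow> complex \<Rightarrow> complex) \<times> (real \<Rightarrow> complex \<Rightarrow> complex)) set" where
  "isom_homotopy = {(g, h). homotopic_paths isom_plus g h}"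

definition cover_PSL2R :: "isom_path_class monoid" where
  "cover_PSL2R =
     \<lparr>carrier = {g. path g \<and> path_image g \<subseteq> isom_plus \<and> pathstart g = id} // isom_homotopy,
      mult = (\<lambda>A B. \<Union>g\<in>A. \<Union>h\<in>B. isom_homotopy `` {\<lambda>t. g t \<circ> h t}),
      one = isom_homotopy `` {\<lambda>t. id}\<rparr>"

definition cover_image :: "isom_path_class \<Rightarrow> complex \<Rightarrow> complex" where
  "cover_image A = (THE f. \<forall>g\<in>A. pathfinish g = f)"

definition commutator :: "('a, 'b) monoid_scheme \<Rightarrow> 'a \<Rightarrow> 'a \<Rightarrow> 'a" where
  "commutator G x y = x \<otimes>\<^bsub>G\<^esub> y \<otimes>\<^bsub>G\<^esub> inv\<^bsub>G\<^esub> x \<otimes>\<^bsub>G\<^esub> inv\<^bsub>G\<^esub> y"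

text \<open>The ordered product of \<open>f i\<close>, \<open>f (i + 1)\<close>, ..., \<open>f j\<close>, which is \<open>\<one>\<close> if \<open>j < i\<close>.\<close>

definition oprod :: "('a, 'b) monoid_scheme \<Rightarrow> (nat \<Rightarrow> 'a) \<Rightarrow> nat \<Rightarrow> nat \<Rightarrow> 'a" where
  "oprod G f i j = foldr (\<lambda>k x. f k \<otimes>\<^bsub>G\<^esub> x) [i..<Suc j] \<one>\<^bsub>G\<^esub>"


section \<open>Twists\<close>

text \<open>
  \<open>\<tau>\<close> arises as the twist of the class \<open>A\<close> at \<open>y\<close> for some choice of a representative \<open>g\<close>, a unit
  tangent vector \<open>u\<close> at \<open>y\<close>, a path \<open>V\<close> of unit tangent vectors along \<open>c\<close> and an angle function \<open>\<theta>\<close>.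
  The reference field \<open>e\<close> is the unit velocity of \<open>c\<close>, or a fixed vector if \<open>c\<close> is constant.
  Tangent vectors are complex numbers, so the derivative of the holomorphic map \<open>g t\<close> at \<open>y\<close> acts
  on them as multiplication by \<open>deriv (g t) y\<close>.
\<close>

definition is_twist :: "isom_path_class \<Rightarrow> complex \<Rightarrow> real \<Rightarrow> bool" where
  "is_twist A y \<tau> \<longleftrightarrow> (\<exists>g\<in>A. \<exists>c u e V \<theta>.
     hgeodesic c y (pathfinish g y) \<and>
     (y, u) \<in> unit_tangent_bundle \<and>
     (if pathfinish g y = y
      then \<exists>e\<^sub>0. (y, e\<^sub>0) \<in> unit_tangent_bundle \<and> (\<forall>t\<in>{0..1}. e t = e\<^sub>0)
      else \<forall>t\<in>{0..1}. e t = hunit (c t) (vector_derivative c (at t within {0..1}))) \<and>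
     homotopic_paths unit_tangent_bundle V (\<lambda>t. (g t y, deriv (g t) y * u)) \<and>
     continuous_on {0..1} \<theta> \<and>
     (\<forall>t\<in>{0..1}. V t = (c t, cis (\<theta> t) * e t)) \<and>
     \<tau> = \<theta> 1 - \<theta> 0)"

definition twist_inner :: "isom_path_class \<Rightarrow> complex \<Rightarrow> real" where
  "twist_inner A y = (THE \<tau>. is_twist A y \<tau>)"

definition Tw :: "isom_path_class \<Rightarrow> complex \<Rightarrow> real" where
  "Tw A p = (if p \<in> hplane then twist_inner A p
     else (THE L. \<forall>c. geodesic_ray c p \<longrightarrow> ((\<lambda>t. twist_inner A (c t)) \<longlongrightarrow> L) at_top))"


section \<open>Geodesic polygons\<close>

text \<open>\<open>b\<close> runs once through the closed geodesic polygon with the vertices \<open>vs\<close> in cyclic order.\<close>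

definition geodesic_polygon :: "complex list \<Rightarrow> (real \<Rightarrow> complex) \<Rightarrow> bool" where
  "geodesic_polygon vs b \<longleftrightarrow> vs \<noteq> [] \<and>
     (\<forall>i<length vs. geodesic_arc
        (subpath (real i / real (length vs)) (real (Suc i) / real (length vs)) b)
        (vs ! i) (vs ! (Suc i mod length vs)))"

text \<open>The boundary is determined by the vertices up to parametrisation.\<close>

definition polygon_boundary :: "complex list \<Rightarrow> real \<Rightarrow> complex" where
  "polygon_boundary vs = (SOME b. geodesic_polygon vs b)"

definition convex_polygon :: "complex list \<Rightarrow> bool" where
  "convex_polygon vs \<longleftrightarrow> geodesic_polygon vs (polygon_boundary vs) \<and>
     simple_path (polygon_boundary vs) \<and> hconvex (inside (path_image (polygon_boundary vs)))"

definition harea :: "complex set \<Rightarrow> real" where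
  "harea S = (LINT z:S|lborel. 4 / (1 - (cmod z)\<^sup>2)\<^sup>2)"

definition anticlockwise :: "(real \<Rightarrow> complex) \<Rightarrow> bool" where
  "anticlockwise b \<longleftrightarrow> (\<forall>z\<in>inside (path_image b). winding_number b z = 1)"

text \<open>Only meant for vertices with a simple boundary, which is either anticlockwise or clockwise.\<close>

definition signed_area :: "complex list \<Rightarrow> real" where
  "signed_area vs =
     (if anticlockwise (polygon_boundary vs) then harea (inside (path_image (polygon_boundary vs)))
      else - harea (inside (path_image (polygon_boundary vs))))"

definition polygon_q :: "nat \<Rightarrow> nat \<Rightarrow> (nat \<Rightarrow> complex \<Rightarrow> complex) \<Rightarrow> (nat \<Rightarrow> complex \<Rightarrow> complex) \<Rightarrow>
    (nat \<Rightarrow> complex \<Rightarrow> complex) \<Rightarrow> complex \<Rightarrow> nat \<Rightarrow> complex" where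
  "polygon_q g n \<alpha> \<beta> \<gamma> p i =
     (oprod PSL2R (\<lambda>j. commutator PSL2R (\<alpha> j) (\<beta> j)) (Suc i) g \<otimes>\<^bsub>PSL2R\<^esub> oprod PSL2R \<gamma> 1 n) p"

text \<open>
  The last entry of the list under \<open>butlast\<close> is \<open>p\<close>, which is already the first vertex:
  if \<open>n \<ge> 1\<close> it is the case \<open>j = n\<close> of the empty product, and if \<open>n = 0\<close> it is \<open>q g\<close>. The vertices \<open>p\<close> and \<open>q 0\<close> are identified whenever they coincide,
  in particular if the product of all commutators and all \<open>\<gamma> i\<close> is the identity.
\<close>

definition polygon_D :: "nat \<Rightarrow> nat \<Rightarrow> (nat \<Rightarrow> complex \<Rightarrow> complex) \<Rightarrow> (nat \<Rightarrow> complex \<Rightarrow> complex) \<Rightarrow>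
    (nat \<Rightarrow> complex \<Rightarrow> complex) \<Rightarrow> complex \<Rightarrow> complex list" where
  "polygon_D g n \<alpha> \<beta> \<gamma> p =
     (let q = polygon_q g n \<alpha> \<beta> \<gamma> p in
      p # (if q 0 = p then [] else [q 0]) @
      butlast
       (concat (map (\<lambda>i. let \<alpha>' = inv\<^bsub>PSL2R\<^esub> (\<alpha> i); \<beta>' = inv\<^bsub>PSL2R\<^esub> (\<beta> i) in
            [\<beta>' (q i), \<alpha>' (\<beta>' (q i)), \<beta> i (\<alpha>' (\<beta>' (q i))), q i]) [1..<Suc g]) @
        map (\<lambda>j. oprod PSL2R \<gamma> (Suc j) n p) [1..<Suc n]))"

end

theory Submission
  imports Defs
begin

text \<open>
  The disc model is conformal, so the direction of a tangent vector can be compared with a fixed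
  Euclidean direction, although this comparison is not invariant under isometries. An element
  \<open>A\<close> of the covering group rotates tangent vectors at \<open>y\<close> by the real number \<open>angle A y\<close>, the
  variation of the argument of the derivative at \<open>y\<close> along a path representing \<open>A\<close>. The velocity
  of the geodesic from \<open>x\<close> to \<open>y\<close> is rotated by \<open>turn x y = 2 * Arg (1 - cnj x * y)\<close>. Hence the twist
  of \<open>A\<close> at \<open>y\<close> is \<open>angle A y - turn y z\<close> with \<open>z = cover_image A y\<close> (\<open>twist_inner_eq\<close>). Both terms
  make sense on the closed disc and the formula extends to ideal points (\<open>Tw_eq\<close>). This uses
  that isometries preserve the radial direction at the circle at infinity.

  Two properties of \<open>angle\<close> suffice for the computation. By the chain rule it is a cocycle
  (\<open>angle_mult\<close>), and since isometries map geodesics to geodesics, \<open>angle A y - angle A x\<close> is the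
  difference of the turnings of the geodesic from \<open>x\<close> to \<open>y\<close> and of its image (\<open>angle_diff\<close>). For
  a commutator the cocycle identity produces such differences only (\<open>angle_commutator\<close>). The
  twist of the whole product minus the twists of the factors \<open>\<gamma> i\<close> is therefore minus the sum of
  the turnings of the sides of the polygon.

  By the Gauss-Bonnet formula that number is the signed area (\<open>oriented_area\<close>). In the Klein
  model geodesics are straight (\<open>geodesic_arc_klein\<close>), so almost everywhere the winding number of
  the boundary is the sum of the signed indicator functions of the triangles which have the
  origin as apex and a side as base (\<open>winding_number_b\<close>). The area of such a triangle is computed
  by integrating along rays from the origin and then along the base, where the turning is an
  antiderivative (\<open>outer_integral\<close>). Ideal vertices are reached by monotone convergence
  (\<open>htri_area_closed\<close>).
\<close>

section \<open>Distance, Moebius transformations and geodesics of the disc\<close>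

definition hcosh :: "complex \<Rightarrow> complex \<Rightarrow> real" where
  "hcosh z w = 1 + 2 * (cmod (z - w))\<^sup>2 / ((1 - (cmod z)\<^sup>2) * (1 - (cmod w)\<^sup>2))"

lemma one_minus_norm_sq_pos: "z \<in> hplane \<Longrightarrow> 0 < 1 - (cmod z)\<^sup>2"
  by (simp add: power_less_one_iff abs_square_less_1)

lemma hcosh_ge_1: "z \<in> hplane \<Longrightarrow> w \<in> hplane \<Longrightarrow> 1 \<le> hcosh z w"
  using one_minus_norm_sq_pos[of z] one_minus_norm_sq_pos[of w] by (simp add: hcosh_def)

lemma hdist_nonneg: "z \<in> hplane \<Longrightarrow> w \<in> hplane \<Longrightarrow> 0 \<le> hdist z w"
  using hcosh_ge_1[of z w] by (simp add: hdist_def hcosh_def arcosh_nonneg_real)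

lemma cosh_hdist: "z \<in> hplane \<Longrightarrow> w \<in> hplane \<Longrightarrow> cosh (hdist z w) = hcosh z w"
  using hcosh_ge_1[of z w] by (simp add: hdist_def hcosh_def cosh_arcosh_real)

lemma hdist_commute: "hdist z w = hdist w z"
  by (simp add: hdist_def norm_minus_commute mult.commute)

lemma hdist_eq_iff_hcosh:
  assumes "z \<in> hplane" "w \<in> hplane" "z' \<in> hplane" "w' \<in> hplane"
  shows "hdist z w = hdist z' w' \<longleftrightarrow> hcosh z w = hcosh z' w'"
  using assms cosh_hdist by (metis hcosh_def hdist_def)

lemma hdist_eq_0_iff: "z \<in> hplane \<Longrightarrow> w \<in> hplane \<Longrightarrow> hdist z w = 0 \<longleftrightarrow> z = w"
proof -
  assume a: "z \<in> hplane" "w \<in> hplane"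
  have "hdist z w = 0 \<longleftrightarrow> hcosh z w = 1"
    using a hdist_eq_iff_hcosh[of z w z z] by (simp add: hcosh_def hdist_def)
  also have "\<dots> \<longleftrightarrow> z = w"
    using one_minus_norm_sq_pos[OF a(1)] one_minus_norm_sq_pos[OF a(2)] by (simp add: hcosh_def)
  finally show ?thesis .
qed

text \<open>
  The passage from the Poincare disc to the Klein disc. Writing a point of the plane as a point
  \<open>(z\<^sub>0, z\<^sub>1)\<close> of the hyperboloid \<open>z\<^sub>0\<^sup>2 - \<bar>z\<^sub>1\<bar>\<^sup>2 = 1\<close>, with \<open>z\<^sub>0 = (1 + \<bar>z\<bar>\<^sup>2) / (1 - \<bar>z\<bar>\<^sup>2)\<close> and
  \<open>z\<^sub>1 = 2 z / (1 - \<bar>z\<bar>\<^sup>2)\<close>, it is the central projection \<open>z\<^sub>1 / z\<^sub>0\<close>, so it makes geodesics straight.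
\<close>

definition klein :: "complex \<Rightarrow> complex" where
  "klein z = (2 / (1 + (cmod z)\<^sup>2)) *\<^sub>R z"

lemma klein_rescale: "z = ((1 + (cmod z)\<^sup>2) / 2) *\<^sub>R klein z"
proof -
  have "1 + (cmod z)\<^sup>2 \<noteq> 0" using add_pos_nonneg[of 1 "(cmod z)\<^sup>2"] by simp
  then have "(1 + (cmod z)\<^sup>2) / 2 * (2 / (1 + (cmod z)\<^sup>2)) = 1" by (simp add: divide_simps)
  then show ?thesis by (simp only: klein_def scaleR_scaleR scaleR_one)
qed

text \<open>
  The equality case of the reversed triangle inequality on the hyperboloid, where
  \<open>p = cosh d(a,b)\<close>, \<open>P = sinh d(a,b)\<close> and \<open>q\<close>, \<open>Q\<close> belong to \<open>d(b,c)\<close>. The components of \<open>a\<close> and \<open>c\<close>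
  orthogonal to \<open>b\<close> lie in a space on which the Lorentz form is definite, and they have lengths
  \<open>P\<close> and \<open>Q\<close>. The hypothesis on \<open>\<langle>a, c\<rangle>\<close> says that they point in opposite directions,
  so \<open>Q a + P c\<close> is a multiple of \<open>b\<close>.
\<close>

lemma hyperboloid_additive:
  fixes a0 :: real
  assumes A: "a0\<^sup>2 = 1 + a1\<^sup>2 + a2\<^sup>2" and B: "b0\<^sup>2 = 1 + b1\<^sup>2 + b2\<^sup>2" and C: "c0\<^sup>2 = 1 + c1\<^sup>2 + c2\<^sup>2"
    and p: "p = a0 * b0 - a1 * b1 - a2 * b2" and q: "q = c0 * b0 - c1 * b1 - c2 * b2"
    and r: "a0 * c0 - a1 * c1 - a2 * c2 = p * q + P * Q"
    and P: "P\<^sup>2 = p\<^sup>2 - 1" and Q: "Q\<^sup>2 = q\<^sup>2 - 1"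
  shows "Q * a0 + P * c0 = (p * Q + q * P) * b0"
    "Q * a1 + P * c1 = (p * Q + q * P) * b1"
    "Q * a2 + P * c2 = (p * Q + q * P) * b2"
proof -
  \<comment> \<open>The part of \<open>Q a + P c\<close> orthogonal to \<open>b\<close> is isotropic; being orthogonal to a timelike vector, it vanishes.\<close>
  define x0 x1 x2 where x: "x0 = Q * (a0 - p * b0) + P * (c0 - q * b0)"
    "x1 = Q * (a1 - p * b1) + P * (c1 - q * b1)" "x2 = Q * (a2 - p * b2) + P * (c2 - q * b2)"
  have "x0 * b0 - x1 * b1 - x2 * b2 =
      Q * ((a0 * b0 - a1 * b1 - a2 * b2) - p * (b0\<^sup>2 - b1\<^sup>2 - b2\<^sup>2))
      + P * ((c0 * b0 - c1 * b1 - c2 * b2) - q * (b0\<^sup>2 - b1\<^sup>2 - b2\<^sup>2))"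
    unfolding x by (simp add: algebra_simps power2_eq_square)
  also have "\<dots> = 0"
    using B p q by simp
  finally have orth: "x0 * b0 = x1 * b1 + x2 * b2" by simp
  define y0 y1 y2 where y: "y0 = Q * a0 + P * c0" "y1 = Q * a1 + P * c1" "y2 = Q * a2 + P * c2"
  have xy: "x0 = y0 - (p * Q + q * P) * b0" "x1 = y1 - (p * Q + q * P) * b1" "x2 = y2 - (p * Q + q * P) * b2"
    unfolding x y by (simp_all add: algebra_simps)
  have yb: "y0 * b0 - y1 * b1 - y2 * b2 = Q * p + P * q"
    unfolding y p q by (simp add: algebra_simps)
  have yy: "y0\<^sup>2 - y1\<^sup>2 - y2\<^sup>2 = Q\<^sup>2 * (a0\<^sup>2 - a1\<^sup>2 - a2\<^sup>2) + P\<^sup>2 * (c0\<^sup>2 - c1\<^sup>2 - c2\<^sup>2)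
      + 2 * P * Q * (a0 * c0 - a1 * c1 - a2 * c2)"
    unfolding y by (simp add: algebra_simps power2_eq_square)
  have "x0\<^sup>2 - x1\<^sup>2 - x2\<^sup>2 = (y0\<^sup>2 - y1\<^sup>2 - y2\<^sup>2) - 2 * (p * Q + q * P) * (y0 * b0 - y1 * b1 - y2 * b2)
      + (p * Q + q * P)\<^sup>2 * (b0\<^sup>2 - b1\<^sup>2 - b2\<^sup>2)"
    unfolding xy by (simp add: algebra_simps power2_eq_square)
  also have "\<dots> = Q\<^sup>2 + P\<^sup>2 + 2 * P * Q * (p * q + P * Q) - (p * Q + q * P)\<^sup>2"
    unfolding yy yb r using A B C by (simp add: algebra_simps power2_eq_square)
  also have "\<dots> = Q\<^sup>2 + P\<^sup>2 + 2 * P\<^sup>2 * Q\<^sup>2 - p\<^sup>2 * Q\<^sup>2 - q\<^sup>2 * P\<^sup>2"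
    by (simp add: algebra_simps power2_eq_square)
  also have "\<dots> = 0"
    unfolding P Q by (simp add: algebra_simps)
  finally have null: "x0\<^sup>2 = x1\<^sup>2 + x2\<^sup>2" by simp
  have "(x1\<^sup>2 + x2\<^sup>2) * b0\<^sup>2 = (x1 * b1 + x2 * b2)\<^sup>2"
    using orth null by (metis power_mult_distrib)
  also have "\<dots> \<le> (x1\<^sup>2 + x2\<^sup>2) * (b1\<^sup>2 + b2\<^sup>2)"
    using zero_le_power2[of "x1 * b2 - x2 * b1"] by (simp add: algebra_simps power2_eq_square)
  finally have "x1\<^sup>2 + x2\<^sup>2 \<le> 0"
    unfolding B by (simp add: algebra_simps)
  then have "x1 = 0" "x2 = 0"
    by (auto simp: sum_power2_le_zero_iff)
  with null have "x0 = 0" by simp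
  with \<open>x1 = 0\<close> \<open>x2 = 0\<close> xy y show "Q * a0 + P * c0 = (p * Q + q * P) * b0"
    "Q * a1 + P * c1 = (p * Q + q * P) * b1"
    "Q * a2 + P * c2 = (p * Q + q * P) * b2" by simp_all
qed

lemma hcosh_hyperboloid:
  assumes "z \<in> hplane" "w \<in> hplane"
  shows "hcosh z w = (1 + (cmod z)\<^sup>2) / (1 - (cmod z)\<^sup>2) * ((1 + (cmod w)\<^sup>2) / (1 - (cmod w)\<^sup>2))
    - 2 * Re z / (1 - (cmod z)\<^sup>2) * (2 * Re w / (1 - (cmod w)\<^sup>2))
    - 2 * Im z / (1 - (cmod z)\<^sup>2) * (2 * Im w / (1 - (cmod w)\<^sup>2))"
proof -
  have d: "(cmod (z - w))\<^sup>2 = (cmod z)\<^sup>2 + (cmod w)\<^sup>2 - 2 * Re z * Re w - 2 * Im z * Im w"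
    unfolding cmod_power2 by (simp add: power2_eq_square algebra_simps)
  define Z W M N where Z: "Z = (cmod z)\<^sup>2" and W: "W = (cmod w)\<^sup>2" and M: "M = 1 - Z" and N: "N = 1 - W"
  have "M \<noteq> 0" "N \<noteq> 0"
    using one_minus_norm_sq_pos[OF assms(1)] one_minus_norm_sq_pos[OF assms(2)] by (auto simp: M N Z W)
  then have "hcosh z w = (M * N + 2 * (Z + W - 2 * Re z * Re w - 2 * Im z * Im w)) / (M * N)"
    unfolding hcosh_def d Z[symmetric] W[symmetric] M[symmetric] N[symmetric] by (simp add: add_divide_distrib)
  also have "M * N + 2 * (Z + W - 2 * Re z * Re w - 2 * Im z * Im w) =
      (1 + Z) * (1 + W) - 2 * Re z * (2 * Re w) - 2 * Im z * (2 * Im w)"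
    by (simp add: M N algebra_simps)
  also have "\<dots> / (M * N) = (1 + Z) / M * ((1 + W) / N) - 2 * Re z / M * (2 * Re w / N) - 2 * Im z / M * (2 * Im w / N)"
    by (simp add: diff_divide_distrib)
  finally show ?thesis unfolding M N Z W .
qed

lemma hyperboloid_eq:
  assumes "z \<in> hplane"
  shows "((1 + (cmod z)\<^sup>2) / (1 - (cmod z)\<^sup>2))\<^sup>2 =
    1 + (2 * Re z / (1 - (cmod z)\<^sup>2))\<^sup>2 + (2 * Im z / (1 - (cmod z)\<^sup>2))\<^sup>2"
proof -
  define n where "n = (cmod z)\<^sup>2"
  have n: "n = (Re z)\<^sup>2 + (Im z)\<^sup>2" "1 - n \<noteq> 0"
    using one_minus_norm_sq_pos[OF assms] by (simp_all add: n_def cmod_power2)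
  have "(1 + n)\<^sup>2 = (1 - n)\<^sup>2 + (2 * Re z)\<^sup>2 + (2 * Im z)\<^sup>2"
    using n(1) by (simp add: power2_eq_square algebra_simps)
  then have "(1 + n)\<^sup>2 / (1 - n)\<^sup>2 = ((1 - n)\<^sup>2 + (2 * Re z)\<^sup>2 + (2 * Im z)\<^sup>2) / (1 - n)\<^sup>2" by simp
  then show ?thesis
    using n(2) unfolding n_def[symmetric] power_divide by (simp add: add_divide_distrib)
qed

text \<open>
  Projecting the linear relation of \<open>hyperboloid_additive\<close> from the centre expresses \<open>klein b\<close> as a
  convex combination of \<open>klein a\<close> and \<open>klein c\<close>.
\<close>

lemma klein_between:
  assumes a: "a \<in> hplane" and b: "b \<in> hplane" and c: "c \<in> hplane"
    and add: "hdist a c = hdist a b + hdist b c"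
  shows "klein b \<in> closed_segment (klein a) (klein c)"
proof (cases "a = b \<and> b = c")
  case False
  let ?h = "\<lambda>z. (1 + (cmod z)\<^sup>2) / (1 - (cmod z)\<^sup>2)"
  let ?r = "\<lambda>z. 2 * Re z / (1 - (cmod z)\<^sup>2)"
  let ?i = "\<lambda>z. 2 * Im z / (1 - (cmod z)\<^sup>2)"
  define P Q where PQ: "P = sinh (hdist a b)" "Q = sinh (hdist b c)"
  define p q where pq: "p = hcosh a b" "q = hcosh c b"
  have q_cosh: "q = cosh (hdist b c)" and p_cosh: "p = cosh (hdist a b)"
    using cosh_hdist[of c b] cosh_hdist[of a b] a b c by (auto simp: pq hdist_commute)
  have r: "hcosh a c = p * q + P * Q"
    unfolding cosh_hdist[OF a c, symmetric] add cosh_add p_cosh q_cosh PQ ..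
  have 1: "Q * ?h a + P * ?h c = (p * Q + q * P) * ?h b"
    and 2: "Q * ?r a + P * ?r c = (p * Q + q * P) * ?r b"
    and 3: "Q * ?i a + P * ?i c = (p * Q + q * P) * ?i b"
    using hyperboloid_additive[OF hyperboloid_eq[OF a] hyperboloid_eq[OF b] hyperboloid_eq[OF c],
        of p q P Q, folded hcosh_hyperboloid[OF a b] hcosh_hyperboloid[OF c b] hcosh_hyperboloid[OF a c]]
      r by (auto simp: pq[symmetric] PQ p_cosh q_cosh sinh_square_eq)
  have "P \<ge> 0" "Q \<ge> 0" using hdist_nonneg a b c by (auto simp: PQ)
  have "P \<noteq> 0 \<or> Q \<noteq> 0" using False hdist_eq_0_iff a b c by (auto simp: PQ)
  with \<open>P \<ge> 0\<close> \<open>Q \<ge> 0\<close> have pos: "P > 0 \<or> Q > 0" by auto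
  have h: "?h z > 0" if "z \<in> hplane" for z
    using one_minus_norm_sq_pos[OF that] by (intro divide_pos_pos) (auto intro: add_pos_nonneg)
  define S where "S = Q * ?h a + P * ?h c"
  have S: "S > 0"
    using pos \<open>P \<ge> 0\<close> \<open>Q \<ge> 0\<close> h[OF a] h[OF c] unfolding S_def
    by (meson add_nonneg_pos add_pos_nonneg mult_nonneg_nonneg mult_pos_pos order_less_imp_le)
  define u where "u = P * ?h c / S"
  have nn: "0 \<le> P * ?h c" "0 \<le> Q * ?h a"
    using h[OF a] h[OF c] \<open>P \<ge> 0\<close> \<open>Q \<ge> 0\<close> by (simp_all only: mult_nonneg_nonneg less_imp_le)
  have u_eq: "1 - u = Q * ?h a / S"
    using S by (simp only: u_def diff_divide_eq_iff S_def) (simp add: field_simps)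
  have "0 \<le> u" using nn(1) S unfolding u_def by (rule divide_nonneg_pos)
  moreover have "0 \<le> 1 - u" using nn(2) S unfolding u_eq by (rule divide_nonneg_pos)
  ultimately have u: "0 \<le> u" "u \<le> 1" "1 - u = Q * ?h a / S"
    using u_eq by simp_all
  have k: "?h z * Re (klein z) = ?r z" "?h z * Im (klein z) = ?i z" if "z \<in> hplane" for z
    using one_minus_norm_sq_pos[OF that] add_pos_nonneg[of 1 "(cmod z)\<^sup>2"]
    by (auto simp: klein_def divide_simps)
  have T: "p * Q + q * P = S / ?h b" using 1[folded S_def] h[OF b] by (metis less_irrefl nonzero_mult_div_cancel_right)
  have "Re (klein b) = ?r b / ?h b" using k(1)[OF b] h[OF b] by (metis less_irrefl nonzero_mult_div_cancel_left)
  also have "\<dots> = (Q * ?r a + P * ?r c) / S" unfolding 2 T using S h[OF b] by simp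
  also have "\<dots> = (1 - u) * Re (klein a) + u * Re (klein c)"
    unfolding u(3) unfolding u_def k(1)[OF a, symmetric] k(1)[OF c, symmetric]
    by (simp add: add_divide_distrib)
  finally have R: "Re (klein b) = (1 - u) * Re (klein a) + u * Re (klein c)" .
  have "Im (klein b) = ?i b / ?h b" using k(2)[OF b] h[OF b] by (metis less_irrefl nonzero_mult_div_cancel_left)
  also have "\<dots> = (Q * ?i a + P * ?i c) / S" unfolding 3 T using S h[OF b] by simp
  also have "\<dots> = (1 - u) * Im (klein a) + u * Im (klein c)"
    unfolding u(3) unfolding u_def k(2)[OF a, symmetric] k(2)[OF c, symmetric]
    by (simp add: add_divide_distrib)
  finally have "klein b = (1 - u) *\<^sub>R klein a + u *\<^sub>R klein c"
    using R by (simp add: complex_eq_iff)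
  then show ?thesis using u unfolding closed_segment_def by blast
qed auto

text \<open>
  The general isometry in terms of \<open>b\<close>, its value at \<open>0\<close>, and \<open>u\<close>, the direction of its
  derivative at \<open>0\<close>.
\<close>

definition mob :: "complex \<Rightarrow> complex \<Rightarrow> complex \<Rightarrow> complex" where
  "mob u b z = (if z \<in> cball 0 1 then (u * z + b) / (1 + cnj b * u * z) else z)"

text \<open>
  The angle by which the Euclidean direction of the geodesic from \<open>x\<close> to \<open>y\<close> turns. It is
  \<open>0\<close> for geodesics through the origin, which are straight. The geodesic from \<open>x\<close> is the image
  of a radius, ending at \<open>m\<close> say, under \<open>z \<mapsto> (z + x) / (1 + cnj x * z)\<close>, whose derivative has
  argument \<open>- 2 Arg (1 + cnj x * z)\<close>, and \<open>1 + cnj x * m\<close> is a positive multiple of the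
  inverse of \<open>1 - cnj x * y\<close>.
\<close>

definition turn :: "complex \<Rightarrow> complex \<Rightarrow> real" where
  "turn x y = 2 * Arg (1 - cnj x * y)"

lemma Re_one_plus_pos:
  assumes "cmod w < 1"
  shows "0 < Re (1 + w)"
  using assms abs_Re_le_cmod[of w] by (simp add: abs_less_iff)

lemma norm_mob_den: "cmod u = 1 \<Longrightarrow> b \<in> hplane \<Longrightarrow> z \<in> cball 0 1 \<Longrightarrow> cmod (cnj b * u * z) < 1"
  using mult_mono[of "cmod z" 1 "cmod b" "cmod b"] by (simp add: norm_mult mult.commute)

lemma Re_mob_den: "cmod u = 1 \<Longrightarrow> b \<in> hplane \<Longrightarrow> z \<in> cball 0 1 \<Longrightarrow> 0 < Re (1 + cnj b * u * z)"
  using norm_mob_den Re_one_plus_pos by blast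

lemma mob_den_nonzero: "cmod u = 1 \<Longrightarrow> b \<in> hplane \<Longrightarrow> z \<in> cball 0 1 \<Longrightarrow> 1 + cnj b * u * z \<noteq> 0"
  using Re_mob_den by fastforce

text \<open>
  The polarised form of the invariance of \<open>\<bar>dz\<bar> / (1 - \<bar>z\<bar>\<^sup>2)\<close>. Its modulus controls distances,
  and its argument gives the behaviour of \<open>turn\<close> under isometries.
\<close>

lemma mob_form:
  assumes u: "cmod u = 1" and b: "b \<in> hplane" and z: "z \<in> cball 0 1" and w: "w \<in> cball 0 1"
  shows "1 - cnj (mob u b z) * mob u b w =
    of_real (1 - (cmod b)\<^sup>2) * (1 - cnj z * w) / (cnj (1 + cnj b * u * z) * (1 + cnj b * u * w))"
proof -
  have nz: "1 + cnj b * u * w \<noteq> 0" "cnj (1 + cnj b * u * z) \<noteq> 0"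
    using mob_den_nonzero[OF u b w] mob_den_nonzero[OF u b z] by (simp_all only: complex_cnj_zero_iff) auto
  have uu: "u * cnj u = 1" using u by (simp add: complex_mult_cnj cmod_power2[symmetric])
  have bb: "b * cnj b = of_real ((cmod b)\<^sup>2)" by (rule complex_norm_square[symmetric])
  have "1 - cnj (mob u b z) * mob u b w =
     (cnj (1 + cnj b * u * z) * (1 + cnj b * u * w) - cnj (u * z + b) * (u * w + b)) /
      (cnj (1 + cnj b * u * z) * (1 + cnj b * u * w))"
    using nz z w by (simp add: mob_def diff_divide_distrib)
  also have "cnj (1 + cnj b * u * z) * (1 + cnj b * u * w) - cnj (u * z + b) * (u * w + b) =
     1 - b * cnj b - (u * cnj u) * (cnj z * w) + (b * cnj b) * (u * cnj u) * (cnj z * w)"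
    by (simp add: algebra_simps)
  also have "\<dots> = of_real (1 - (cmod b)\<^sup>2) * (1 - cnj z * w)"
    unfolding uu bb by (simp add: algebra_simps)
  finally show ?thesis .
qed

lemma mob_norm_form:
  assumes u: "cmod u = 1" and b: "b \<in> hplane" and z: "z \<in> cball 0 1"
  shows "1 - (cmod (mob u b z))\<^sup>2 = (1 - (cmod b)\<^sup>2) * (1 - (cmod z)\<^sup>2) / (cmod (1 + cnj b * u * z))\<^sup>2"
proof -
  have c: "cnj x * x = of_real ((cmod x)\<^sup>2)" for x unfolding complex_norm_square by (rule mult.commute)
  have "complex_of_real (1 - (cmod (mob u b z))\<^sup>2) =
      of_real ((1 - (cmod b)\<^sup>2) * (1 - (cmod z)\<^sup>2) / (cmod (1 + cnj b * u * z))\<^sup>2)"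
    using mob_form[OF u b z z] unfolding c by simp
  then show ?thesis using of_real_eq_iff by blast
qed

lemma mob_diff:
  assumes u: "cmod u = 1" and b: "b \<in> hplane" and z: "z \<in> cball 0 1" and w: "w \<in> cball 0 1"
  shows "mob u b z - mob u b w =
    u * of_real (1 - (cmod b)\<^sup>2) * (z - w) / ((1 + cnj b * u * z) * (1 + cnj b * u * w))"
proof -
  have nz: "1 + cnj b * u * w \<noteq> 0" "1 + cnj b * u * z \<noteq> 0"
    using mob_den_nonzero[OF u b w] mob_den_nonzero[OF u b z] by auto
  have bb: "b * cnj b = of_real ((cmod b)\<^sup>2)" by (rule complex_norm_square[symmetric])
  have "mob u b z - mob u b w = ((u * z + b) * (1 + cnj b * u * w) - (u * w + b) * (1 + cnj b * u * z)) /
     ((1 + cnj b * u * z) * (1 + cnj b * u * w))"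
    using nz z w by (simp add: mob_def diff_frac_eq)
  also have "(u * z + b) * (1 + cnj b * u * w) - (u * w + b) * (1 + cnj b * u * z) = u * (1 - b * cnj b) * (z - w)"
    by (simp add: algebra_simps)
  finally show ?thesis unfolding bb by simp
qed

lemma mob_in_cball: "cmod u = 1 \<Longrightarrow> b \<in> hplane \<Longrightarrow> z \<in> cball 0 1 \<Longrightarrow> mob u b z \<in> cball 0 1"
proof -
  assume a: "cmod u = 1" "b \<in> hplane" "z \<in> cball 0 1"
  have "0 \<le> 1 - (cmod (mob u b z))\<^sup>2"
    unfolding mob_norm_form[OF a] using one_minus_norm_sq_pos[OF a(2)] a(3)
    by (intro divide_nonneg_nonneg mult_nonneg_nonneg) (auto simp: power_le_one)
  then show ?thesis by (simp add: abs_square_le_1)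
qed

lemma mob_in_hplane: "cmod u = 1 \<Longrightarrow> b \<in> hplane \<Longrightarrow> z \<in> hplane \<Longrightarrow> mob u b z \<in> hplane"
proof -
  assume a: "cmod u = 1" "b \<in> hplane" "z \<in> hplane"
  have z: "z \<in> cball 0 1" using a(3) by auto
  have "0 < 1 - (cmod (mob u b z))\<^sup>2"
    unfolding mob_norm_form[OF a(1,2) z] using one_minus_norm_sq_pos[OF a(2)] one_minus_norm_sq_pos[OF a(3)]
      mob_den_nonzero[OF a(1,2) z]
    by (intro divide_pos_pos mult_pos_pos) auto
  then show ?thesis by (simp add: abs_square_less_1)
qed

lemma hdist_mob:
  assumes u: "cmod u = 1" and b: "b \<in> hplane" and z: "z \<in> hplane" and w: "w \<in> hplane"
  shows "hdist (mob u b z) (mob u b w) = hdist z w"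
proof -
  have z': "z \<in> cball 0 1" and w': "w \<in> cball 0 1" using z w by auto
  define B X Y where "B = 1 - (cmod b)\<^sup>2" "X = cmod (1 + cnj b * u * z)" "Y = cmod (1 + cnj b * u * w)"
  have nz: "B > 0" "X \<noteq> 0" "Y \<noteq> 0"
    using mob_den_nonzero[OF u b w'] mob_den_nonzero[OF u b z'] one_minus_norm_sq_pos[OF b]
    by (auto simp: B_X_Y_def)
  have d: "(cmod (mob u b z - mob u b w))\<^sup>2 = B\<^sup>2 * (cmod (z - w))\<^sup>2 / (X\<^sup>2 * Y\<^sup>2)"
    unfolding mob_diff[OF u b z' w'] B_X_Y_def[symmetric] norm_divide norm_mult u norm_of_real
    using nz by (simp add: power_mult_distrib power_divide)
  have "hcosh (mob u b z) (mob u b w) = hcosh z w"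
    unfolding hcosh_def d mob_norm_form[OF u b z'] mob_norm_form[OF u b w'] B_X_Y_def[symmetric]
    using nz by (simp add: power2_eq_square mult.commute)
  then show ?thesis by (simp add: hcosh_def hdist_def)
qed

lemma mob_inverse:
  assumes u: "cmod u = 1" and b: "b \<in> hplane"
  shows "mob (cnj u) (- cnj u * b) (mob u b z) = z"
proof (cases "z \<in> cball 0 1")
  case z: True
  have uu: "u * cnj u = 1" "cnj u * u = 1" using u by (simp_all add: complex_mult_cnj cmod_power2[symmetric] mult.commute)
  have B: "complex_of_real (1 - (cmod b)\<^sup>2) \<noteq> 0"
    using one_minus_norm_sq_pos[OF b] by (simp only: of_real_eq_0_iff)
  have bb: "1 - b * cnj b = of_real (1 - (cmod b)\<^sup>2)" unfolding complex_norm_square[symmetric] by simp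
  have nz: "1 + cnj b * u * z \<noteq> 0" by (rule mob_den_nonzero[OF u b z])
  define f where "f = mob u b z"
  have f: "f = (u * z + b) / (1 + cnj b * u * z)" using z by (simp add: f_def mob_def)
  have 1: "cnj u * f + - cnj u * b = z * of_real (1 - (cmod b)\<^sup>2) / (1 + cnj b * u * z)"
  proof -
    have "cnj u * f + - cnj u * b = cnj u * (u * z + b - b * (1 + cnj b * u * z)) / (1 + cnj b * u * z)"
      unfolding f using nz by (simp add: field_simps)
    also have "cnj u * (u * z + b - b * (1 + cnj b * u * z)) = (cnj u * u) * z * (1 - b * cnj b)"
      by (simp add: algebra_simps)
    finally show ?thesis unfolding uu bb by simp
  qed
  have 2: "1 + cnj (- cnj u * b) * cnj u * f = of_real (1 - (cmod b)\<^sup>2) / (1 + cnj b * u * z)"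
  proof -
    have "1 + cnj (- cnj u * b) * cnj u * f = 1 - (u * cnj u) * cnj b * f" by (simp add: algebra_simps)
    also have "\<dots> = (1 + cnj b * u * z - cnj b * (u * z + b)) / (1 + cnj b * u * z)"
      unfolding f uu using nz by (simp add: diff_divide_distrib)
    also have "1 + cnj b * u * z - cnj b * (u * z + b) = 1 - b * cnj b" by (simp add: algebra_simps)
    finally show ?thesis unfolding bb .
  qed
  have "mob (cnj u) (- cnj u * b) f = (cnj u * f + - cnj u * b) / (1 + cnj (- cnj u * b) * cnj u * f)"
    using mob_in_cball[OF u b z] unfolding mob_def[of "cnj u"] f_def[symmetric] by simp
  also have "\<dots> = z" unfolding 1 2 using nz B by simp
  finally show ?thesis unfolding f_def .
qed (simp add: mob_def)

lemma mob_inverse':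
  assumes u: "cmod u = 1" and b: "b \<in> hplane"
  shows "mob u b (mob (cnj u) (- cnj u * b) z) = z"
proof -
  have "u * cnj u = 1" using u by (simp add: complex_mult_cnj cmod_power2[symmetric])
  then have "- cnj (cnj u) * (- cnj u * b) = b" "cnj (cnj u) = u" by (simp_all add: mult.assoc[symmetric])
  moreover have "cmod (cnj u) = 1" "- cnj u * b \<in> hplane" using u b by (simp_all add: norm_mult)
  ultimately show ?thesis using mob_inverse[of "cnj u" "- cnj u * b" z] by (simp only:)
qed

lemma hdist_radial:
  assumes "cmod w = 1"
  shows "hdist (of_real (tanh s) * w) (of_real (tanh t) * w) = 2 * \<bar>s - t\<bar>"
proof -
  have c: "1 - (tanh x)\<^sup>2 = 1 / (cosh x)\<^sup>2" for x :: real
  proof -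
    have "1 - (tanh x)\<^sup>2 = ((cosh x)\<^sup>2 - (sinh x)\<^sup>2) / (cosh x)\<^sup>2"
      by (simp add: tanh_def power_divide diff_divide_distrib)
    then show ?thesis by (simp add: cosh_square_eq)
  qed
  have d: "tanh s - tanh t = sinh (s - t) / (cosh s * cosh t)"
    by (simp add: tanh_def sinh_diff diff_frac_eq mult.commute)
  have "cmod (of_real (tanh s) * w - of_real (tanh t) * w) = \<bar>tanh s - tanh t\<bar>"
    using assms by (simp add: left_diff_distrib[symmetric] norm_mult flip: of_real_diff)
  then have n: "(cmod (of_real (tanh s) * w - of_real (tanh t) * w))\<^sup>2 = (sinh (s - t) / (cosh s * cosh t))\<^sup>2"
    by (simp add: d power_divide)
  have "1 + 2 * (cmod (of_real (tanh s) * w - of_real (tanh t) * w))\<^sup>2 /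
    ((1 - (cmod (of_real (tanh s) * w))\<^sup>2) * (1 - (cmod (of_real (tanh t) * w))\<^sup>2)) = 1 + 2 * (sinh (s - t))\<^sup>2"
    unfolding n using assms by (simp add: norm_mult c power_divide power_mult_distrib)
  also have "\<dots> = cosh (2 * (s - t))"
    unfolding cosh_double[of "s - t"] cosh_square_eq by simp
  also have "\<dots> = cosh (2 * \<bar>s - t\<bar>)" by (simp add: abs_if)
  finally show ?thesis
    unfolding hdist_def by (simp only: arcosh_cosh_real) (simp add: arcosh_cosh_real)
qed

lemma tanh_artanh: "\<bar>x\<bar> < 1 \<Longrightarrow> tanh (artanh x) = (x::real)"
proof -
  assume x: "\<bar>x\<bar> < 1"
  define e where "e = exp (- 2 * artanh x)"
  have "e = (1 - x) / (1 + x)"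
    using x by (simp add: e_def artanh_def exp_minus)
  moreover have "tanh (artanh x) = (1 - e) / (1 + e)" unfolding tanh_real_altdef e_def ..
  moreover have "1 - (1 - x) / (1 + x) = 2 * x / (1 + x)" "1 + (1 - x) / (1 + x) = 2 / (1 + x)"
    using x by (simp_all add: field_simps)
  ultimately show ?thesis using x by simp
qed

lemma tanh_norm_lt_1: "\<bar>tanh (x::real)\<bar> < 1"
  using tanh_real_bounds[of x] by auto

lemma hdist_0: "z \<in> hplane \<Longrightarrow> cmod z = tanh (hdist 0 z / 2)"
proof -
  assume z: "z \<in> hplane"
  define w where "w = (if z = 0 then 1 else sgn z)"
  have w: "cmod w = 1" by (simp add: w_def norm_sgn)
  have zw: "z = of_real (cmod z) * w" by (simp add: w_def sgn_div_norm scaleR_conv_of_real)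
  have "tanh (artanh (cmod z)) = cmod z" using z by (intro tanh_artanh) simp
  then have "hdist 0 z = 2 * \<bar>artanh (cmod z)\<bar>"
    using hdist_radial[OF w, of 0 "artanh (cmod z)"] zw by simp
  moreover have "artanh (cmod z) \<ge> 0"
    using \<open>tanh (artanh (cmod z)) = cmod z\<close> tanh_real_nonneg_iff norm_ge_zero by metis
  ultimately show ?thesis using \<open>tanh (artanh (cmod z)) = cmod z\<close> by simp
qed

text \<open>
  Chords through the origin are radii, so additivity of distance from the origin forces
  proportionality.
\<close>

lemma between_origin:
  assumes a: "a \<in> hplane" and c: "c \<in> hplane" and "hdist 0 c = hdist 0 a + hdist a c"
  obtains r where "0 \<le> r" "a = r *\<^sub>R c"
proof -
  have "klein a \<in> closed_segment (klein 0) (klein c)"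
    using klein_between[of 0 a c] assms by simp
  then obtain u where u: "0 \<le> u" "klein a = u *\<^sub>R klein c" by (auto simp: closed_segment_def klein_def)
  have "a = ((1 + (cmod a)\<^sup>2) / 2) *\<^sub>R klein a" by (rule klein_rescale)
  also have "\<dots> = ((1 + (cmod a)\<^sup>2) / 2 * u * (2 / (1 + (cmod c)\<^sup>2))) *\<^sub>R c"
    unfolding u by (simp add: klein_def)
  finally show ?thesis using u by (intro that[of "(1 + (cmod a)\<^sup>2) / 2 * u * (2 / (1 + (cmod c)\<^sup>2))"]) auto
qed

section \<open>The group of orientation preserving isometries\<close>

text \<open>
  This expression recovers \<open>u\<close> from the values of \<open>mob u b\<close> at two points. It therefore depends
  continuously on an isometry in the topology of pointwise convergence.
\<close>

definition mob_arg :: "(complex \<Rightarrow> complex) \<Rightarrow> complex" where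
  "mob_arg f = 2 * (f (1/2) - f 0) / (1 - cnj (f 0) * f (1/2))"

text \<open>
  The derivative of an isometry, by a formula that also makes sense at ideal points.
\<close>

definition jac :: "(complex \<Rightarrow> complex) \<Rightarrow> complex \<Rightarrow> complex" where
  "jac f z = mob_arg f * of_real (1 - (cmod (f 0))\<^sup>2) / (1 + cnj (f 0) * mob_arg f * z)\<^sup>2"

lemma half_in_hplane: "(1/2::complex) \<in> hplane"
  by (simp add: norm_divide)

lemma mob_0 [simp]: "mob u b 0 = b"
  by (simp add: mob_def)

lemma mob_arg_mob:
  assumes u: "cmod u = 1" and b: "b \<in> hplane"
  shows "mob_arg (mob u b) = u"
proof -
  define h :: complex where "h = 1/2"
  have h: "h \<in> cball 0 1" "2 * h = 1" by (auto simp: h_def norm_divide)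
  define D where "D = 1 + cnj b * u * h"
  have D: "D \<noteq> 0" unfolding D_def by (rule mob_den_nonzero[OF u b h(1)])
  have B: "complex_of_real (1 - (cmod b)\<^sup>2) \<noteq> 0"
    using one_minus_norm_sq_pos[OF b] by (simp only: of_real_eq_0_iff)
  have "mob u b h - b = u * of_real (1 - (cmod b)\<^sup>2) * h / D"
    using mob_diff[OF u b h(1), of 0] by (simp add: D_def)
  moreover have "1 - cnj b * mob u b h = of_real (1 - (cmod b)\<^sup>2) / D"
    using mob_form[OF u b _ h(1), of 0] by (simp add: D_def)
  ultimately have "mob_arg (mob u b) = 2 * h * u"
    using D B unfolding mob_arg_def h_def[symmetric] by simp
  then show ?thesis by (simp add: h)
qed

lemma continuous_on_mob: "cmod u = 1 \<Longrightarrow> b \<in> hplane \<Longrightarrow> continuous_on (cball 0 1) (mob u b)"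
proof -
  assume a: "cmod u = 1" "b \<in> hplane"
  have "continuous_on (cball 0 1) (\<lambda>z. (u * z + b) / (1 + cnj b * u * z))"
    using mob_den_nonzero[OF a] by (intro continuous_intros) auto
  then show ?thesis by (rule continuous_on_eq) (simp add: mob_def)
qed

lemma has_field_derivative_mob:
  assumes a: "cmod u = 1" "b \<in> hplane" and z: "z \<in> hplane"
  shows "(mob u b has_field_derivative (u * of_real (1 - (cmod b)\<^sup>2) / (1 + cnj b * u * z)\<^sup>2)) (at z)"
proof -
  have nz: "1 + cnj b * u * z \<noteq> 0" using mob_den_nonzero[OF a, of z] z by auto
  have bb: "b * cnj b = of_real ((cmod b)\<^sup>2)" by (rule complex_norm_square[symmetric])
  have "((\<lambda>z. (u * z + b) / (1 + cnj b * u * z)) has_field_derivative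
      (u * (1 + cnj b * u * z) - (u * z + b) * (cnj b * u)) / ((1 + cnj b * u * z) * (1 + cnj b * u * z))) (at z)"
    using nz by (auto intro!: derivative_eq_intros)
  also have "u * (1 + cnj b * u * z) - (u * z + b) * (cnj b * u) = u * (1 - b * cnj b)"
    by (simp add: algebra_simps)
  finally have d: "((\<lambda>z. (u * z + b) / (1 + cnj b * u * z)) has_field_derivative
      (u * of_real (1 - (cmod b)\<^sup>2) / (1 + cnj b * u * z)\<^sup>2)) (at z)"
    unfolding bb by (simp add: power2_eq_square)
  show ?thesis
    by (rule DERIV_cong_ev[THEN iffD1, OF refl _ refl d])
      (use z in \<open>auto simp: mob_def eventually_nhds intro!: exI[of _ hplane]\<close>)
qed

lemma mob_in_isom_plus: assumes a: "cmod u = 1" "b \<in> hplane" shows "mob u b \<in> isom_plus"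
proof -
  have "mob u b ` hplane = hplane"
  proof
    show "mob u b ` hplane \<subseteq> hplane" using mob_in_hplane[OF a] by blast
    show "hplane \<subseteq> mob u b ` hplane"
    proof
      fix z :: complex assume z: "z \<in> hplane"
      have "mob (cnj u) (- cnj u * b) z \<in> hplane"
        using a by (intro mob_in_hplane z) (simp_all add: norm_mult)
      then show "z \<in> mob u b ` hplane" using mob_inverse'[OF a, of z] by (metis imageI)
    qed
  qed
  moreover have "mob u b holomorphic_on hplane"
    unfolding holomorphic_on_open[OF open_ball] using has_field_derivative_mob[OF a] by blast
  ultimately show ?thesis
    using hdist_mob[OF a] continuous_on_mob[OF a] by (auto simp: isom_plus_def mob_def)
qed

text \<open>
  After composition with a Moebius map that moves \<open>f 0\<close> back to \<open>0\<close>, the map \<open>f\<close> preserves the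
  distance from \<open>0\<close>, and the equality case of the Schwarz lemma makes it a rotation.
\<close>

lemma isom_plus_imp_mob:
  assumes f: "f \<in> isom_plus"
  obtains u b where "cmod u = 1" "b \<in> hplane" "f = mob u b"
proof -
  define b where "b = f 0"
  have im: "f ` hplane = hplane" and iso: "\<And>z w. z \<in> hplane \<Longrightarrow> w \<in> hplane \<Longrightarrow> hdist (f z) (f w) = hdist z w"
    and hol: "f holomorphic_on hplane" and cont: "continuous_on (cball 0 1) f" and out: "\<And>z. z \<notin> cball 0 1 \<Longrightarrow> f z = z"
    using f by (auto simp: isom_plus_def)
  have b: "b \<in> hplane" using im by (auto simp: b_def)
  have one: "cmod 1 = 1" and mb: "- b \<in> hplane" using b by auto
  define \<phi> where "\<phi> = mob 1 (- b) \<circ> f"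
  have holm: "mob 1 (- b) holomorphic_on hplane"
    using mob_in_isom_plus[OF one mb] by (auto simp: isom_plus_def)
  have hol\<phi>: "\<phi> holomorphic_on ball 0 1"
    unfolding \<phi>_def using holomorphic_on_compose_gen[OF hol holm] im by auto
  have \<phi>0: "\<phi> 0 = 0"
    using b by (simp add: \<phi>_def b_def[symmetric] mob_def)
  have in\<phi>: "\<phi> z \<in> hplane" if "z \<in> hplane" for z
  proof -
    have "f z \<in> hplane" using im that by blast
    then show ?thesis using mob_in_hplane[OF one mb] by (simp only: \<phi>_def comp_apply)
  qed
  have norm\<phi>: "cmod (\<phi> z) = cmod z" if z: "z \<in> hplane" for z
  proof -
    have fz: "f z \<in> hplane" "f 0 \<in> hplane" using im z b unfolding b_def by blast+
    have "hdist 0 (\<phi> z) = hdist (\<phi> 0) (\<phi> z)" by (simp add: \<phi>0)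
    also have "\<dots> = hdist (f 0) (f z)" using hdist_mob[OF one mb fz(2) fz(1)] by (simp add: \<phi>_def)
    also have "\<dots> = hdist 0 z" using iso z by simp
    finally show ?thesis using hdist_0[OF in\<phi>[OF z]] hdist_0[OF z] by simp
  qed
  have "\<exists>\<alpha>. (\<forall>z. cmod z < 1 \<longrightarrow> \<phi> z = \<alpha> * z) \<and> cmod \<alpha> = 1"
  proof (rule Schwarz_Lemma(3)[OF hol\<phi> \<phi>0])
    show "cmod (\<phi> z) < 1" if "cmod z < 1" for z using in\<phi>[of z] that by simp
    show "cmod (0::complex) < 1" by simp
    show "(\<exists>z. cmod z < 1 \<and> z \<noteq> 0 \<and> cmod (\<phi> z) = cmod z) \<or> cmod (deriv \<phi> 0) = 1"
      by (intro disjI1 exI[of _ "1/2"] conjI norm\<phi>[OF half_in_hplane]) (simp_all add: norm_divide)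
  qed
  then obtain u where u: "cmod u = 1" "\<And>z. cmod z < 1 \<Longrightarrow> \<phi> z = u * z" by blast
  have eq: "f z = mob u b z" if z: "z \<in> hplane" for z
  proof -
    have "f z = mob 1 b (\<phi> z)" using mob_inverse'[OF one b, of "f z"] by (simp add: \<phi>_def)
    also have "\<dots> = mob u b z" using z u by (auto simp: mob_def norm_mult)
    finally show ?thesis .
  qed
  have "f z = mob u b z" for z
  proof (cases "z \<in> cball 0 1")
    case True
    have "f z - mob u b z = 0"
    proof (rule continuous_constant_on_closure[where S = "hplane" and f = "\<lambda>z. f z - mob u b z" and a = 0])
      show "continuous_on (closure hplane) (\<lambda>z. f z - mob u b z)"
        using cont continuous_on_mob[OF u(1) b] by (simp add: continuous_on_diff)
      show "f z - mob u b z = 0" if "z \<in> hplane" for z using eq[OF that] by simp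
      show "z \<in> closure hplane" using True by simp
    qed
    then show ?thesis by simp
  qed (simp add: out mob_def)
  then show ?thesis using u(1) b that by blast
qed

lemma isom_plusE:
  assumes "f \<in> isom_plus"
  shows "cmod (mob_arg f) = 1" "f 0 \<in> hplane" "f = mob (mob_arg f) (f 0)"
  using isom_plus_imp_mob[OF assms] by (metis mob_0 mob_arg_mob)+

lemma isom_plus_eq: "f \<in> isom_plus \<Longrightarrow> z \<in> cball 0 1 \<Longrightarrow>
    f z = (mob_arg f * z + f 0) / (1 + cnj (f 0) * mob_arg f * z)"
  using isom_plusE(3)[of f] by (metis mob_def)

lemma isom_plus_den_nonzero: "f \<in> isom_plus \<Longrightarrow> z \<in> cball 0 1 \<Longrightarrow> 1 + cnj (f 0) * mob_arg f * z \<noteq> 0"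
  using isom_plusE mob_den_nonzero by blast

lemma isom_plus_Re_den: "f \<in> isom_plus \<Longrightarrow> z \<in> cball 0 1 \<Longrightarrow> 0 < Re (1 + cnj (f 0) * mob_arg f * z)"
  using isom_plusE Re_mob_den by blast

lemma isom_plus_out: "f \<in> isom_plus \<Longrightarrow> z \<notin> cball 0 1 \<Longrightarrow> f z = z"
  by (simp add: isom_plus_def)

lemma isom_plus_cball: "f \<in> isom_plus \<Longrightarrow> z \<in> cball 0 1 \<Longrightarrow> f z \<in> cball 0 1"
  using isom_plusE mob_in_cball by metis

lemma isom_plus_hplane: "f \<in> isom_plus \<Longrightarrow> z \<in> hplane \<Longrightarrow> f z \<in> hplane"
  by (auto simp: isom_plus_def)

lemma deriv_isom_plus: "f \<in> isom_plus \<Longrightarrow> z \<in> hplane \<Longrightarrow> (f has_field_derivative jac f z) (at z)"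
  using isom_plusE[of f] has_field_derivative_mob[of "mob_arg f" "f 0" z] by (simp add: jac_def)

lemma norm_jac_pos_eq: "f \<in> isom_plus \<Longrightarrow> z \<in> cball 0 1 \<Longrightarrow>
   1 - (cmod (f z))\<^sup>2 = cmod (jac f z) * (1 - (cmod z)\<^sup>2)"
  using mob_norm_form[of "mob_arg f" "f 0" z] isom_plusE[of f] one_minus_norm_sq_pos[of "f 0"]
  by (simp add: jac_def norm_divide norm_mult norm_power del: of_real_power of_real_diff)

lemma jac_nonzero: "f \<in> isom_plus \<Longrightarrow> z \<in> cball 0 1 \<Longrightarrow> jac f z \<noteq> 0"
  using isom_plusE[of f] one_minus_norm_sq_pos[of "f 0"] isom_plus_den_nonzero[of f z]
  by (auto simp: jac_def simp del: of_real_power of_real_diff)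

lemma continuous_on_jac: "f \<in> isom_plus \<Longrightarrow> continuous_on (cball 0 1) (jac f)"
  unfolding jac_def using isom_plus_den_nonzero by (intro continuous_intros) auto

lemma id_in_isom_plus: "id \<in> isom_plus"
  by (auto simp: isom_plus_def)

lemma comp_in_isom_plus: 
  assumes f: "f \<in> isom_plus" and h: "h \<in> isom_plus" shows "f \<circ> h \<in> isom_plus"
proof -
  have sub: "h ` cball 0 1 \<subseteq> cball 0 1" using isom_plus_cball[OF h] by blast
  have "continuous_on (cball 0 1) (f \<circ> h)"
  proof (rule continuous_on_compose)
    show "continuous_on (cball 0 1) h" using h by (simp add: isom_plus_def)
    have "continuous_on (cball 0 1) f" using f by (simp add: isom_plus_def)
    then show "continuous_on (h ` cball 0 1) f" using sub by (rule continuous_on_subset)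
  qed
  moreover have "(f \<circ> h) holomorphic_on hplane"
    using f h unfolding isom_plus_def by (auto intro!: holomorphic_on_compose_gen)
  moreover have "(f \<circ> h) ` hplane = hplane" using f h unfolding isom_plus_def image_comp[symmetric] by simp
  moreover have "hdist (f (h z)) (f (h w)) = hdist z w" if "z \<in> hplane" "w \<in> hplane" for z w
    using f h that isom_plus_hplane[OF h] by (simp add: isom_plus_def)
  ultimately show ?thesis using isom_plus_out[OF f] isom_plus_out[OF h] by (simp add: isom_plus_def)
qed

text \<open>
  The chain rule, carried over to ideal points by continuity.
\<close>

lemma jac_comp:
  assumes f: "f \<in> isom_plus" and h: "h \<in> isom_plus" and z: "z \<in> cball 0 1"
  shows "jac (f \<circ> h) z = jac f (h z) * jac h z"
proof -
  have "jac (f \<circ> h) z - jac f (h z) * jac h z = 0"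
  proof (rule continuous_constant_on_closure[where S = "hplane" and f = "\<lambda>z. jac (f \<circ> h) z - jac f (h z) * jac h z" and a = 0])
    have "h ` cball 0 1 \<subseteq> cball 0 1" using isom_plus_cball[OF h] by blast
    then have "continuous_on (h ` cball 0 1) (jac f)"
      using continuous_on_jac[OF f] continuous_on_subset by blast
    moreover have "continuous_on (cball 0 1) h" using h by (simp add: isom_plus_def)
    ultimately have "continuous_on (cball 0 1) (\<lambda>z. jac f (h z))"
      using continuous_on_compose[of "cball 0 1" h "jac f"] by (simp add: comp_def)
    then show "continuous_on (closure hplane) (\<lambda>z. jac (f \<circ> h) z - jac f (h z) * jac h z)"
      using continuous_on_jac[OF comp_in_isom_plus[OF f h]] continuous_on_jac[OF h]
      by (simp add: continuous_on_diff continuous_on_mult)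
    show "jac (f \<circ> h) z - jac f (h z) * jac h z = 0" if "z \<in> hplane" for z
    proof -
      have "((f \<circ> h) has_field_derivative jac f (h z) * jac h z) (at z)"
        using DERIV_chain[of f _ h] deriv_isom_plus isom_plus_hplane f h that by blast
      then show ?thesis
        using deriv_isom_plus[OF comp_in_isom_plus[OF f h] that] DERIV_unique by force
    qed
  qed (use z in auto)
  then show ?thesis by simp
qed

lemma inverse_in_isom_plus:
  assumes "f \<in> isom_plus"
  shows "mob (cnj (mob_arg f)) (- cnj (mob_arg f) * f 0) \<in> isom_plus"
    "mob (cnj (mob_arg f)) (- cnj (mob_arg f) * f 0) \<circ> f = id"
proof -
  note f = isom_plusE[OF assms]
  show "mob (cnj (mob_arg f)) (- cnj (mob_arg f) * f 0) \<in> isom_plus"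
    using f by (intro mob_in_isom_plus) (simp_all add: norm_mult)
  show "mob (cnj (mob_arg f)) (- cnj (mob_arg f) * f 0) \<circ> f = id"
    using mob_inverse[OF f(1,2)] f(3) by (metis comp_apply eq_id_iff)
qed

lemma group_PSL2R: "group PSL2R"
proof (rule groupI)
  fix f assume "f \<in> carrier PSL2R"
  then show "\<exists>h\<in>carrier PSL2R. h \<otimes>\<^bsub>PSL2R\<^esub> f = \<one>\<^bsub>PSL2R\<^esub>"
    using inverse_in_isom_plus[of f] by (auto simp: PSL2R_def)
qed (auto simp: PSL2R_def comp_in_isom_plus id_in_isom_plus comp_assoc)

interpretation PSL: group PSL2R by (rule group_PSL2R)

lemma carrier_PSL2R [simp]: "carrier PSL2R = isom_plus"
  and mult_PSL2R [simp]: "f \<otimes>\<^bsub>PSL2R\<^esub> h = f \<circ> h"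
  and one_PSL2R [simp]: "\<one>\<^bsub>PSL2R\<^esub> = id"
  by (simp_all add: PSL2R_def)

lemma inv_PSL2R: "f \<in> isom_plus \<Longrightarrow> inv\<^bsub>PSL2R\<^esub> f = mob (cnj (mob_arg f)) (- cnj (mob_arg f) * f 0)"
  using PSL.inv_equality[of "mob (cnj (mob_arg f)) (- cnj (mob_arg f) * f 0)" f] inverse_in_isom_plus[of f] by simp

lemma inv_PSL2R_apply:
  assumes "f \<in> isom_plus"
  shows "(inv\<^bsub>PSL2R\<^esub> f) (f z) = z" "f ((inv\<^bsub>PSL2R\<^esub> f) z) = z"
  using PSL.l_inv[of f] PSL.r_inv[of f] assms by (simp_all add: fun_eq_iff)

lemma continuous_on_eval: "continuous_on S g \<Longrightarrow> continuous_on S (\<lambda>t. g t z)"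
  by (rule continuous_on_product_then_coordinatewise)

lemma continuous_on_mob_arg:
  assumes g: "continuous_on S g" "g ` S \<subseteq> isom_plus"
  shows "continuous_on S (\<lambda>t. mob_arg (g t))"
  unfolding mob_arg_def
proof (intro continuous_on_divide continuous_on_diff continuous_on_mult continuous_on_cnj continuous_on_const
      continuous_on_eval[OF g(1)] ballI)
  fix t assume "t \<in> S"
  then have f: "g t \<in> isom_plus" using g by auto
  have "cmod (g t 0) < 1" "cmod (g t (1/2)) < 1"
    using isom_plus_hplane[OF f, of 0] isom_plus_hplane[OF f half_in_hplane] by auto
  then have "cmod (cnj (g t 0) * g t (1/2)) < 1"
    using mult_left_le[of "cmod (g t (1/2))" "cmod (g t 0)"] by (simp add: norm_mult)
  then show "1 - cnj (g t 0) * g t (1 / 2) \<noteq> 0" by auto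
qed

text \<open>
  The parameters of an isometry are continuous in it, and the value at a point is a rational
  expression in them and the point. Hence evaluation, composition and inversion are jointly
  continuous.
\<close>

lemma continuous_on_isom_apply:
  assumes g: "continuous_on S g" "g ` S \<subseteq> isom_plus" and w: "continuous_on S w" "w ` S \<subseteq> cball 0 1"
  shows "continuous_on S (\<lambda>t. g t (w t))"
proof -
  have "continuous_on S (\<lambda>t. (mob_arg (g t) * w t + g t 0) / (1 + cnj (g t 0) * mob_arg (g t) * w t))"
    using isom_plus_den_nonzero g(2) w(2)
    by (intro continuous_on_divide continuous_on_add continuous_on_mult continuous_on_cnj continuous_on_const
      continuous_on_eval[OF g(1)] continuous_on_mob_arg[OF g] w(1))
      (auto simp: image_subset_iff)
  then show ?thesis 
    by (rule continuous_on_eq) (rule isom_plus_eq[symmetric], use g(2) w(2) in \<open>blast+\<close>)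
qed

lemma continuous_on_isom_comp:
  assumes g: "continuous_on S g" "g ` S \<subseteq> isom_plus" and h: "continuous_on S h" "h ` S \<subseteq> isom_plus"
  shows "continuous_on S (\<lambda>t. g t \<circ> h t)"
proof (rule continuous_on_coordinatewise_then_product)
  fix z
  show "continuous_on S (\<lambda>t. (g t \<circ> h t) z)"
  proof (cases "z \<in> cball 0 1")
    case True
    show ?thesis unfolding comp_def
    proof (rule continuous_on_isom_apply[OF g])
      show "continuous_on S (\<lambda>t. h t z)" using h(1) by (rule continuous_on_eval)
      show "(\<lambda>t. h t z) ` S \<subseteq> cball 0 1" using h(2) isom_plus_cball[OF _ True] by blast
    qed
  next
    case False
    have "(g t \<circ> h t) z = z" if "t \<in> S" for t
      using isom_plus_out[OF _ False, of "h t"] isom_plus_out[OF _ False, of "g t"] g(2) h(2) that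
      by (simp add: image_subset_iff)
    then show ?thesis by (simp cong: continuous_on_cong)
  qed
qed

lemma continuous_on_isom_inv:
  assumes g: "continuous_on S g" "g ` S \<subseteq> isom_plus"
  shows "continuous_on S (\<lambda>t. inv\<^bsub>PSL2R\<^esub> (g t))"
proof (rule continuous_on_coordinatewise_then_product)
  fix z
  show "continuous_on S (\<lambda>t. (inv\<^bsub>PSL2R\<^esub> (g t)) z)"
  proof (cases "z \<in> cball 0 1")
    case z: True
    have "continuous_on S (\<lambda>t. (cnj (mob_arg (g t)) * z + - cnj (mob_arg (g t)) * g t 0) /
       (1 + cnj (- cnj (mob_arg (g t)) * g t 0) * cnj (mob_arg (g t)) * z))"
    proof (intro continuous_on_divide continuous_on_add continuous_on_mult continuous_on_cnj continuous_on_const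
      continuous_on_minus continuous_on_eval[OF g(1)] continuous_on_mob_arg[OF g] ballI)
      fix t assume "t \<in> S"
      then have f: "g t \<in> isom_plus" using g by auto
      show "1 + cnj (- cnj (mob_arg (g t)) * g t 0) * cnj (mob_arg (g t)) * z \<noteq> 0"
        using isom_plusE[OF f] by (intro mob_den_nonzero z) (simp_all add: norm_mult)
    qed
    then show ?thesis by (rule continuous_on_eq) (use z g in \<open>auto simp: inv_PSL2R image_subset_iff mob_def\<close>)
  next
    case False
    have "continuous_on S (\<lambda>t. z)" by simp
    then show ?thesis by (rule continuous_on_eq) (use False g in \<open>auto simp: inv_PSL2R image_subset_iff mob_def\<close>)
  qed
qed

lemma continuous_on_jac_path:
  assumes g: "continuous_on S g" "g ` S \<subseteq> isom_plus" and z: "continuous_on S z" "z ` S \<subseteq> cball 0 1"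
  shows "continuous_on S (\<lambda>t. jac (g t) (z t))"
  unfolding jac_def using isom_plus_den_nonzero g(2) z(2)
  by (intro continuous_on_divide continuous_on_add continuous_on_mult continuous_on_cnj continuous_on_const
      continuous_on_power continuous_on_of_real continuous_on_diff continuous_on_norm
      continuous_on_eval[OF g(1)] continuous_on_mob_arg[OF g] z(1)) (auto simp: image_subset_iff)

section \<open>Turning of geodesics\<close>

lemma cis_eq_imp_eq:
  assumes "cis a = cis b" "\<bar>a - b\<bar> < 2 * pi"
  shows "a = b"
proof -
  have "cis (a - b) = 1" using assms(1) by (simp flip: cis_divide)
  then have "cos (a - b) = 1" by (metis cis.simps(1) one_complex.simps(1))
  then obtain n where n: "a - b = of_int n * 2 * pi" using cos_one_2pi_int by blast
  then have "\<bar>of_int n\<bar> * (2 * pi) < 1 * (2 * pi)" using assms(2) by (simp add: abs_mult)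
  then have "\<bar>real_of_int n\<bar> < 1" by (subst (asm) mult_less_cancel_right_pos) auto
  then have "n = 0" by linarith
  then show ?thesis using n by simp
qed

lemma Arg_Re_nonneg: "0 \<le> Re z \<Longrightarrow> \<bar>Arg z\<bar> \<le> pi / 2"
  using Re_Ln_pos_le[of z] by (cases "z = 0") (auto simp: Arg_eq_Im_Ln Arg_zero)

lemma Arg_Re_pos: "0 < Re z \<Longrightarrow> \<bar>Arg z\<bar> < pi / 2"
  using Re_Ln_pos_lt[of z] by (cases "z = 0") (auto simp: Arg_eq_Im_Ln)

lemma Re_one_minus_nonneg: "x \<in> cball 0 1 \<Longrightarrow> y \<in> cball 0 1 \<Longrightarrow> 0 \<le> Re (1 - cnj x * y)"
proof -
  assume a: "x \<in> cball 0 1" "y \<in> cball 0 1"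
  have "cmod (cnj x * y) \<le> 1" using a mult_mono[of "cmod x" 1 "cmod y" 1] by (simp add: norm_mult)
  then show ?thesis using complex_Re_le_cmod[of "cnj x * y"] by simp
qed

lemma one_minus_cnj_mult_eq_0:
  assumes x: "x \<in> cball 0 1" and y: "y \<in> cball 0 1" and "1 - cnj x * y = 0"
  shows "x = y" "cmod x = 1"
proof -
  have e: "cnj x * y = 1" using assms(3) by simp
  then have n: "cmod x * cmod y = 1" by (metis complex_mod_cnj norm_mult norm_one)
  then have "cmod x \<ge> 1" using x y mult_mono[of "cmod x" "cmod x" "cmod y" 1] by simp
  then show "cmod x = 1" using x by simp
  then have "x * cnj x = 1" by (simp add: complex_mult_cnj cmod_power2[symmetric])
  then have "y = x * (cnj x * y)" by (simp add: mult.assoc[symmetric])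
  then show "x = y" using e by simp
qed

lemma one_minus_cnj_not_nonpos:
  assumes "x \<in> cball 0 1" "y \<in> cball 0 1" "x \<noteq> y"
  shows "1 - cnj x * y \<notin> \<real>\<^sub>\<le>\<^sub>0"
proof -
  have "1 - cnj x * y \<noteq> 0" using one_minus_cnj_mult_eq_0(1)[OF assms(1,2)] assms(3) by blast
  then show ?thesis using Re_one_minus_nonneg[OF assms(1,2)]
    by (metis complex_nonpos_Reals_iff complex_eq_iff order_antisym zero_complex.simps)
qed

lemma tendsto_turn:
  assumes "(f \<longlongrightarrow> a) F" "(g \<longlongrightarrow> b) F" "a \<in> cball 0 1" "b \<in> cball 0 1" "a \<noteq> b"
  shows "((\<lambda>n. turn (f n) (g n)) \<longlongrightarrow> turn a b) F"
  unfolding turn_def using assms by (intro tendsto_mult_left tendsto_Arg tendsto_intros one_minus_cnj_not_nonpos)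

text \<open>
  An isometry \<open>f\<close> maps the geodesic from \<open>x\<close> to \<open>y\<close> to the geodesic from \<open>f x\<close> to \<open>f y\<close> and
  changes the Euclidean directions at its ends by the arguments of \<open>jac f x\<close> and \<open>jac f y\<close>.
  By \<open>mob_form\<close> the two sides agree modulo \<open>4 * pi\<close>, and all arguments are those of
  numbers in the right half plane, which is too little room for a nontrivial multiple.
\<close>

lemma turn_isom:
  assumes f: "f \<in> isom_plus" and x: "x \<in> cball 0 1" and y: "y \<in> cball 0 1"
  shows "turn (f x) (f y) = turn x y + 2 * Arg (1 + cnj (f 0) * mob_arg f * x) - 2 * Arg (1 + cnj (f 0) * mob_arg f * y)"
proof -
  define X Y where XY: "X = 1 + cnj (f 0) * mob_arg f * x" "Y = 1 + cnj (f 0) * mob_arg f * y"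
  note F = isom_plusE[OF f]
  have form: "1 - cnj (f x) * f y = of_real (1 - (cmod (f 0))\<^sup>2) * (1 - cnj x * y) / (cnj X * Y)"
    using mob_form[OF F(1,2) x y] F(3) XY by metis
  show ?thesis
  proof (cases "1 - cnj x * y = 0")
    case True
    then have "x = y" using one_minus_cnj_mult_eq_0[OF x y] by simp
    then show ?thesis unfolding turn_def form True by (simp add: Arg_zero)
  next
    case False
    have R: "0 < Re X" "0 < Re Y" unfolding XY using isom_plus_Re_den[OF f] x y by auto
    then have nz: "X \<noteq> 0" "Y \<noteq> 0" by auto
    have c: "1 - (cmod (f 0))\<^sup>2 > 0" using one_minus_norm_sq_pos[OF F(2)] .
    have rep: "w = of_real (cmod w) * cis (Arg w)" for w
      using rcis_cmod_Arg[of w] by (simp add: rcis_def)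
    have cX: "cnj X = of_real (cmod X) * cis (- Arg X)"
      by (subst rep[of X]) (simp add: cis_cnj)
    define r where "r = (1 - (cmod (f 0))\<^sup>2) * cmod (1 - cnj x * y) / (cmod X * cmod Y)"
    have r: "r > 0" using c nz False unfolding r_def by (intro divide_pos_pos mult_pos_pos) auto
    have "1 - cnj (f x) * f y = of_real r * (cis (Arg (1 - cnj x * y)) / (cis (- Arg X) * cis (Arg Y)))"
      unfolding form unfolding cX by (subst rep[of "1 - cnj x * y"], subst rep[of Y]) (simp add: r_def mult_ac)
    also have "\<dots> = of_real r * cis (Arg (1 - cnj x * y) + Arg X - Arg Y)"
      unfolding cis_mult cis_divide by (simp add: diff_diff_eq2 add.commute diff_add_eq)
    finally have e: "1 - cnj (f x) * f y = of_real r * cis (Arg (1 - cnj x * y) + Arg X - Arg Y)" .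
    then have "sgn (1 - cnj (f x) * f y) = cis (Arg (1 - cnj x * y) + Arg X - Arg Y)"
      using r by (simp add: sgn_mult sgn_of_real)
    moreover have "1 - cnj (f x) * f y \<noteq> 0" using e r by auto
    ultimately have "cis (Arg (1 - cnj (f x) * f y)) = cis (Arg (1 - cnj x * y) + Arg X - Arg Y)"
      by (simp add: cis_Arg)
    moreover have "\<bar>Arg (1 - cnj (f x) * f y)\<bar> \<le> pi / 2" "\<bar>Arg (1 - cnj x * y)\<bar> \<le> pi / 2"
      using Re_one_minus_nonneg x y isom_plus_cball[OF f] Arg_Re_nonneg by blast+
    moreover have "\<bar>Arg X\<bar> < pi / 2" "\<bar>Arg Y\<bar> < pi / 2" using R Arg_Re_pos by auto
    ultimately have "Arg (1 - cnj (f x) * f y) = Arg (1 - cnj x * y) + Arg X - Arg Y"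
      by (intro cis_eq_imp_eq) (assumption, linarith)
    then show ?thesis by (simp add: turn_def XY)
  qed
qed

section \<open>Variation of the argument along a path\<close>

text \<open>
  The total change of the argument of a path in \<open>\<complex> - {0}\<close>. As a winding number it is defined
  for every path and is a homotopy invariant.
\<close>

definition argvar :: "(real \<Rightarrow> complex) \<Rightarrow> real" where
  "argvar v = 2 * pi * Re (winding_number v 0)"

lemma argvar_cong: "(\<And>t. t \<in> {0..1} \<Longrightarrow> v t = w t) \<Longrightarrow> argvar v = argvar w"
  unfolding argvar_def using winding_number_cong[of v w 0] by simp

lemma argvar_homotopic: "homotopic_paths (- {0}) v w \<Longrightarrow> argvar v = argvar w"
  unfolding argvar_def using winding_number_homotopic_paths by metis

lemma argvar_lift:
  assumes r: "continuous_on {0..1} r" "\<And>t. t \<in> {0..1} \<Longrightarrow> 0 < r t" and \<theta>: "continuous_on {0..1} \<theta>"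
    and v: "\<And>t. t \<in> {0..1} \<Longrightarrow> v t = of_real (r t) * cis (\<theta> t)"
  shows "argvar v = \<theta> 1 - \<theta> 0"
proof -
  define q where "q t = of_real (ln (r t)) + \<i> * of_real (\<theta> t)" for t
  have "continuous_on {0..1} (\<lambda>t. ln (r t))"
    using r by (intro continuous_on_ln) force+
  then have q: "path q"
    unfolding path_def q_def
    by (intro continuous_on_add continuous_on_mult continuous_on_const continuous_on_of_real \<theta>)
  have "exp (q t) = v t" if "t \<in> {0..1}" for t
    unfolding q_def v[OF that] exp_add cis_conv_exp using r(2)[OF that] by (simp add: exp_of_real)
  then have "argvar v = argvar (exp \<circ> q)" by (intro argvar_cong) simp
  also have "\<dots> = 2 * pi * Re ((q 1 - q 0) / (2 * of_real pi * \<i>))"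
    by (simp add: argvar_def winding_number_compose_exp[OF q] pathfinish_def pathstart_def)
  also have "\<dots> = Im (q 1 - q 0)"
    by (simp add: Re_divide power2_eq_square)
  finally show ?thesis by (simp add: q_def)
qed

lemma argvar_lift_exists:
  assumes "path v" "0 \<notin> path_image v"
  obtains \<theta> where "continuous_on {0..1} \<theta>" "\<And>t. t \<in> {0..1} \<Longrightarrow> v t = of_real (cmod (v t)) * cis (\<theta> t)"
    "argvar v = \<theta> 1 - \<theta> 0"
proof -
  obtain q where q: "path q" "\<And>t. t \<in> {0..1} \<Longrightarrow> v t = 0 + exp (q t)"
    using winding_number_as_continuous_log[OF assms] by metis
  have c: "continuous_on {0..1} (\<lambda>t. Im (q t))" using q(1) unfolding path_def by (intro continuous_intros)
  have e: "v t = of_real (cmod (v t)) * cis (Im (q t))" if "t \<in> {0..1}" for t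
    
  proof -
    have "v t = of_real (exp (Re (q t))) * cis (Im (q t))" using q(2)[OF that] by (simp add: exp_eq_polar)
    moreover from this have "cmod (v t) = exp (Re (q t))" by (simp add: norm_mult)
    ultimately show ?thesis by simp
  qed
  have n: "continuous_on {0..1} (\<lambda>t. cmod (v t))" using assms(1) unfolding path_def by (intro continuous_intros)
  have p: "0 < cmod (v t)" if "t \<in> {0..1}" for t using q(2)[OF that] by simp
  show ?thesis using argvar_lift[OF n p c e] c e that by blast
qed

lemma argvar_mult:
  assumes "path v" "0 \<notin> path_image v" "path w" "0 \<notin> path_image w"
  shows "argvar (\<lambda>t. v t * w t) = argvar v + argvar w"
proof -
  obtain \<theta> where \<theta>: "continuous_on {0..1} \<theta>" "\<And>t. t \<in> {0..1} \<Longrightarrow> v t = of_real (cmod (v t)) * cis (\<theta> t)"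
    "argvar v = \<theta> 1 - \<theta> 0" using argvar_lift_exists assms(1,2) by blast
  obtain \<psi> where \<psi>: "continuous_on {0..1} \<psi>" "\<And>t. t \<in> {0..1} \<Longrightarrow> w t = of_real (cmod (w t)) * cis (\<psi> t)"
    "argvar w = \<psi> 1 - \<psi> 0" using argvar_lift_exists assms(3,4) by blast
  have "argvar (\<lambda>t. v t * w t) = (\<theta> 1 + \<psi> 1) - (\<theta> 0 + \<psi> 0)"
  proof (rule argvar_lift[of "\<lambda>t. cmod (v t) * cmod (w t)"])
    show "continuous_on {0..1} (\<lambda>t. cmod (v t) * cmod (w t))"
      using assms unfolding path_def by (intro continuous_intros)
    show "0 < cmod (v t) * cmod (w t)" if "t \<in> {0..1}" for t
      using that assms(2,4) by (auto simp: path_image_def intro!: mult_pos_pos)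
    show "continuous_on {0..1} (\<lambda>t. \<theta> t + \<psi> t)" using \<theta> \<psi> by (intro continuous_intros)
    show "v t * w t = of_real (cmod (v t) * cmod (w t)) * cis (\<theta> t + \<psi> t)" if "t \<in> {0..1}" for t
      by (subst \<theta>(2)[OF that], subst \<psi>(2)[OF that]) (simp add: cis_mult[symmetric] mult_ac)
  qed
  then show ?thesis using \<theta>(3) \<psi>(3) by simp
qed

lemma argvar_right_half_plane:
  assumes "path v" "\<And>t. t \<in> {0..1} \<Longrightarrow> 0 < Re (v t)"
  shows "argvar v = Arg (v 1) - Arg (v 0)"
proof (rule argvar_lift[of "\<lambda>t. cmod (v t)"])
  have nz: "v t \<noteq> 0" if "t \<in> {0..1}" for t using assms(2)[OF that] by auto
  show "continuous_on {0..1} (\<lambda>t. cmod (v t))" using assms unfolding path_def by (intro continuous_intros)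
  show "0 < cmod (v t)" if "t \<in> {0..1}" for t using nz[OF that] by simp
  have "v t \<notin> \<real>\<^sub>\<le>\<^sub>0" if "t \<in> {0..1}" for t using assms(2)[OF that] by (auto simp: complex_nonpos_Reals_iff)
  then have "continuous_on {0..1} (\<lambda>t. Im (Ln (v t)))"
    using assms(1) unfolding path_def by (intro continuous_intros) auto
  then show "continuous_on {0..1} (\<lambda>t. Arg (v t))"
    by (rule continuous_on_eq) (simp add: Arg_eq_Im_Ln nz)
  show "v t = of_real (cmod (v t)) * cis (Arg (v t))" if "t \<in> {0..1}" for t
    using rcis_cmod_Arg[of "v t"] by (simp add: rcis_def)
qed

section \<open>The universal covering group\<close>

text \<open>
  The elements of the covering group are the classes of these paths. All of its structure is
  computed on representatives.
\<close>

definition paths_from_id :: "(real \<Rightarrow> complex \<Rightarrow> complex) set" where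
  "paths_from_id = {g. path g \<and> path_image g \<subseteq> isom_plus \<and> pathstart g = id}"

definition pclass :: "(real \<Rightarrow> complex \<Rightarrow> complex) \<Rightarrow> isom_path_class" where
  "pclass g = isom_homotopy `` {g}"

lemma mem_pclass: "h \<in> pclass g \<longleftrightarrow> homotopic_paths isom_plus g h"
  by (simp add: pclass_def isom_homotopy_def)

lemma pclass_eq: "homotopic_paths isom_plus g h \<Longrightarrow> pclass g = pclass h"
  unfolding set_eq_iff mem_pclass by (meson homotopic_paths_trans homotopic_paths_sym)

lemma paths_from_idD:
  assumes "g \<in> paths_from_id"
  shows "continuous_on {0..1} g" "g ` {0..1} \<subseteq> isom_plus" "g 0 = id" "g 1 \<in> isom_plus"
  using assms by (auto simp: paths_from_id_def path_def path_image_def pathstart_def)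

lemma paths_from_idI: "continuous_on {0..1} g \<Longrightarrow> g ` {0..1} \<subseteq> isom_plus \<Longrightarrow> g 0 = id \<Longrightarrow> g \<in> paths_from_id"
  by (simp add: paths_from_id_def path_def path_image_def pathstart_def)

lemma self_in_pclass: "g \<in> paths_from_id \<Longrightarrow> g \<in> pclass g"
  by (simp add: mem_pclass paths_from_id_def)

lemma pclass_member: "g \<in> paths_from_id \<Longrightarrow> h \<in> pclass g \<Longrightarrow> h \<in> paths_from_id \<and> h 1 = g 1"
  using homotopic_paths_imp_path[of isom_plus g h] homotopic_paths_imp_subset[of isom_plus g h]
    homotopic_paths_imp_pathstart[of isom_plus g h] homotopic_paths_imp_pathfinish[of isom_plus g h]
  by (simp add: mem_pclass paths_from_id_def pathfinish_def)

lemma carrier_cover: "carrier cover_PSL2R = pclass ` paths_from_id"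
  by (auto simp: cover_PSL2R_def quotient_def pclass_def paths_from_id_def)

lemma homotopic_paths_comp:
  assumes "homotopic_paths isom_plus g g'" "homotopic_paths isom_plus h h'"
  shows "homotopic_paths isom_plus (\<lambda>t. g t \<circ> h t) (\<lambda>t. g' t \<circ> h' t)"
proof -
  let ?I = "{0..1::real} \<times> {0..1::real}"
  obtain H where H: "continuous_on ?I H" "H ` ?I \<subseteq> isom_plus" "\<forall>x \<in> {0..1}. H (0,x) = g x" "\<forall>x \<in> {0..1}. H (1,x) = g' x"
     "\<forall>t \<in> {0..1::real}. H (t, 0) = g 0 \<and> H (t, 1) = g 1"
    using assms(1) unfolding homotopic_paths by (auto simp: pathstart_def pathfinish_def image_subset_iff_funcset)
  obtain K where K: "continuous_on ?I K" "K ` ?I \<subseteq> isom_plus" "\<forall>x \<in> {0..1}. K (0,x) = h x" "\<forall>x \<in> {0..1}. K (1,x) = h' x"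
     "\<forall>t \<in> {0..1::real}. K (t, 0) = h 0 \<and> K (t, 1) = h 1"
    using assms(2) unfolding homotopic_paths by (auto simp: pathstart_def pathfinish_def image_subset_iff_funcset)
  have "continuous_on ?I (\<lambda>x. H x \<circ> K x)"
    by (rule continuous_on_isom_comp[OF H(1,2) K(1,2)])
  moreover have "(\<lambda>x. H x \<circ> K x) \<in> ?I \<rightarrow> isom_plus"
    using H(2) K(2) by (intro funcsetI comp_in_isom_plus) blast+
  ultimately show ?thesis unfolding homotopic_paths using H K
    by (intro exI[of _ "\<lambda>x. H x \<circ> K x"]) (simp add: pathstart_def pathfinish_def)
qed

lemma comp_paths_from_id:
  assumes "g \<in> paths_from_id" "h \<in> paths_from_id"
  shows "(\<lambda>t. g t \<circ> h t) \<in> paths_from_id"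
  using paths_from_idD[OF assms(1)] paths_from_idD[OF assms(2)]
  by (intro paths_from_idI continuous_on_isom_comp) (auto intro!: comp_in_isom_plus)

lemma mult_pclass:
  assumes "g \<in> paths_from_id" "h \<in> paths_from_id"
  shows "pclass g \<otimes>\<^bsub>cover_PSL2R\<^esub> pclass h = pclass (\<lambda>t. g t \<circ> h t)"
proof -
  have eq: "isom_homotopy `` {\<lambda>t. g' t \<circ> h' t} = pclass (\<lambda>t. g t \<circ> h t)" if "g' \<in> pclass g" "h' \<in> pclass h" for g' h'
    using that homotopic_paths_comp[of g g' h h'] pclass_eq unfolding mem_pclass pclass_def[symmetric] by metis
  have "pclass g \<otimes>\<^bsub>cover_PSL2R\<^esub> pclass h = (\<Union>g'\<in>pclass g. \<Union>h'\<in>pclass h. isom_homotopy `` {\<lambda>t. g' t \<circ> h' t})"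
    by (simp add: cover_PSL2R_def)
  also have "\<dots> = (\<Union>g'\<in>pclass g. \<Union>h'\<in>pclass h. pclass (\<lambda>t. g t \<circ> h t))"
    using eq by simp
  also have "\<dots> = pclass (\<lambda>t. g t \<circ> h t)"
    using self_in_pclass[OF assms(1)] self_in_pclass[OF assms(2)] by blast
  finally show ?thesis .
qed

lemma one_cover: "\<one>\<^bsub>cover_PSL2R\<^esub> = pclass (\<lambda>t. id)"
  by (simp add: cover_PSL2R_def pclass_def)

lemma const_id_path: "(\<lambda>t. id) \<in> paths_from_id"
  using id_in_isom_plus by (intro paths_from_idI) auto

lemma group_cover_PSL2R: "group cover_PSL2R"
proof (rule groupI)
  show "A \<otimes>\<^bsub>cover_PSL2R\<^esub> B \<in> carrier cover_PSL2R" if "A \<in> carrier cover_PSL2R" "B \<in> carrier cover_PSL2R" for A B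
    using that unfolding carrier_cover by (auto simp: mult_pclass comp_paths_from_id)
  show "\<one>\<^bsub>cover_PSL2R\<^esub> \<in> carrier cover_PSL2R"
    unfolding carrier_cover one_cover using const_id_path by blast
  show "A \<otimes>\<^bsub>cover_PSL2R\<^esub> B \<otimes>\<^bsub>cover_PSL2R\<^esub> C = A \<otimes>\<^bsub>cover_PSL2R\<^esub> (B \<otimes>\<^bsub>cover_PSL2R\<^esub> C)"
    if "A \<in> carrier cover_PSL2R" "B \<in> carrier cover_PSL2R" "C \<in> carrier cover_PSL2R" for A B C
    using that unfolding carrier_cover by (auto simp: mult_pclass comp_paths_from_id comp_assoc)
  show "\<one>\<^bsub>cover_PSL2R\<^esub> \<otimes>\<^bsub>cover_PSL2R\<^esub> A = A" if "A \<in> carrier cover_PSL2R" for A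
    using that unfolding carrier_cover one_cover by (auto simp: mult_pclass const_id_path)
  show "\<exists>B\<in>carrier cover_PSL2R. B \<otimes>\<^bsub>cover_PSL2R\<^esub> A = \<one>\<^bsub>cover_PSL2R\<^esub>" if "A \<in> carrier cover_PSL2R" for A
  proof -
    obtain g where g: "g \<in> paths_from_id" "A = pclass g" using \<open>A \<in> _\<close> unfolding carrier_cover by auto
    define h where "h t = inv\<^bsub>PSL2R\<^esub> (g t)" for t
    have gt: "g t \<in> isom_plus" if "t \<in> {0..1}" for t :: real using paths_from_idD(2)[OF g(1)] that by blast
    have "inv\<^bsub>PSL2R\<^esub> id = id" using PSL.inv_one by simp
    then have h: "h \<in> paths_from_id"
      using continuous_on_isom_inv paths_from_idD[OF g(1)] PSL.inv_closed gt unfolding h_def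
      by (intro paths_from_idI) auto
    have "h t \<circ> g t = id" if "t \<in> {0..1}" for t :: real
      using PSL.l_inv[of "g t"] gt[OF that] by (simp add: h_def)
    then have "homotopic_paths isom_plus (\<lambda>t. id) (\<lambda>t. h t \<circ> g t)"
      using const_id_path by (intro homotopic_paths_eq) (auto simp: paths_from_id_def)
    then have "pclass h \<otimes>\<^bsub>cover_PSL2R\<^esub> A = \<one>\<^bsub>cover_PSL2R\<^esub>"
      unfolding g(2) mult_pclass[OF h g(1)] one_cover using pclass_eq by metis
    then show ?thesis using h unfolding carrier_cover by blast
  qed
qed

interpretation COV: group cover_PSL2R by (rule group_cover_PSL2R)

lemma cover_image_pclass: "g \<in> paths_from_id \<Longrightarrow> cover_image (pclass g) = g 1"
  unfolding cover_image_def pathfinish_def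
  using pclass_member[of g] self_in_pclass[of g] by (intro the_equality) metis+

lemma cover_image_hom: "cover_image \<in> hom cover_PSL2R PSL2R"
  unfolding hom_def carrier_cover
  by (auto simp: mult_pclass cover_image_pclass comp_paths_from_id paths_from_idD)

interpretation COVH: group_hom cover_PSL2R PSL2R cover_image
  using cover_image_hom group_PSL2R group_cover_PSL2R by (simp add: group_hom_def group_hom_axioms_def)

section \<open>The angular cocycle\<close>

text \<open>
  The angle, relative to the Euclidean direction, by which an element of the covering group
  rotates tangent vectors at \<open>y\<close> along its path. By homotopy invariance any representative gives
  the same value.
\<close>

definition angle :: "isom_path_class \<Rightarrow> complex \<Rightarrow> real" where
  "angle A y = argvar (\<lambda>t. jac ((SOME g. g \<in> A) t) y)"

text \<open>
  Only the factor \<open>mob_arg\<close> of \<open>jac\<close> can wind around \<open>0\<close>. The factor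
  \<open>1 + cnj (g t 0) * mob_arg (g t) * z t\<close> stays in the right half plane, so its contribution is
  determined by its final value.
\<close>

lemma argvar_jac:
  assumes g: "g \<in> paths_from_id" and z: "continuous_on {0..1} z" "z ` {0..1} \<subseteq> cball 0 1"
  shows "argvar (\<lambda>t. jac (g t) (z t)) =
    argvar (\<lambda>t. mob_arg (g t)) - 2 * Arg (1 + cnj (g 1 0) * mob_arg (g 1) * z 1)"
    "path (\<lambda>t. jac (g t) (z t))" "0 \<notin> path_image (\<lambda>t. jac (g t) (z t))"
proof -
  note G = paths_from_idD[OF g]
  have gt: "g t \<in> isom_plus" if "t \<in> {0..1}" for t using G(2) that by blast
  have zt: "z t \<in> cball 0 1" if "t \<in> {0..1}" for t using z(2) that by blast
  define d where "d t = 1 + cnj (g t 0) * mob_arg (g t) * z t" for t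
  have d: "continuous_on {0..1} d" unfolding d_def
    by (intro continuous_on_add continuous_on_mult continuous_on_cnj continuous_on_const
      continuous_on_eval[OF G(1)] continuous_on_mob_arg[OF G(1,2)] z(1))
  have Re_d: "0 < Re (d t)" if "t \<in> {0..1}" for t unfolding d_def by (rule isom_plus_Re_den[OF gt[OF that] zt[OF that]])
  have ad: "argvar d = Arg (d 1) - Arg (d 0)"
    using argvar_right_half_plane[of d] d Re_d by (simp add: path_def)
  have d0: "d 0 = 1" using G(3) by (simp add: d_def)
  have pd: "path d" "0 \<notin> path_image d" using d Re_d by (force simp: path_def path_image_def)+
  show pj: "path (\<lambda>t. jac (g t) (z t))" "0 \<notin> path_image (\<lambda>t. jac (g t) (z t))"
    using continuous_on_jac_path[OF G(1,2) z] jac_nonzero[OF gt zt] by (force simp: path_def path_image_def)+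
  define c where "c t = complex_of_real (1 - (cmod (g t 0))\<^sup>2)" for t
  have g0: "0 < 1 - (cmod (g t 0))\<^sup>2" if "t \<in> {0..1}" for t
    by (rule one_minus_norm_sq_pos[OF isom_plusE(2)[OF gt[OF that]]])
  have c: "path c" unfolding path_def c_def
    by (intro continuous_on_of_real continuous_on_diff continuous_on_power continuous_on_norm continuous_on_const
      continuous_on_eval[OF G(1)])
  have c0: "0 \<notin> path_image c" using g0 by (force simp: path_image_def c_def simp del: of_real_diff of_real_power)
  have ac: "argvar c = 0"
    using argvar_right_half_plane[OF c] g0[of 0] g0[of 1] g0
    by (auto simp: c_def Arg_of_real simp del: of_real_diff of_real_power)
  have m: "path (\<lambda>t. mob_arg (g t))" "0 \<notin> path_image (\<lambda>t. mob_arg (g t))"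
    using continuous_on_mob_arg[OF G(1,2)] isom_plusE(1)[OF gt] by (force simp: path_def path_image_def)+
  have dd: "path (\<lambda>t. d t * d t)" "0 \<notin> path_image (\<lambda>t. d t * d t)"
    using pd by (auto simp: path_def path_image_def intro!: continuous_intros)
  have "argvar (\<lambda>t. mob_arg (g t) * c t) = argvar (\<lambda>t. jac (g t) (z t) * (d t * d t))"
    by (rule argvar_cong) (use isom_plus_den_nonzero[OF gt zt] in \<open>simp add: jac_def c_def d_def power2_eq_square\<close>)
  also have "\<dots> = argvar (\<lambda>t. jac (g t) (z t)) + (argvar d + argvar d)"
    using argvar_mult[OF pj dd] argvar_mult[OF pd pd] by simp
  finally have "argvar (\<lambda>t. jac (g t) (z t)) = argvar (\<lambda>t. mob_arg (g t)) - 2 * argvar d"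
    using argvar_mult[OF m c c0] ac by simp
  then show "argvar (\<lambda>t. jac (g t) (z t)) =
    argvar (\<lambda>t. mob_arg (g t)) - 2 * Arg (1 + cnj (g 1 0) * mob_arg (g 1) * z 1)"
    unfolding ad d0 by (simp add: d_def)
qed

lemma argvar_jac_homotopic:
  assumes "homotopic_paths isom_plus g h" "y \<in> cball 0 1"
  shows "argvar (\<lambda>t. jac (g t) y) = argvar (\<lambda>t. jac (h t) y)"
proof -
  have "homotopic_paths (- {0}) ((\<lambda>f. jac f y) \<circ> g) ((\<lambda>f. jac f y) \<circ> h)"
  proof (rule homotopic_paths_continuous_image[OF assms(1)])
    show "continuous_on isom_plus (\<lambda>f. jac f y)"
      using continuous_on_jac_path[of isom_plus "\<lambda>f. f" "\<lambda>f. y"] assms(2) by (simp add: image_subset_iff)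
    show "(\<lambda>f. jac f y) \<in> isom_plus \<rightarrow> - {0}" using jac_nonzero assms(2) by auto
  qed
  then show ?thesis using argvar_homotopic by (fastforce simp: comp_def)
qed

lemma angle_pclass:
  assumes g: "g \<in> paths_from_id" and y: "y \<in> cball 0 1"
  shows "angle (pclass g) y = argvar (\<lambda>t. jac (g t) y)"
proof -
  have "(SOME h. h \<in> pclass g) \<in> pclass g" using self_in_pclass[OF g] by (rule someI[of "\<lambda>h. h \<in> pclass g"])
  then show ?thesis unfolding angle_def mem_pclass using argvar_jac_homotopic y by metis
qed

text \<open>
  The point at which the derivative is taken may move along the path, since the variation of the
  argument depends on its final position only.
\<close>

lemma angle_moving_point:
  assumes g: "g \<in> paths_from_id" and z: "continuous_on {0..1} z" "z ` {0..1} \<subseteq> cball 0 1"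
  shows "argvar (\<lambda>t. jac (g t) (z t)) = angle (pclass g) (z 1)"
proof -
  have y: "z 1 \<in> cball 0 1" using z(2) by (simp add: image_subset_iff)
  then have "angle (pclass g) (z 1) = argvar (\<lambda>t. jac (g t) ((\<lambda>_. z 1) t))" using angle_pclass[OF g] by simp
  also have "\<dots> = argvar (\<lambda>t. jac (g t) (z t))"
    using argvar_jac(1)[OF g z] argvar_jac(1)[OF g, of "\<lambda>_. z 1"] y by (simp add: image_subset_iff)
  finally show ?thesis ..
qed

text \<open>
  The chain rule splits the derivative of \<open>g t \<circ> h t\<close> at \<open>y\<close> into the derivative of \<open>h t\<close> at
  \<open>y\<close> and the derivative of \<open>g t\<close> at the moving point \<open>h t y\<close>.
\<close>

lemma angle_mult:
  assumes A: "A \<in> carrier cover_PSL2R" and B: "B \<in> carrier cover_PSL2R" and y: "y \<in> cball 0 1"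
  shows "angle (A \<otimes>\<^bsub>cover_PSL2R\<^esub> B) y = angle A (cover_image B y) + angle B y"
proof -
  obtain g where g: "g \<in> paths_from_id" "A = pclass g" using A unfolding carrier_cover by auto
  obtain h where h: "h \<in> paths_from_id" "B = pclass h" using B unfolding carrier_cover by auto
  note G = paths_from_idD[OF g(1)] and H = paths_from_idD[OF h(1)]
  have z: "continuous_on {0..1} (\<lambda>t. h t y)" "(\<lambda>t. h t y) ` {0..1} \<subseteq> cball 0 1"
    using continuous_on_eval[OF H(1)] H(2) isom_plus_cball[OF _ y] by (auto simp: image_subset_iff)
  have c: "continuous_on {0..1} (\<lambda>t::real. y)" "(\<lambda>t::real. y) ` {0..1} \<subseteq> cball 0 1" using y by (simp_all add: image_subset_iff)
  have "angle (A \<otimes>\<^bsub>cover_PSL2R\<^esub> B) y = argvar (\<lambda>t. jac (g t \<circ> h t) y)"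
    unfolding g h mult_pclass[OF g(1) h(1)] using angle_pclass[OF comp_paths_from_id[OF g(1) h(1)] y] .
  also have "\<dots> = argvar (\<lambda>t. jac (g t) (h t y) * jac (h t) y)"
    using G(2) H(2) by (intro argvar_cong jac_comp y) (simp_all add: image_subset_iff)
  also have "\<dots> = argvar (\<lambda>t. jac (g t) (h t y)) + argvar (\<lambda>t. jac (h t) y)"
    using argvar_jac[OF g(1) z] argvar_jac[OF h(1) c] by (intro argvar_mult) simp_all
  also have "\<dots> = angle A (cover_image B y) + angle B y"
    using angle_moving_point[OF g(1) z] angle_pclass[OF h(1) y] cover_image_pclass[OF h(1)] g h by simp
  finally show ?thesis .
qed

text \<open>
  The image of the geodesic from \<open>x\<close> to \<open>y\<close> is the geodesic between the images, so the
  difference of the rotations at the ends is the difference of the turnings.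
\<close>

lemma angle_diff:
  assumes A: "A \<in> carrier cover_PSL2R" and x: "x \<in> cball 0 1" and y: "y \<in> cball 0 1"
  shows "angle A y - angle A x = turn (cover_image A x) (cover_image A y) - turn x y"
proof -
  obtain g where g: "g \<in> paths_from_id" "A = pclass g" using A unfolding carrier_cover by auto
  have c: "continuous_on {0..1} (\<lambda>t::real. z)" "(\<lambda>t::real. z) ` {0..1} \<subseteq> cball 0 1" if "z \<in> cball 0 1" for z using that by (simp_all add: image_subset_iff)
  show ?thesis
    using argvar_jac(1)[OF g(1) c[OF x]] argvar_jac(1)[OF g(1) c[OF y]] angle_pclass[OF g(1) x] angle_pclass[OF g(1) y]
      turn_isom[OF paths_from_idD(4)[OF g(1)] x y] cover_image_pclass[OF g(1)] g(2) by simp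
qed

lemma continuous_on_angle:
  assumes A: "A \<in> carrier cover_PSL2R" shows "continuous_on (cball 0 1) (angle A)"
proof -
  obtain g where g: "g \<in> paths_from_id" "A = pclass g" using A unfolding carrier_cover by auto
  have f: "g 1 \<in> isom_plus" by (rule paths_from_idD(4)[OF g(1)])
  define d where "d y = 1 + cnj (g 1 0) * mob_arg (g 1) * y" for y
  have d: "0 < Re (d y)" if "y \<in> cball 0 1" for y unfolding d_def using isom_plus_Re_den[OF f that] .
  have "continuous_on (cball 0 1) d" unfolding d_def by (intro continuous_intros)
  moreover have "d y \<notin> \<real>\<^sub>\<le>\<^sub>0" if "y \<in> cball 0 1" for y using d[OF that] by (auto simp: complex_nonpos_Reals_iff)
  ultimately have "continuous_on (cball 0 1) (\<lambda>y. argvar (\<lambda>t. mob_arg (g t)) - 2 * Im (Ln (d y)))"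
    by (intro continuous_intros) auto
  then show ?thesis
  proof (rule continuous_on_eq)
    fix y :: complex assume y: "y \<in> cball 0 1"
    have "d y \<noteq> 0" using d[OF y] by auto
    moreover have "angle A y = argvar (\<lambda>t. mob_arg (g t)) - 2 * Arg (d y)"
      using argvar_jac(1)[OF g(1), of "\<lambda>_. y"] y angle_pclass[OF g(1) y] g(2) by (simp add: d_def image_subset_iff)
    ultimately show "argvar (\<lambda>t. mob_arg (g t)) - 2 * Im (Ln (d y)) = angle A y" by (simp add: Arg_eq_Im_Ln)
  qed
qed

section \<open>Geodesics in coordinates\<close>

text \<open>
  The point at distance \<open>r\<close> from \<open>y\<close> on the geodesic which leaves \<open>y\<close> in direction \<open>s\<close>: a radius,
  on which the point at distance \<open>r\<close> from \<open>0\<close> has modulus \<open>tanh (r / 2)\<close>, moved to \<open>y\<close>.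
\<close>

definition geod :: "complex \<Rightarrow> complex \<Rightarrow> real \<Rightarrow> complex" where
  "geod y s r = mob 1 y (of_real (tanh (r / 2)) * s)"

lemma tanh_mult_in_hplane: "cmod s = 1 \<Longrightarrow> of_real (tanh r) * s \<in> hplane"
  using tanh_norm_lt_1[of r] by (simp add: norm_mult)

lemma geod_in_hplane: "y \<in> hplane \<Longrightarrow> cmod s = 1 \<Longrightarrow> geod y s r \<in> hplane"
  unfolding geod_def using tanh_mult_in_hplane by (intro mob_in_hplane) auto

lemma hdist_geod: "y \<in> hplane \<Longrightarrow> cmod s = 1 \<Longrightarrow> hdist (geod y s a) (geod y s b) = \<bar>a - b\<bar>"
  unfolding geod_def using tanh_mult_in_hplane[of s]
  by (simp only: hdist_mob[of 1 y] norm_one hdist_radial) (simp add: field_simps abs_if)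

lemma geod_0 [simp]: "geod y s 0 = y"
  by (simp add: geod_def)

lemma mob_1_inverse:
  assumes "y \<in> hplane"
  shows "mob 1 (- y) (mob 1 y z) = z" "mob 1 y (mob 1 (- y) z) = z"
  using mob_inverse[of 1 y z] mob_inverse'[of 1 y z] assms by simp_all

text \<open>
  Moving \<open>y\<close> to the origin reduces this to \<open>between_origin\<close>. It yields uniqueness of geodesics
  and of geodesic rays.
\<close>

lemma between_eq_geod:
  assumes y: "y \<in> hplane" and x: "x \<in> hplane" and w: "w \<in> hplane" and "y \<noteq> w"
    and add: "hdist y w = hdist y x + hdist x w"
  shows "x = geod y (sgn (mob 1 (- y) w)) (hdist y x)"
proof -
  have m: "cmod 1 = 1" "- y \<in> hplane" using y by auto
  define x' w' where "x' = mob 1 (- y) x" "w' = mob 1 (- y) w"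
  have in': "x' \<in> hplane" "w' \<in> hplane" using mob_in_hplane[OF m] x w by (auto simp: x'_w'_def)
  have y0: "mob 1 (- y) y = 0" using y by (simp add: mob_def)
  have d: "hdist 0 x' = hdist y x" "hdist 0 w' = hdist y w" "hdist x' w' = hdist x w"
    using hdist_mob[OF m y x] hdist_mob[OF m y w] hdist_mob[OF m x w] by (simp_all add: y0 x'_w'_def)
  obtain r where r: "0 \<le> r" "x' = r *\<^sub>R w'"
    using between_origin[OF in'] add unfolding d by blast
  have "w' \<noteq> 0" using d(2) hdist_eq_0_iff[OF y w] \<open>y \<noteq> w\<close> by (auto simp: hdist_def)
  then have "x' = of_real (cmod x') * sgn w'" using r by (simp add: sgn_div_norm scaleR_conv_of_real norm_mult)
  also have "cmod x' = tanh (hdist y x / 2)" using hdist_0[OF in'(1)] d by simp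
  finally have "x' = of_real (tanh (hdist y x / 2)) * sgn w'" .
  then have "mob 1 y x' = geod y (sgn w') (hdist y x)" by (simp only: geod_def)
  then show ?thesis using mob_1_inverse(2)[OF y, of x] by (simp only: x'_w'_def)
qed

lemma direction_unit: "y \<in> hplane \<Longrightarrow> w \<in> hplane \<Longrightarrow> y \<noteq> w \<Longrightarrow> cmod (sgn (mob 1 (- y) w)) = 1"
proof -
  assume a: "y \<in> hplane" "w \<in> hplane" "y \<noteq> w"
  have "mob 1 (- y) w \<noteq> 0" using mob_1_inverse(2)[OF a(1), of w] a(3) by auto
  then show ?thesis by (simp add: norm_sgn)
qed

lemma geod_hdist_end: "y \<in> hplane \<Longrightarrow> w \<in> hplane \<Longrightarrow> y \<noteq> w \<Longrightarrow> geod y (sgn (mob 1 (- y) w)) (hdist y w) = w"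
  using between_eq_geod[of y w w] by (simp add: hdist_eq_0_iff)

lemma hgeodesic_in_hplane: "hgeodesic c y w \<Longrightarrow> t \<in> {0..1} \<Longrightarrow> c t \<in> hplane"
  unfolding hgeodesic_def by blast

lemma hgeodesic_eq_geod:
  assumes c: "hgeodesic c y w" and "y \<noteq> w" and t: "t \<in> {0..1}"
  shows "c t = geod y (sgn (mob 1 (- y) w)) (t * hdist y w)"
proof -
  have c0: "c 0 = y" "c 1 = w" "\<And>t. t \<in> {0..1} \<Longrightarrow> c t \<in> hplane"
    and d: "\<And>s t. s \<in> {0..1} \<Longrightarrow> t \<in> {0..1} \<Longrightarrow> hdist (c s) (c t) = \<bar>s - t\<bar> * hdist y w"
    using c by (auto simp: hgeodesic_def image_subset_iff)
  have "y \<in> hplane" "w \<in> hplane" using c0(3)[of 0] c0(3)[of 1] c0 by auto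
  moreover have dt: "hdist y (c t) = t * hdist y w" "hdist (c t) w = (1 - t) * hdist y w"
    using d[of 0 t] d[of t 1] t c0 by auto
  ultimately show ?thesis
    using between_eq_geod[of y "c t" w] c0(3)[OF t] \<open>y \<noteq> w\<close> by (simp add: algebra_simps)
qed

lemma hgeodesic_geod:
  assumes "y \<in> hplane" "w \<in> hplane" "y \<noteq> w"
  shows "hgeodesic (\<lambda>t. geod y (sgn (mob 1 (- y) w)) (t * hdist y w)) y w"
proof -
  have "\<bar>s * hdist y w - t * hdist y w\<bar> = \<bar>s - t\<bar> * hdist y w" for s t
    using hdist_nonneg[OF assms(1,2)] by (simp add: abs_mult flip: left_diff_distrib)
  then show ?thesis
    unfolding hgeodesic_def using assms hdist_geod direction_unit geod_in_hplane geod_hdist_end by auto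
qed

lemma hgeodesic_const: "y \<in> hplane \<Longrightarrow> hgeodesic (\<lambda>t. y) y y"
  by (auto simp: hgeodesic_def hdist_def)

lemma hgeodesic_refl_eq: "hgeodesic c y y \<Longrightarrow> t \<in> {0..1} \<Longrightarrow> c t = y"
proof -
  assume c: "hgeodesic c y y" and t: "t \<in> {0..1}"
  have "c 0 \<in> hplane" "c t \<in> hplane" using hgeodesic_in_hplane[OF c] t by auto
  moreover have "c 0 = y" using c by (simp add: hgeodesic_def)
  moreover have "hdist (c 0) (c t) = \<bar>0 - t\<bar> * hdist y y"
    using c t unfolding hgeodesic_def by (metis atLeastAtMost_iff order_refl zero_le_one)
  moreover have "hdist y y = 0" by (simp add: hdist_def)
  ultimately show ?thesis using hdist_eq_0_iff[of y "c t"] by simp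
qed

text \<open>
  The Euclidean direction of \<open>geod y s\<close> at parameter \<open>r\<close>, as a continuous function of \<open>r\<close>.
\<close>

definition geod_angle :: "complex \<Rightarrow> complex \<Rightarrow> real \<Rightarrow> real" where
  "geod_angle y s r = Arg s - 2 * Arg (1 + cnj y * (of_real (tanh (r / 2)) * s))"

lemma geod_den_pos: "y \<in> hplane \<Longrightarrow> cmod s = 1 \<Longrightarrow> 0 < Re (1 + cnj y * (of_real (tanh r) * s))"
  using Re_mob_den[of 1 y "of_real (tanh r) * s"] tanh_mult_in_hplane[of s r] by simp

lemma continuous_on_geod_angle:
  assumes "y \<in> hplane" "cmod s = 1" shows "continuous_on T (geod_angle y s)"
proof -
  have p: "0 < Re (1 + cnj y * (of_real (tanh (r / 2)) * s))" for r using geod_den_pos[OF assms] .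
  then have "1 + cnj y * (of_real (tanh (r / 2)) * s) \<notin> \<real>\<^sub>\<le>\<^sub>0" for r
    unfolding complex_nonpos_Reals_iff using not_le by blast
  moreover have "continuous_on T (\<lambda>r::real. tanh (r / 2))"
    by (intro continuous_on_tanh continuous_intros) auto
  ultimately have "continuous_on T (\<lambda>r. Arg s - 2 * Im (Ln (1 + cnj y * (of_real (tanh (r / 2)) * s))))"
    by (intro continuous_on_diff continuous_on_mult continuous_on_const continuous_on_Im continuous_on_Ln'
      continuous_on_add continuous_on_of_real) auto
  then show ?thesis
  proof (rule continuous_on_eq)
    fix r
    have "1 + cnj y * (of_real (tanh (r / 2)) * s) \<noteq> 0" using p[of r] by (metis less_irrefl zero_complex.simps(1))
    then show "Arg s - 2 * Im (Ln (1 + cnj y * (of_real (tanh (r / 2)) * s))) = geod_angle y s r"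
      by (simp add: geod_angle_def Arg_eq_Im_Ln)
  qed
qed

lemma sgn_eq_cis_mult:
  assumes "a > 0" "z \<noteq> 0"
  shows "sgn (of_real a / z\<^sup>2) = cis (- 2 * Arg z)"
proof -
  have "z = of_real (cmod z) * cis (Arg z)" using rcis_cmod_Arg[of z] by (simp add: rcis_def)
  then have "z\<^sup>2 = of_real ((cmod z)\<^sup>2) * cis (2 * Arg z)"
    by (metis of_real_power power_mult_distrib power2_eq_square cis_mult mult_2)
  then have "of_real a / z\<^sup>2 = of_real (a / (cmod z)\<^sup>2) * (1 / cis (2 * Arg z))" by simp
  also have "1 / cis (2 * Arg z) = cis (- 2 * Arg z)" by (simp add: cis_divide[of 0, simplified])
  finally have "of_real a / z\<^sup>2 = of_real (a / (cmod z)\<^sup>2) * cis (- 2 * Arg z)" .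
  moreover have "0 < a / (cmod z)\<^sup>2" using assms by simp
  ultimately show ?thesis by (simp only: sgn_mult sgn_of_real sgn_pos) (simp add: sgn_eq)
qed

lemma geod_velocity:
  assumes y: "y \<in> hplane" and s: "cmod s = 1" and D: "D > 0"
  obtains v where "((\<lambda>t. geod y s (t * D)) has_vector_derivative v) (at t)" "sgn v = cis (geod_angle y s (t * D))"
proof -
  define \<rho> where "\<rho> t = tanh (t * D / 2)" for t
  have one: "cmod 1 = 1" by simp
  define \<rho>' where "\<rho>' = (1 - (tanh (t * D / 2))\<^sup>2) * (D / 2)"
  have "(\<rho> has_real_derivative \<rho>') (at t)"
    unfolding \<rho>_def \<rho>'_def by (auto intro!: derivative_eq_intros)
  then have "((\<lambda>t. of_real (\<rho> t) * s) has_vector_derivative of_real \<rho>' * s) (at t)"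
    by (auto intro!: derivative_eq_intros simp: has_real_derivative_iff_has_vector_derivative)
  moreover have hp: "of_real (\<rho> t) * s \<in> hplane" unfolding \<rho>_def by (rule tanh_mult_in_hplane[OF s])
  note has_field_derivative_mob[OF one y hp]
  ultimately have "((mob 1 y \<circ> (\<lambda>t. of_real (\<rho> t) * s)) has_vector_derivative
     (of_real \<rho>' * s) * (1 * of_real (1 - (cmod y)\<^sup>2) / (1 + cnj y * 1 * (of_real (\<rho> t) * s))\<^sup>2)) (at t)"
    by (rule field_vector_diff_chain_at)
  moreover have "mob 1 y \<circ> (\<lambda>t. of_real (\<rho> t) * s) = (\<lambda>t. geod y s (t * D))"
    by (auto simp: geod_def \<rho>_def)
  moreover have "sgn ((of_real \<rho>' * s) * (1 * of_real (1 - (cmod y)\<^sup>2) / (1 + cnj y * 1 * (of_real (\<rho> t) * s))\<^sup>2))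
     = cis (geod_angle y s (t * D))"
  proof -
    have "1 + cnj y * (of_real (\<rho> t) * s) \<noteq> 0" using geod_den_pos[OF y s, of "t * D / 2"] by (metis \<rho>_def less_irrefl zero_complex.simps(1))
    then have 1: "sgn (of_real (1 - (cmod y)\<^sup>2) / (1 + cnj y * (of_real (\<rho> t) * s))\<^sup>2) =
        cis (- 2 * Arg (1 + cnj y * (of_real (\<rho> t) * s)))"
      using one_minus_norm_sq_pos[OF y] by (intro sgn_eq_cis_mult)
    have "(tanh (t * D / 2))\<^sup>2 < 1" using tanh_norm_lt_1[of "t * D / 2"] abs_square_less_1 by blast
    then have "\<rho>' > 0" using D unfolding \<rho>'_def by (intro mult_pos_pos) auto
    moreover have "sgn s = cis (Arg s)" using s by (subst cis_Arg) auto
    moreover have "sgn ((of_real \<rho>' * s) * (1 * of_real (1 - (cmod y)\<^sup>2) / (1 + cnj y * 1 * (of_real (\<rho> t) * s))\<^sup>2))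
        = sgn (complex_of_real \<rho>') * sgn s * sgn (of_real (1 - (cmod y)\<^sup>2) / (1 + cnj y * (of_real (\<rho> t) * s))\<^sup>2)"
      by (simp only: sgn_mult mult_1 mult_1_right)
    moreover have "sgn (complex_of_real \<rho>') = 1" using \<open>\<rho>' > 0\<close> by (simp add: sgn_of_real)
    ultimately show ?thesis
      unfolding 1 by (simp add: geod_angle_def \<rho>_def cis_mult)
  qed
  ultimately show ?thesis using that by simp
qed

text \<open>
  This is \<open>turn_isom\<close> for the Moebius map that moves the radius to the geodesic.
\<close>

lemma geod_angle_total:
  assumes "y \<in> hplane" "w \<in> hplane" "y \<noteq> w"
  defines "s \<equiv> sgn (mob 1 (- y) w)"
  shows "geod_angle y s (hdist y w) - geod_angle y s 0 = turn y w"
proof -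
  have s: "cmod s = 1" using direction_unit assms by auto
  define m where "m = of_real (tanh (hdist y w / 2)) * s"
  have m: "m \<in> cball 0 1" using tanh_mult_in_hplane[OF s, of "hdist y w / 2"] by (simp add: m_def)
  have w: "mob 1 y m = w" using geod_hdist_end[OF assms(1-3)] by (simp add: geod_def s_def m_def)
  have f: "mob 1 y \<in> isom_plus" using assms by (intro mob_in_isom_plus) auto
  have "turn (mob 1 y 0) (mob 1 y m) = - 2 * Arg (1 + cnj y * m)"
    using turn_isom[OF f _ m, of 0] mob_arg_mob[of 1 y] assms(1) by (simp add: turn_def)
  then show ?thesis unfolding w by (simp add: geod_angle_def m_def)
qed

lemma hunit_geod_velocity:
  assumes c: "hgeodesic c y w" and "y \<noteq> w" and t: "t \<in> {0..1}"
  shows "hunit (c t) (vector_derivative c (at t within {0..1})) =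
    of_real ((1 - (cmod (c t))\<^sup>2) / 2) * cis (geod_angle y (sgn (mob 1 (- y) w)) (t * hdist y w))"
proof -
  have "y \<in> hplane" "w \<in> hplane" using c by (auto simp: hgeodesic_def image_subset_iff)
  then have D: "hdist y w > 0" using hdist_nonneg[of y w] hdist_eq_0_iff[of y w] \<open>y \<noteq> w\<close> by auto
  obtain v where v: "((\<lambda>t. geod y (sgn (mob 1 (- y) w)) (t * hdist y w)) has_vector_derivative v) (at t)"
    "sgn v = cis (geod_angle y (sgn (mob 1 (- y) w)) (t * hdist y w))"
    using geod_velocity[OF \<open>y \<in> hplane\<close> direction_unit[OF \<open>y \<in> hplane\<close> \<open>w \<in> hplane\<close> \<open>y \<noteq> w\<close>] D] by blast
  have "(c has_vector_derivative v) (at t within {0..1})"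
    by (rule has_vector_derivative_transform[OF t _ has_vector_derivative_at_within[OF v(1)]])
      (rule hgeodesic_eq_geod[OF c \<open>y \<noteq> w\<close>])
  then have "vector_derivative c (at t within {0..1}) = v"
    using t by (intro vector_derivative_within_closed_interval) auto
  then show ?thesis using v(2) by (simp add: hunit_def scaleR_conv_of_real)
qed

section \<open>The twist is the angular cocycle relative to the turning\<close>

lemma turn_refl: "y \<in> cball 0 1 \<Longrightarrow> turn y y = 0"
proof -
  assume y: "y \<in> cball 0 1"
  have "1 - cnj y * y = of_real (1 - (cmod y)\<^sup>2)" using complex_norm_square[of y] by (simp add: mult.commute)
  moreover have "(cmod y)\<^sup>2 \<le> 1" using y by (simp add: power_le_one)
  ultimately show ?thesis unfolding turn_def by (simp only: Arg_of_real) simp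
qed

lemma unit_tangent_bundle_iff: "(z, u) \<in> unit_tangent_bundle \<longleftrightarrow> z \<in> hplane \<and> cmod u = (1 - (cmod z)\<^sup>2) / 2"
  using one_minus_norm_sq_pos[of z] by (auto simp: unit_tangent_bundle_def field_simps)

text \<open>
  The reference field of a twist is a positive multiple of \<open>cis \<circ> \<psi>\<close>. Since \<open>turn y y = 0\<close>, the
  constant field for \<open>w = y\<close> fits the same formula as the velocity field.
\<close>

lemma reference_field:
  assumes c: "hgeodesic c y w" and yw: "y \<in> hplane" "w \<in> hplane"
    and e: "if w = y then \<exists>e\<^sub>0. (y, e\<^sub>0) \<in> unit_tangent_bundle \<and> (\<forall>t\<in>{0..1}. e t = e\<^sub>0)
      else \<forall>t\<in>{0..1}. e t = hunit (c t) (vector_derivative c (at t within {0..1}))"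
  obtains \<psi> where "continuous_on {0..1} \<psi>" "\<And>t. t \<in> {0..1} \<Longrightarrow> e t = of_real ((1 - (cmod (c t))\<^sup>2) / 2) * cis (\<psi> t)"
    "\<psi> 1 - \<psi> 0 = turn y w"
proof (cases "w = y")
  case True
  then obtain e\<^sub>0 where e0: "(y, e\<^sub>0) \<in> unit_tangent_bundle" "\<And>t. t \<in> {0..1} \<Longrightarrow> e t = e\<^sub>0" using e by auto
  have "e\<^sub>0 = of_real (cmod e\<^sub>0) * cis (Arg e\<^sub>0)" using rcis_cmod_Arg[of e\<^sub>0] by (simp add: rcis_def)
  moreover have "cmod e\<^sub>0 = (1 - (cmod y)\<^sup>2) / 2" using e0 by (simp add: unit_tangent_bundle_iff)
  moreover have "turn y y = 0" using yw(1) by (intro turn_refl) simp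
  ultimately show ?thesis
    using True hgeodesic_refl_eq c e0(2) by (intro that[of "\<lambda>t. Arg e\<^sub>0"]) (auto simp del: of_real_divide)
next
  case False
  let ?s = "sgn (mob 1 (- y) w)"
  have s: "cmod ?s = 1" using direction_unit yw False by metis
  have "continuous_on {0..1} (\<lambda>t. geod_angle y ?s (t * hdist y w))"
    by (rule continuous_on_compose2[OF continuous_on_geod_angle[OF yw(1) s, of UNIV]]) (auto intro!: continuous_intros)
  then show ?thesis
    using e False hunit_geod_velocity[OF c] geod_angle_total[OF yw] by (intro that[of "\<lambda>t. geod_angle y ?s (t * hdist y w)"]) auto
qed

lemma path_hgeodesic:
  assumes c: "hgeodesic c y w" and y: "y \<in> hplane" and w: "w \<in> hplane"
  shows "path c"
proof (cases "w = y")
  case True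
  have "continuous_on {0..1} (\<lambda>t. y)" by simp
  then show ?thesis unfolding path_def
    by (rule continuous_on_eq) (use True hgeodesic_refl_eq[of c y] c in auto)
next
  case False
  then have yw: "y \<noteq> w" by simp
  let ?s = "sgn (mob 1 (- y) w)"
  have s: "cmod ?s = 1" by (rule direction_unit[OF y w yw])
  have D: "hdist y w > 0" using hdist_nonneg[OF y w] hdist_eq_0_iff[OF y w] yw by auto
  have "continuous_on {0..1} (\<lambda>t. geod y ?s (t * hdist y w))"
    using geod_velocity[OF y s D] has_vector_derivative_continuous continuous_at_imp_continuous_on by metis
  then show ?thesis unfolding path_def
    by (rule continuous_on_eq) (use hgeodesic_eq_geod[OF c yw] in auto)
qed

lemma deriv_path_eq: "g \<in> paths_from_id \<Longrightarrow> y \<in> hplane \<Longrightarrow> t \<in> {0..1} \<Longrightarrow> deriv (g t) y = jac (g t) y"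
  using paths_from_idD(2)[of g] by (intro DERIV_imp_deriv deriv_isom_plus) auto

text \<open>
  The tangent component of \<open>V\<close> has argument \<open>\<theta> + \<psi>\<close>, where \<open>\<psi>\<close> is that of the reference field.
  Its variation is the homotopy invariant \<open>angle\<close>, and that of \<open>\<psi>\<close> is the turning of the geodesic.
\<close>

lemma is_twist_imp:
  assumes g: "g \<in> paths_from_id" and y: "y \<in> hplane" and tw: "is_twist (pclass g) y \<tau>"
  shows "\<tau> = angle (pclass g) y - turn y (g 1 y)"
proof -
  obtain h c u e V \<theta> where h: "h \<in> pclass g" and c: "hgeodesic c y (pathfinish h y)"
    and u: "(y, u) \<in> unit_tangent_bundle"
    and e: "if pathfinish h y = y then \<exists>e\<^sub>0. (y, e\<^sub>0) \<in> unit_tangent_bundle \<and> (\<forall>t\<in>{0..1}. e t = e\<^sub>0)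
      else \<forall>t\<in>{0..1}. e t = hunit (c t) (vector_derivative c (at t within {0..1}))"
    and V: "homotopic_paths unit_tangent_bundle V (\<lambda>t. (h t y, deriv (h t) y * u))"
    and \<theta>: "continuous_on {0..1} \<theta>" "\<And>t. t \<in> {0..1} \<Longrightarrow> V t = (c t, cis (\<theta> t) * e t)" "\<tau> = \<theta> 1 - \<theta> 0"
    using tw unfolding is_twist_def by blast
  have h': "h \<in> paths_from_id" "pathfinish h = g 1" using pclass_member[OF g h] by (auto simp: pathfinish_def)
  have w: "g 1 y \<in> hplane" using isom_plus_hplane paths_from_idD(4)[OF g] y by blast
  obtain \<psi> where \<psi>: "continuous_on {0..1} \<psi>" "\<And>t. t \<in> {0..1} \<Longrightarrow> e t = of_real ((1 - (cmod (c t))\<^sup>2) / 2) * cis (\<psi> t)"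
    "\<psi> 1 - \<psi> 0 = turn y (g 1 y)"
    using reference_field[OF c y _ e] h'(2) w by auto
  have pc: "path c" using path_hgeodesic[OF c y] h'(2) w by simp
  have cin: "c t \<in> hplane" if "t \<in> {0..1}" for t using hgeodesic_in_hplane[OF c that] .
  have "argvar (\<lambda>t. snd (V t)) = (\<theta> 1 + \<psi> 1) - (\<theta> 0 + \<psi> 0)"
  proof (rule argvar_lift[of "\<lambda>t. (1 - (cmod (c t))\<^sup>2) / 2"])
    show "continuous_on {0..1} (\<lambda>t. (1 - (cmod (c t))\<^sup>2) / 2)"
      using pc unfolding path_def by (intro continuous_intros) auto
    show "0 < (1 - (cmod (c t))\<^sup>2) / 2" if "t \<in> {0..1}" for t using one_minus_norm_sq_pos[OF cin[OF that]] by simp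
    show "continuous_on {0..1} (\<lambda>t. \<theta> t + \<psi> t)" using \<theta> \<psi> by (intro continuous_intros)
    show "snd (V t) = of_real ((1 - (cmod (c t))\<^sup>2) / 2) * cis (\<theta> t + \<psi> t)" if "t \<in> {0..1}" for t
      unfolding \<theta>(2)[OF that] \<psi>(2)[OF that] by (simp add: cis_mult[symmetric])
  qed
  moreover have "argvar (\<lambda>t. snd (V t)) = argvar (\<lambda>t. deriv (h t) y * u)"
  proof -
    have "homotopic_paths (- {0}) (snd \<circ> V) (snd \<circ> (\<lambda>t. (h t y, deriv (h t) y * u)))"
    proof (rule homotopic_paths_continuous_image[OF V])
      show "snd \<in> unit_tangent_bundle \<rightarrow> - {0}" by (auto simp: unit_tangent_bundle_def)
    qed (intro continuous_intros)
    then show ?thesis using argvar_homotopic by (fastforce simp: comp_def)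
  qed
  moreover have "argvar (\<lambda>t. deriv (h t) y * u) = angle (pclass g) y"
  proof -
    have cy: "continuous_on {0..1} (\<lambda>t::real. y)" "(\<lambda>t::real. y) ` {0..1} \<subseteq> cball 0 1" using y by (auto simp: image_subset_iff)
    have u0: "u \<noteq> 0" using u by (auto simp: unit_tangent_bundle_def)
    have pu: "path (\<lambda>t. u)" "0 \<notin> path_image (\<lambda>t. u)" using u0 by (auto simp: path_def path_image_def)
    have u': "argvar (\<lambda>t. u) = 0"
      using argvar_lift[of "\<lambda>t. cmod u" "\<lambda>t. Arg u" "\<lambda>t. u"] u0 rcis_cmod_Arg[of u] by (simp add: rcis_def)
    have "argvar (\<lambda>t. deriv (h t) y * u) = argvar (\<lambda>t. jac (h t) y * u)"
      using deriv_path_eq[OF h'(1) y] by (intro argvar_cong) simp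
    also have "\<dots> = angle (pclass h) y"
      using argvar_mult[OF argvar_jac(2,3)[OF h'(1) cy] pu] u' angle_pclass[OF h'(1), of y] y by simp
    finally show ?thesis using pclass_eq h unfolding mem_pclass by metis
  qed
  ultimately show ?thesis using \<psi>(3) \<theta>(3) by simp
qed

text \<open>
  The disc is convex and vectors in its unit tangent bundle are determined by base point and
  Euclidean direction. Hence the path of vectors \<open>Dg\<^sub>t(u)\<close> deforms to one along the geodesic by
  moving its base points along segments with fixed Euclidean directions.
\<close>

lemma is_twist_exists:
  assumes g: "g \<in> paths_from_id" and y: "y \<in> hplane"
  shows "\<exists>\<tau>. is_twist (pclass g) y \<tau>"
proof -
  define w where "w = g 1 y"
  have w: "w \<in> hplane" using isom_plus_hplane paths_from_idD(4)[OF g] y by (auto simp: w_def)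
  note G = paths_from_idD[OF g]
  obtain c where c: "hgeodesic c y w"
    using hgeodesic_geod[OF y w] hgeodesic_const[OF y] by (cases "y = w") auto
  define R :: "complex \<Rightarrow> complex" where "R z = of_real ((1 - (cmod z)\<^sup>2) / 2)" for z
  have R: "cmod (R z) = (1 - (cmod z)\<^sup>2) / 2" if "z \<in> hplane" for z
    using one_minus_norm_sq_pos[OF that] unfolding R_def norm_of_real by simp
  define u where "u = R y"
  have u: "(y, u) \<in> unit_tangent_bundle" using R[OF y] y by (simp add: u_def unit_tangent_bundle_iff)
  define e where "e t = (if w = y then u else hunit (c t) (vector_derivative c (at t within {0..1})))" for t
  have e: "if w = y then \<exists>e\<^sub>0. (y, e\<^sub>0) \<in> unit_tangent_bundle \<and> (\<forall>t\<in>{0..1}. e t = e\<^sub>0)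
      else \<forall>t\<in>{0..1}. e t = hunit (c t) (vector_derivative c (at t within {0..1}))"
    using u by (auto simp: e_def)
  obtain \<psi> where \<psi>: "continuous_on {0..1} \<psi>" "\<And>t. t \<in> {0..1} \<Longrightarrow> e t = R (c t) * cis (\<psi> t)"
    using reference_field[OF c y w e] unfolding R_def by blast
  have cy: "continuous_on {0..1} (\<lambda>t::real. y)" "(\<lambda>t::real. y) ` {0..1} \<subseteq> cball 0 1" using y by (auto simp: image_subset_iff)
  obtain \<phi> where \<phi>: "continuous_on {0..1} \<phi>" "\<And>t. t \<in> {0..1} \<Longrightarrow> jac (g t) y = of_real (cmod (jac (g t) y)) * cis (\<phi> t)"
    using argvar_lift_exists[OF argvar_jac(2,3)[OF g cy]] by blast
  have gt: "g t \<in> isom_plus" if "t \<in> {0..1}" for t using G(2) that by blast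
  have D: "deriv (g t) y * u = R (g t y) * cis (\<phi> t)" if "t \<in> {0..1}" for t
  proof -
    have "deriv (g t) y * u = of_real (cmod (jac (g t) y)) * cis (\<phi> t) * u"
      unfolding deriv_path_eq[OF g y that] using \<phi>(2)[OF that] by simp
    also have "\<dots> = of_real (cmod (jac (g t) y) * ((1 - (cmod y)\<^sup>2) / 2)) * cis (\<phi> t)" by (simp add: u_def R_def)
    also have "cmod (jac (g t) y) * ((1 - (cmod y)\<^sup>2) / 2) = (1 - (cmod (g t y))\<^sup>2) / 2"
      using norm_jac_pos_eq[OF gt[OF that], of y] y by simp
    finally show ?thesis by (simp add: R_def)
  qed
  define V where "V t = (c t, R (c t) * cis (\<phi> t))" for t
  define \<theta> where "\<theta> t = \<phi> t - \<psi> t" for t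
  have pc: "continuous_on {0..1} c" using path_hgeodesic[OF c y w] by (simp add: path_def)
  have pg: "continuous_on {0..1} (\<lambda>t. g t y)" using continuous_on_eval[OF G(1)] .
  have cin: "c t \<in> hplane" if "t \<in> {0..1}" for t using hgeodesic_in_hplane[OF c that] .
  have gin: "g t y \<in> hplane" if "t \<in> {0..1}" for t using isom_plus_hplane[OF gt[OF that] y] .
  have ce: "c 0 = y" "c 1 = w" using c by (auto simp: hgeodesic_def)
  let ?I = "{0..1::real} \<times> {0..1::real}"
  define z where "z p = (1 - fst p) *\<^sub>R c (snd p) + fst p *\<^sub>R g (snd p) y" for p :: "real \<times> real"
  have z: "continuous_on ?I z" unfolding z_def
    by (intro continuous_intros continuous_on_compose2[OF pc] continuous_on_compose2[OF pg]) auto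
  have zin: "z p \<in> hplane" if "p \<in> ?I" for p
    unfolding z_def using that cin[of "snd p"] gin[of "snd p"]
    by (intro convexD[OF convex_ball]) (auto simp: mem_Times_iff)
  define H where "H p = (z p, R (z p) * cis (\<phi> (snd p)))" for p
  have "homotopic_paths unit_tangent_bundle V (\<lambda>t. (g t y, deriv (g t) y * u))"
    unfolding homotopic_paths
  proof (intro exI[of _ H] conjI ballI)
    have "continuous_on ?I (\<lambda>p. \<phi> (snd p))"
      by (intro continuous_on_compose2[OF \<phi>(1)] continuous_intros) auto
    then show "continuous_on ?I H" unfolding H_def R_def
      by (intro continuous_intros z continuous_on_cis) auto
    show "H \<in> ?I \<rightarrow> unit_tangent_bundle"
      using zin R by (auto simp: H_def unit_tangent_bundle_iff norm_mult)
    show "H (0, t) = V t" if "t \<in> {0..1}" for t by (simp add: H_def z_def V_def)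
    show "H (1, t) = (g t y, deriv (g t) y * u)" if "t \<in> {0..1}" for t by (simp add: H_def z_def D[OF that])
    fix t :: real assume "t \<in> {0..1}"
    show "pathstart (H \<circ> Pair t) = pathstart V" "pathfinish (H \<circ> Pair t) = pathfinish V"
      using ce G(3) by (simp_all add: pathstart_def pathfinish_def H_def V_def z_def w_def flip: scaleR_add_left)
  qed
  moreover have "V t = (c t, cis (\<theta> t) * e t)" if "t \<in> {0..1}" for t
    unfolding V_def \<psi>(2)[OF that] \<theta>_def by (simp add: cis_mult mult.left_commute)
  moreover have "continuous_on {0..1} \<theta>" unfolding \<theta>_def using \<phi>(1) \<psi>(1) by (intro continuous_intros)
  ultimately have "is_twist (pclass g) y (\<theta> 1 - \<theta> 0)"
    unfolding is_twist_def using self_in_pclass[OF g] c u e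
    by (intro bexI[of _ g] exI[of _ c] exI[of _ u] exI[of _ e] exI[of _ V] exI[of _ \<theta>])
      (simp_all add: pathfinish_def w_def)
  then show ?thesis ..
qed

lemma twist_inner_eq:
  assumes "A \<in> carrier cover_PSL2R" and y: "y \<in> hplane"
  shows "twist_inner A y = angle A y - turn y (cover_image A y)"
proof -
  obtain g where g: "g \<in> paths_from_id" "A = pclass g" using assms(1) unfolding carrier_cover by auto
  show ?thesis unfolding twist_inner_def g(2) cover_image_pclass[OF g(1)]
    using is_twist_exists[OF g(1) y] is_twist_imp[OF g(1) y] by (metis the_equality)
qed


section \<open>The twist at an ideal point\<close>

lemma tendsto_tanh_half: "((\<lambda>t::real. tanh (t / 2)) \<longlongrightarrow> 1) at_top"
proof (rule filterlim_compose[OF tanh_real_at_top])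
  have "filterlim (\<lambda>t::real. (1 / 2) * t) at_top at_top"
    by (rule filterlim_tendsto_pos_mult_at_top[OF tendsto_const _ filterlim_ident]) simp
  then show "filterlim (\<lambda>t::real. t / 2) at_top at_top" by simp
qed

lemma geodesic_ray_eq_geod:
  assumes c: "geodesic_ray c p"
  obtains y s where "y \<in> hplane" "cmod s = 1" "\<And>t. 1 \<le> t \<Longrightarrow> c t = geod y s t" "mob 1 y s = p"
proof -
  define y s where "y = c 0" "s = sgn (mob 1 (- y) (c 1))"
  have cin: "c t \<in> hplane" if "t \<ge> 0" for t using c that by (auto simp: geodesic_ray_def)
  have d: "hdist (c a) (c b) = \<bar>a - b\<bar>" if "a \<ge> 0" "b \<ge> 0" for a b using c that by (auto simp: geodesic_ray_def)
  have y: "y \<in> hplane" using cin by (simp add: y_s_def)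
  have ne: "y \<noteq> c t" if "t \<ge> 1" for t using d[of 0 t] that hdist_eq_0_iff[OF y y] by (auto simp: y_s_def)
  have s: "cmod s = 1" using direction_unit[OF y cin ne[of 1]] by (simp add: y_s_def)
  have g: "c t = geod y s t" if t: "1 \<le> t" for t
  proof -
    define s' where "s' = sgn (mob 1 (- y) (c t))"
    have s': "cmod s' = 1" using direction_unit[OF y cin ne[OF t]] t by (simp add: s'_def)
    have "hdist y (c t) = t" using d[of 0 t] t by (simp add: y_s_def)
    moreover have "hdist y (c 1) = 1" "hdist (c 1) (c t) = t - 1" using d[of 0 1] d[of 1 t] t by (simp_all add: y_s_def)
    ultimately have "c t = geod y s' t" "c 1 = geod y s' 1"
      using geod_hdist_end[OF y cin ne[OF t]] between_eq_geod[OF y cin cin ne[OF t], of 1] t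
      by (simp_all add: s'_def)
    moreover from this(2) have "s = s'"
      using mob_1_inverse(1)[OF y] s' by (simp add: y_s_def geod_def sgn_mult sgn_of_real sgn_div_norm[of s'])
    ultimately show ?thesis by simp
  qed
  have "(c \<longlongrightarrow> p) at_top" using c by (simp add: geodesic_ray_def)
  moreover have "(c \<longlongrightarrow> mob 1 y s) at_top"
  proof -
    note tendsto_tanh_half
    then have "((\<lambda>t::real. of_real (tanh (t / 2)) * s) \<longlongrightarrow> of_real 1 * s) at_top" by (intro tendsto_intros)
    moreover have "continuous_on (cball 0 1) (mob 1 y)" using y by (intro continuous_on_mob) auto
    moreover have "of_real (tanh (t / 2)) * s \<in> cball 0 1" for t :: real
      using tanh_mult_in_hplane[OF s, of "t / 2"] by simp
    ultimately have "((\<lambda>t. mob 1 y (of_real (tanh (t / 2)) * s)) \<longlongrightarrow> mob 1 y (of_real 1 * s)) at_top"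
      using s by (intro continuous_on_tendsto_compose[of "cball 0 1" "mob 1 y"]) auto
    then have "((\<lambda>t. geod y s t) \<longlongrightarrow> mob 1 y s) at_top" by (simp add: geod_def)
    then show ?thesis
      by (rule Lim_transform_eventually) (use g in \<open>auto intro: eventually_mono[OF eventually_ge_at_top[of 1]]\<close>)
  qed
  ultimately have "mob 1 y s = p" by (intro tendsto_unique) auto
  then show ?thesis using that y s g by blast
qed

text \<open>
  To first order an isometry maps the radius ending at the ideal point \<open>s\<close> to the radius ending
  at \<open>f s\<close>, scaled by the positive factor \<open>m\<close>. Exactness of the expansion avoids error terms.
\<close>

lemma isom_boundary_expansion:
  assumes f: "f \<in> isom_plus" and s: "cmod s = 1"
  obtains k m where "0 < m" "(k \<longlongrightarrow> of_real m * f s) (at_left (1::real))"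
    "\<And>\<rho>. \<rho> \<in> {0..1} \<Longrightarrow> f (of_real \<rho> * s) = f s - of_real (1 - \<rho>) * k \<rho>"
proof -
  define u b where "u = mob_arg f" "b = f 0"
  have ub: "cmod u = 1" "b \<in> hplane" "f = mob u b" using isom_plusE[OF f] by (auto simp: u_b_def)
  have s1: "s \<in> cball 0 1" using s by simp
  have \<rho>s: "of_real \<rho> * s \<in> cball 0 1" if "\<rho> \<in> {0..1}" for \<rho> using that s by (simp add: norm_mult)
  define E where "E = 1 + cnj b * u * s"
  have E: "E \<noteq> 0" unfolding E_def by (rule mob_den_nonzero[OF ub(1,2) s1])
  define k where "k \<rho> = u * of_real (1 - (cmod b)\<^sup>2) * s / (E * (1 + cnj b * u * (of_real \<rho> * s)))" for \<rho> :: real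
  define m where "m = (1 - (cmod b)\<^sup>2) / (cmod E)\<^sup>2"
  have m: "0 < m" using one_minus_norm_sq_pos[OF ub(2)] E by (simp add: m_def)
  have exp: "f (of_real \<rho> * s) = f s - of_real (1 - \<rho>) * k \<rho>" if "\<rho> \<in> {0..1}" for \<rho>
  proof -
    have "f s - f (of_real \<rho> * s) = of_real (1 - \<rho>) * k \<rho>"
      unfolding ub(3) mob_diff[OF ub(1,2) s1 \<rho>s[OF that]] k_def E_def by (simp add: algebra_simps)
    then show ?thesis by (simp add: algebra_simps)
  qed
  have "(k \<longlongrightarrow> u * of_real (1 - (cmod b)\<^sup>2) * s / (E * (1 + cnj b * u * (of_real 1 * s)))) (at_left 1)"
    unfolding k_def using E by (intro tendsto_intros) (auto simp: E_def)
  also have "u * of_real (1 - (cmod b)\<^sup>2) * s / (E * (1 + cnj b * u * (of_real 1 * s))) = of_real m * f s"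
  proof -
    have "u * cnj u = 1" "s * cnj s = 1" using ub(1) s by (simp_all add: complex_mult_cnj cmod_power2[symmetric])
    then have "u * s * cnj E = u * s + b * ((u * cnj u) * (s * cnj s))" by (simp add: E_def algebra_simps)
    then have us: "u * s + b = u * s * cnj E" using \<open>u * cnj u = 1\<close> \<open>s * cnj s = 1\<close> by simp
    have "f s = u * s * cnj E / E" using s1 unfolding ub(3) mob_def E_def[symmetric] us by simp
    moreover have "of_real m = of_real (1 - (cmod b)\<^sup>2) / (E * cnj E)"
      unfolding m_def by (simp only: of_real_divide complex_norm_square)
    ultimately show ?thesis using E by (simp add: E_def[symmetric])
  qed
  finally show ?thesis using that m exp by blast
qed

text \<open>
  The delicate case is \<open>f p = p\<close>, in which \<open>1 - cnj (c t) * f (c t)\<close> tends to \<open>0\<close>. Both \<open>c t\<close> and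
  \<open>f (c t)\<close> approach \<open>p\<close> radially, so this number is asymptotically a positive multiple of
  \<open>1 - tanh (t / 2)\<close>. Its argument tends to \<open>0\<close>, which is also the value of \<open>turn p p\<close>.
\<close>

lemma turn_tendsto_ideal:
  assumes c: "geodesic_ray c p" and f: "f \<in> isom_plus" and p: "cmod p = 1"
  shows "((\<lambda>t. turn (c t) (f (c t))) \<longlongrightarrow> turn p (f p)) at_top"
proof (cases "f p = p")
  case False
  have p1: "p \<in> cball 0 1" using p by simp
  have lim: "(c \<longlongrightarrow> p) at_top" using c by (simp add: geodesic_ray_def)
  have cin: "\<forall>\<^sub>F t in at_top. c t \<in> cball 0 1"
    using c by (intro eventually_mono[OF eventually_ge_at_top[of 0]]) (force simp: geodesic_ray_def)
  have "continuous_on (cball 0 1) f" using f by (simp add: isom_plus_def)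
  then have "((\<lambda>t. f (c t)) \<longlongrightarrow> f p) at_top"
    using lim p1 cin by (rule continuous_on_tendsto_compose)
  then show ?thesis
    using lim p1 isom_plus_cball[OF f p1] False by (intro tendsto_turn) auto
next
  case True
  obtain y s where y: "y \<in> hplane" and s: "cmod s = 1" and cg: "\<And>t. 1 \<le> t \<Longrightarrow> c t = geod y s t" and ps: "mob 1 y s = p"
    using geodesic_ray_eq_geod[OF c] by blast
  have M: "mob 1 y \<in> isom_plus" using y by (intro mob_in_isom_plus) auto
  have N: "f \<circ> mob 1 y \<in> isom_plus" by (rule comp_in_isom_plus[OF f M])
  have Ns: "(f \<circ> mob 1 y) s = p" using ps True by simp
  obtain k m where k: "0 < m" "(k \<longlongrightarrow> of_real m * p) (at_left (1::real))"
    "\<And>\<rho>. \<rho> \<in> {0..1} \<Longrightarrow> mob 1 y (of_real \<rho> * s) = p - of_real (1 - \<rho>) * k \<rho>"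
    using isom_boundary_expansion[OF M s] unfolding ps by blast
  obtain k' m' where k': "0 < m'" "(k' \<longlongrightarrow> of_real m' * p) (at_left (1::real))"
    "\<And>\<rho>. \<rho> \<in> {0..1} \<Longrightarrow> (f \<circ> mob 1 y) (of_real \<rho> * s) = p - of_real (1 - \<rho>) * k' \<rho>"
    using isom_boundary_expansion[OF N s] unfolding Ns by blast
  have pp: "p * cnj p = 1" using p by (simp add: complex_mult_cnj cmod_power2[symmetric])
  define G where "G \<rho> = cnj p * k' \<rho> + p * cnj (k \<rho>) - of_real (1 - \<rho>) * cnj (k \<rho>) * k' \<rho>" for \<rho> :: real
  have "(G \<longlongrightarrow> cnj p * (of_real m' * p) + p * cnj (of_real m * p) - of_real (1 - 1) * cnj (of_real m * p) * (of_real m' * p)) (at_left 1)"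
    unfolding G_def by (intro tendsto_intros k(2) k'(2))
  also have "cnj p * (of_real m' * p) + p * cnj (of_real m * p) - of_real (1 - 1) * cnj (of_real m * p) * (of_real m' * p) = of_real m' * (p * cnj p) + of_real m * (p * cnj p)"
    by simp
  also have "\<dots> = of_real (m + m')" unfolding pp by simp
  finally have G: "(G \<longlongrightarrow> of_real (m + m')) (at_left 1)" .
  have "((\<lambda>\<rho>. Arg (G \<rho>)) \<longlongrightarrow> Arg (of_real (m + m'))) (at_left 1)"
    using k(1) k'(1) by (intro tendsto_Arg[OF G]) (simp del: of_real_add)
  moreover have "filterlim (\<lambda>t::real. tanh (t / 2)) (at_left 1) at_top"
    using tendsto_tanh_half by (simp add: filterlim_at tanh_real_lt_1 less_imp_neq)
  ultimately have lim: "((\<lambda>t. Arg (G (tanh (t / 2)))) \<longlongrightarrow> Arg (of_real (m + m'))) at_top"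
    by (rule filterlim_compose)
  have "turn (c t) (f (c t)) = 2 * Arg (G (tanh (t / 2)))" if t: "1 \<le> t" for t
  proof -
    define \<rho> where "\<rho> = tanh (t / 2)"
    have \<rho>: "0 \<le> \<rho>" "\<rho> < 1" using t by (auto simp: \<rho>_def tanh_real_lt_1)
    have cc: "c t = p - of_real (1 - \<rho>) * k \<rho>" "f (c t) = p - of_real (1 - \<rho>) * k' \<rho>"
      using k(3)[of \<rho>] k'(3)[of \<rho>] \<rho> cg[OF t] by (simp_all add: geod_def \<rho>_def)
    have "1 - cnj (c t) * f (c t) = 1 - p * cnj p + of_real (1 - \<rho>) * G \<rho>"
      unfolding cc(2) unfolding cc(1) G_def complex_cnj_diff complex_cnj_mult complex_cnj_complex_of_real
      by (simp only: algebra_simps)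
    then show ?thesis using \<rho> by (simp add: pp turn_def \<rho>_def[symmetric] Arg_times_of_real del: of_real_diff)
  qed
  then have "((\<lambda>t. turn (c t) (f (c t))) \<longlongrightarrow> 2 * Arg (of_real (m + m'))) at_top"
    by (intro Lim_transform_eventually[OF tendsto_mult_left[OF lim]])
      (auto intro: eventually_mono[OF eventually_ge_at_top[of 1]])
  moreover have "Arg (of_real (m + m')) = 0" using k(1) k'(1) by (simp only: Arg_of_real) simp
  ultimately show ?thesis using turn_refl[of p] p True by simp
qed

lemma geodesic_ray_exists: "cmod p = 1 \<Longrightarrow> geodesic_ray (geod 0 p) p"
proof -
  assume p: "cmod p = 1"
  note tendsto_tanh_half
  then have "((\<lambda>t::real. of_real (tanh (t / 2)) * p) \<longlongrightarrow> of_real 1 * p) at_top" by (intro tendsto_intros)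
  moreover have "geod 0 p = (\<lambda>t. of_real (tanh (t / 2)) * p)"
    using tanh_mult_in_hplane[OF p] by (auto simp: geod_def mob_def fun_eq_iff)
  ultimately have "(geod 0 p \<longlongrightarrow> p) at_top" by simp
  then show ?thesis using p geod_in_hplane[of 0 p] hdist_geod[of 0 p] by (auto simp: geodesic_ray_def)
qed

text \<open>
  At ideal points both terms of \<open>twist_inner_eq\<close> have limits along every geodesic ray, namely
  their values at \<open>p\<close>.
\<close>

theorem Tw_eq:
  assumes A: "A \<in> carrier cover_PSL2R" and p: "p \<in> cball 0 1"
  shows "Tw A p = angle A p - turn p (cover_image A p)"
proof (cases "p \<in> hplane")
  case True
  then show ?thesis using twist_inner_eq[OF A] by (simp add: Tw_def)
next
  case False
  then have p1: "cmod p = 1" using p by simp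
  have f: "cover_image A \<in> isom_plus" using COVH.hom_closed[OF A] by simp
  have lim: "((\<lambda>t. twist_inner A (c t)) \<longlongrightarrow> angle A p - turn p (cover_image A p)) at_top" if c: "geodesic_ray c p" for c
  proof -
    have cin: "c t \<in> hplane" if "t \<ge> 0" for t using c that by (auto simp: geodesic_ray_def)
    have cp: "(c \<longlongrightarrow> p) at_top" using c by (simp add: geodesic_ray_def)
    have ev: "\<forall>\<^sub>F t in at_top. c t \<in> cball 0 1"
      using cin by (intro eventually_mono[OF eventually_ge_at_top[of 0]]) force
    have "((\<lambda>t. angle A (c t)) \<longlongrightarrow> angle A p) at_top"
      using continuous_on_angle[OF A] cp p ev by (rule continuous_on_tendsto_compose)
    then have "((\<lambda>t. angle A (c t) - turn (c t) (cover_image A (c t))) \<longlongrightarrow> angle A p - turn p (cover_image A p)) at_top"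
      using turn_tendsto_ideal[OF c f p1] by (intro tendsto_diff)
    then show ?thesis
      by (rule Lim_transform_eventually)
        (use twist_inner_eq[OF A cin] in \<open>auto intro: eventually_mono[OF eventually_ge_at_top[of 0]]\<close>)
  qed
  have "(THE L. \<forall>c. geodesic_ray c p \<longrightarrow> ((\<lambda>t. twist_inner A (c t)) \<longlongrightarrow> L) at_top) = angle A p - turn p (cover_image A p)"
    using lim geodesic_ray_exists[OF p1] tendsto_unique[OF trivial_limit_at_top_linorder] by (intro the_equality) blast+
  then show ?thesis using False by (simp add: Tw_def)
qed

section \<open>Change of variables in the plane\<close>

text \<open>
  Used to transfer integrals between \<open>\<real>\<^sup>2\<close>, where the change of variables theorem is stated, and
  \<open>\<real> \<times> \<real>\<close> and \<open>\<complex>\<close>, where iterated integration and the hyperbolic area live.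
\<close>

lemma distr_lborel_basis_bij:
  fixes \<phi> :: "'a::euclidean_space \<Rightarrow> 'b::euclidean_space"
  assumes lin: "linear \<phi>" and bij: "bij_betw \<phi> Basis Basis"
  shows "distr lborel borel \<phi> = lborel"
proof (rule lborel_eqI[symmetric])
  have meas: "\<phi> \<in> borel_measurable lborel"
    using linear_continuous_on[of \<phi> UNIV] lin by (simp add: borel_measurable_continuous_onI linear_conv_bounded_linear)
  have inner: "\<phi> x \<bullet> \<phi> b = x \<bullet> b" if b: "b \<in> Basis" for x b
  proof -
    have "\<phi> x = \<phi> (\<Sum>i\<in>Basis. (x \<bullet> i) *\<^sub>R i)" by (simp add: euclidean_representation)
    also have "\<dots> = (\<Sum>i\<in>Basis. (x \<bullet> i) *\<^sub>R \<phi> i)" by (simp add: linear_sum[OF lin] linear_scale[OF lin])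
    finally have "\<phi> x \<bullet> \<phi> b = (\<Sum>i\<in>Basis. (x \<bullet> i) * (\<phi> i \<bullet> \<phi> b))" by (simp add: inner_sum_left)
    also have "\<dots> = (\<Sum>i\<in>Basis. if i = b then x \<bullet> i else 0)"
    proof (rule sum.cong[OF refl])
      fix i :: 'a assume i: "i \<in> Basis"
      have "\<phi> i \<in> Basis" "\<phi> b \<in> Basis" "\<phi> i = \<phi> b \<longleftrightarrow> i = b"
        using bij i b by (auto simp: bij_betw_def inj_on_def)
      then show "x \<bullet> i * (\<phi> i \<bullet> \<phi> b) = (if i = b then x \<bullet> i else 0)" by (simp add: inner_Basis)
    qed
    also have "\<dots> = x \<bullet> b" using b by simp
    finally show ?thesis .
  qed
  have img: "\<phi> ` Basis = Basis" "inj_on \<phi> Basis" using bij by (auto simp: bij_betw_def)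
  fix l u :: 'b
  assume le: "\<And>b. b \<in> Basis \<Longrightarrow> l \<bullet> b \<le> u \<bullet> b"
  define l' u' where "l' = (\<Sum>b\<in>Basis. (l \<bullet> \<phi> b) *\<^sub>R b)" "u' = (\<Sum>b\<in>Basis. (u \<bullet> \<phi> b) *\<^sub>R b)"
  have lu: "l' \<bullet> b = l \<bullet> \<phi> b" "u' \<bullet> b = u \<bullet> \<phi> b" if "b \<in> Basis" for b
    using that by (simp_all add: l'_u'_def)
  have "\<phi> -` box l u = box l' u'"
  proof -
    have "x \<in> \<phi> -` box l u \<longleftrightarrow> (\<forall>b\<in>Basis. l \<bullet> \<phi> b < \<phi> x \<bullet> \<phi> b \<and> \<phi> x \<bullet> \<phi> b < u \<bullet> \<phi> b)" for x
      unfolding mem_box vimage_eq img(1)[symmetric] by simp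
    then show ?thesis by (auto simp: mem_box inner lu)
  qed
  then have "emeasure (distr lborel borel \<phi>) (box l u) = emeasure lborel (box l' u')"
    using meas by (subst emeasure_distr) auto
  also have "\<dots> = (\<Prod>b\<in>Basis. (u' - l') \<bullet> b)"
    using le img(1) by (intro emeasure_lborel_box) (auto simp: lu)
  also have "(\<Prod>b\<in>Basis. (u' - l') \<bullet> b) = (\<Prod>b\<in>Basis. (u - l) \<bullet> \<phi> b)"
    by (rule prod.cong) (auto simp: inner_diff_left lu)
  also have "\<dots> = (\<Prod>b\<in>\<phi> ` Basis. (u - l) \<bullet> b)" by (simp add: prod.reindex[OF img(2)])
  finally show "emeasure (distr lborel borel \<phi>) (box l u) = (\<Prod>b\<in>Basis. (u - l) \<bullet> b)" unfolding img(1) .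
qed simp

definition cart_prod :: "real^2 \<Rightarrow> real \<times> real" where "cart_prod v = (v $ 1, v $ 2)"
definition cart_complex :: "real^2 \<Rightarrow> complex" where "cart_complex v = Complex (v $ 1) (v $ 2)"
definition complex_cart :: "complex \<Rightarrow> real^2" where "complex_cart z = vector [Re z, Im z]"

lemma Basis_real2: "(Basis :: (real^2) set) = {axis 1 1, axis 2 1}"
  by (auto simp: Basis_vec_def UNIV_2)

lemma cart_complex_inverse [simp]: "cart_complex (complex_cart z) = z" "complex_cart (cart_complex v) = v"
  by (auto simp: cart_complex_def complex_cart_def vec_eq_iff forall_2)

lemma linear_cart: "linear cart_prod" "linear cart_complex" "linear complex_cart"
  by (auto intro!: linearI simp: cart_prod_def cart_complex_def complex_cart_def complex_eq_iff vec_eq_iff forall_2)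

lemma distr_cart_prod: "distr lborel borel cart_prod = lborel"
  by (rule distr_lborel_basis_bij[OF linear_cart(1)])
    (auto simp: bij_betw_def Basis_real2 Basis_prod_def cart_prod_def axis_def inj_on_def vec_eq_iff forall_2)

lemma distr_cart_complex: "distr lborel borel cart_complex = lborel"
  by (rule distr_lborel_basis_bij[OF linear_cart(2)])
    (auto simp: bij_betw_def Basis_real2 Basis_complex_def cart_complex_def axis_def inj_on_def vec_eq_iff forall_2 complex_eq_iff)

lemma borel_measurable_cart [measurable]:
  "cart_prod \<in> borel_measurable borel" "cart_complex \<in> borel_measurable borel"
  using linear_continuous_on linear_cart by (auto intro!: borel_measurable_continuous_onI simp: linear_conv_bounded_linear)

text \<open>
  If \<open>a\<close> and \<open>b\<close> are the partial derivatives of \<open>g\<close>, the Jacobian determinant is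
  \<open>Im (cnj a * b)\<close>.
\<close>

lemma change_of_variables_complex:
  fixes g :: "real \<times> real \<Rightarrow> complex" and f :: "complex \<Rightarrow> real"
  assumes S: "S \<in> sets borel" and T: "g ` S \<in> sets borel" and inj: "inj_on g S"
    and der: "\<And>p. p \<in> S \<Longrightarrow> (g has_derivative (\<lambda>h. fst h *\<^sub>R a p + snd h *\<^sub>R b p)) (at p)"
    and f: "f \<in> borel_measurable borel"
    and int: "set_integrable lborel S (\<lambda>p. \<bar>Im (cnj (a p) * b p)\<bar> * f (g p))"
  shows "set_integrable lborel (g ` S) f"
    "(LINT z:g ` S|lborel. f z) = (LINT p:S|lborel. \<bar>Im (cnj (a p) * b p)\<bar> * f (g p))"
proof -
  define G where "G = complex_cart \<circ> g \<circ> cart_prod"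
  define S' where "S' = cart_prod -` S"
  define G' where "G' v = (\<lambda>h. complex_cart (fst (cart_prod h) *\<^sub>R a (cart_prod v) + snd (cart_prod h) *\<^sub>R b (cart_prod v)))" for v
  define F where "F v = (vec (f (cart_complex v)) :: real^1)" for v
  define J where "J v = \<bar>Im (cnj (a (cart_prod v)) * b (cart_prod v))\<bar> * f (g (cart_prod v))" for v
  have S': "S' \<in> sets borel" using S measurable_sets[OF borel_measurable_cart(1), of S] by (simp add: S'_def)
  have GS': "G ` S' = cart_complex -` (g ` S)"
  proof -
    have "cart_prod ` S' = S" unfolding S'_def
      by (rule surj_image_vimage_eq) (rule surjI[of _ "\<lambda>p. vector [fst p, snd p]"], simp add: cart_prod_def)
    then have "G ` S' = complex_cart ` (g ` S)" by (auto simp: G_def image_comp[symmetric])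
    also have "\<dots> = cart_complex -` (g ` S)" by (auto simp: image_iff) (metis cart_complex_inverse(2))
    finally show ?thesis .
  qed
  have T': "G ` S' \<in> sets borel" unfolding GS' using T measurable_sets[OF borel_measurable_cart(2), of "g ` S"] by simp
  have inj': "inj_on G S'"
  proof (rule inj_onI)
    fix v w assume vw: "v \<in> S'" "w \<in> S'" "G v = G w"
    have "g (cart_prod v) = g (cart_prod w)" using arg_cong[OF vw(3), of cart_complex] by (simp add: G_def)
    then have "cart_prod v = cart_prod w" using inj vw by (auto simp: S'_def inj_on_def)
    then show "v = w" by (auto simp: cart_prod_def vec_eq_iff forall_2)
  qed
  have der': "(G has_derivative G' v) (at v within S')" if "v \<in> S'" for v
  proof -
    have 1: "(cart_prod has_derivative cart_prod) (at v within S')"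
      and 3: "(complex_cart has_derivative complex_cart) (at z within X)" for z X
      using linear_cart by (auto intro!: bounded_linear_imp_has_derivative simp: linear_conv_bounded_linear)
    have "(g has_derivative (\<lambda>h. fst h *\<^sub>R a (cart_prod v) + snd h *\<^sub>R b (cart_prod v))) (at (cart_prod v) within cart_prod ` S')"
      using that by (intro has_derivative_at_withinI[OF der]) (simp add: S'_def)
    from diff_chain_within[OF 1 this] have 2: "((g \<circ> cart_prod) has_derivative
      ((\<lambda>h. fst h *\<^sub>R a (cart_prod v) + snd h *\<^sub>R b (cart_prod v)) \<circ> cart_prod)) (at v within S')" .
    from diff_chain_within[OF 2 3] show ?thesis by (simp add: G_def G'_def comp_def)
  qed
  have det: "det (matrix (G' v)) = Im (cnj (a (cart_prod v)) * b (cart_prod v))" for v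
    by (simp add: det_2 matrix_def G'_def cart_prod_def complex_cart_def axis_def)
  have FG: "\<bar>det (matrix (G' v))\<bar> *\<^sub>R F (G v) = vec (J v)" for v
    by (simp add: det F_def G_def J_def vec_eq_iff)
  have abs_iff: "(\<lambda>v. vec (h v) :: real^1) absolutely_integrable_on X \<longleftrightarrow> h absolutely_integrable_on X" for h :: "real^2 \<Rightarrow> real" and X
    by (subst absolutely_integrable_componentwise_iff) (auto simp: Basis_vec_def inner_axis)
  have int1: "integral X (\<lambda>v. vec (h v) :: real^1) = vec (integral X h)" if "h absolutely_integrable_on X" for h :: "real^2 \<Rightarrow> real" and X
  proof -
    have "(\<lambda>v. vec (h v) :: real^1) integrable_on X"
      using that abs_iff set_lebesgue_integral_eq_integral(1) by blast
    then show ?thesis using integral_component_eq_cart[of "\<lambda>v. vec (h v) :: real^1" X] by (simp add: vec_eq_iff)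
  qed
  have J_meas: "(\<lambda>p. indicator S p *\<^sub>R (\<bar>Im (cnj (a p) * b p)\<bar> * f (g p))) \<in> borel_measurable lborel"
    using int unfolding set_integrable_def by (rule borel_measurable_integrable)
  have ind: "(\<lambda>v. indicator S' v *\<^sub>R J v) = (\<lambda>p. indicator S p *\<^sub>R (\<bar>Im (cnj (a p) * b p)\<bar> * f (g p))) \<circ> cart_prod"
    by (auto simp: J_def S'_def indicator_def fun_eq_iff)
  have intJ: "integrable lborel (\<lambda>v. indicator S' v *\<^sub>R J v)"
    unfolding ind comp_def using int unfolding set_integrable_def
    by (subst integrable_distr_eq[symmetric, where N = borel]) (use J_meas in \<open>auto simp: distr_cart_prod\<close>)
  have valJ: "(\<integral>v. indicator S' v *\<^sub>R J v \<partial>lborel) = (LINT p:S|lborel. \<bar>Im (cnj (a p) * b p)\<bar> * f (g p))"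
    unfolding ind comp_def set_lebesgue_integral_def using J_meas
    by (subst integral_distr[symmetric, where N = borel]) (auto simp: distr_cart_prod)
  have absJ: "J absolutely_integrable_on S'"
    unfolding set_integrable_def using intJ by (simp add: integrable_completion borel_measurable_integrable)
  have IJ: "integral S' J = (LINT p:S|lborel. \<bar>Im (cnj (a p) * b p)\<bar> * f (g p))"
  proof -
    have "integral S' J = (LINT v:S'|lebesgue. J v)"
      using set_lebesgue_integral_eq_integral(2)[OF absJ] by simp
    also have "\<dots> = (\<integral>v. indicator S' v *\<^sub>R J v \<partial>lborel)"
      unfolding set_lebesgue_integral_def using intJ by (intro integral_completion) (rule borel_measurable_integrable)
    finally show ?thesis using valJ by simp
  qed
  have "F absolutely_integrable_on (G ` S') \<and> integral (G ` S') F = vec (integral S' J)"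
    using has_absolute_integral_change_of_variables[of S' G G' F "vec (integral S' J)"] S' der' inj' absJ
    unfolding FG abs_iff using int1[OF absJ] by (simp add: abs_iff)
  then have "(\<lambda>v. f (cart_complex v)) absolutely_integrable_on (G ` S')"
    "integral (G ` S') (\<lambda>v. f (cart_complex v)) = integral S' J"
    unfolding F_def using abs_iff int1 by (metis, metis vec_component)
  note fc = this
  have meas2: "(\<lambda>v. indicator (G ` S') v *\<^sub>R f (cart_complex v)) \<in> borel_measurable lborel"
    using T' f by (intro borel_measurable_scaleR borel_measurable_indicator) (auto intro: measurable_compose[OF borel_measurable_cart(2)])
  have ind2: "(\<lambda>v. indicator (G ` S') v *\<^sub>R f (cart_complex v)) = (\<lambda>z. indicator (g ` S) z *\<^sub>R f z) \<circ> cart_complex"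
    unfolding GS' by (auto simp: indicator_def fun_eq_iff)
  have meas3: "(\<lambda>z. indicator (g ` S) z *\<^sub>R f z) \<in> borel_measurable borel" using T f by auto
  have i2: "integrable lborel (\<lambda>v. indicator (G ` S') v *\<^sub>R f (cart_complex v))"
    using fc(1) meas2 unfolding set_integrable_def by (simp add: integrable_completion)
  have cm: "cart_complex \<in> measurable lborel borel" by simp
  show "set_integrable lborel (g ` S) f"
    using i2 integrable_distr_eq[OF cm meas3] unfolding ind2 comp_def distr_cart_complex set_integrable_def by blast
  have "(LINT z:g ` S|lborel. f z) = (\<integral>v. indicator (G ` S') v *\<^sub>R f (cart_complex v) \<partial>lborel)"
    using integral_distr[OF cm meas3] unfolding ind2 comp_def distr_cart_complex set_lebesgue_integral_def .
  also have "\<dots> = integral (G ` S') (\<lambda>v. f (cart_complex v))"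
    using set_lebesgue_integral_eq_integral(2)[OF fc(1)] integral_completion[OF meas2]
    by (simp add: set_lebesgue_integral_def)
  finally show "(LINT z:g ` S|lborel. f z) = (LINT p:S|lborel. \<bar>Im (cnj (a p) * b p)\<bar> * f (g p))"
    using fc(2) IJ by simp
qed

section \<open>The area of a triangle with a vertex at the centre\<close>

text \<open>
  The inverse of \<open>klein\<close> on the closed disc.
\<close>

definition unklein :: "complex \<Rightarrow> complex" where
  "unklein k = (1 / (1 + sqrt (1 - (cmod k)\<^sup>2))) *\<^sub>R k"

lemma unklein_klein: assumes "z \<in> cball 0 1" shows "unklein (klein z) = z"
proof -
  define n where "n = (cmod z)\<^sup>2"
  have n: "0 \<le> n" "n \<le> 1" using assms by (auto simp: n_def power_le_one)
  have "(cmod (klein z))\<^sup>2 = 4 * n / (1 + n)\<^sup>2"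
    by (simp add: klein_def n_def power_mult_distrib power_divide)
  moreover have "1 - 4 * n / (1 + n)\<^sup>2 = ((1 - n) / (1 + n))\<^sup>2"
  proof -
    have "((1 - n) / (1 + n))\<^sup>2 = ((1 + n)\<^sup>2 - 4 * n) / (1 + n)\<^sup>2"
      unfolding power_divide by (simp add: power2_eq_square algebra_simps)
    also have "\<dots> = 1 - 4 * n / (1 + n)\<^sup>2" using n by (simp add: diff_divide_distrib)
    finally show ?thesis ..
  qed
  ultimately have s: "sqrt (1 - (cmod (klein z))\<^sup>2) = (1 - n) / (1 + n)" using n by simp
  have "1 + (1 - n) / (1 + n) = 2 / (1 + n)" using n by (simp add: field_simps)
  then have "unklein (klein z) = ((1 / (2 / (1 + n))) * (2 / (1 + n))) *\<^sub>R z"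
    unfolding unklein_def s by (simp only: klein_def n_def[symmetric] scaleR_scaleR)
  moreover have "1 / (2 / (1 + n)) * (2 / (1 + n)) = 1" using n by (intro nonzero_eq_divide_eq[THEN iffD1, OF _ refl]) auto
  ultimately show ?thesis by (simp only: scaleR_one)
qed

lemma norm_unklein_sq: assumes "k \<in> cball 0 1"
  shows "(cmod (unklein k))\<^sup>2 = (1 - sqrt (1 - (cmod k)\<^sup>2)) / (1 + sqrt (1 - (cmod k)\<^sup>2))"
proof -
  define R where "R = sqrt (1 - (cmod k)\<^sup>2)"
  have R: "0 \<le> R" "R\<^sup>2 = 1 - (cmod k)\<^sup>2" using assms by (auto simp: R_def power_le_one)
  have "(cmod (unklein k))\<^sup>2 = (cmod k)\<^sup>2 / (1 + R)\<^sup>2"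
    using R(1) unfolding unklein_def R_def[symmetric] by (simp add: power_divide)
  also have "(cmod k)\<^sup>2 = (1 - R) * (1 + R)" using R(2) by (simp add: algebra_simps power2_eq_square)
  also have "\<dots> / (1 + R)\<^sup>2 = (1 - R) / (1 + R)" using R(1) by (simp add: power2_eq_square)
  finally show ?thesis by (simp add: R_def)
qed

lemma klein_unklein: assumes k: "k \<in> cball 0 1" shows "klein (unklein k) = k"
proof -
  define R where "R = sqrt (1 - (cmod k)\<^sup>2)"
  have R: "0 \<le> R" using k by (auto simp: R_def power_le_one)
  have "1 + (1 - R) / (1 + R) = 2 / (1 + R)" using R by (simp add: field_simps)
  then show ?thesis using R unfolding klein_def norm_unklein_sq[OF k] R_def[symmetric]
    by (simp add: unklein_def R_def[symmetric])
qed

lemma unklein_in_cball: "k \<in> cball 0 1 \<Longrightarrow> unklein k \<in> cball 0 1"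
  and unklein_in_hplane: "k \<in> hplane \<Longrightarrow> unklein k \<in> hplane"
proof -
  have b: "(cmod (unklein k))\<^sup>2 \<le> 1" if "k \<in> cball 0 1"
  proof -
    define r where "r = sqrt (1 - (cmod k)\<^sup>2)"
    have "0 \<le> r" using that by (auto simp: power_le_one r_def)
    then show ?thesis unfolding norm_unklein_sq[OF that] r_def[symmetric] by (simp add: divide_le_eq_1)
  qed
  then show "k \<in> cball 0 1 \<Longrightarrow> unklein k \<in> cball 0 1" by (simp add: abs_square_le_1)
  assume k: "k \<in> hplane"
  define r where "r = sqrt (1 - (cmod k)\<^sup>2)"
  have "0 < r" using one_minus_norm_sq_pos[OF k] by (simp add: r_def)
  moreover have "k \<in> cball 0 1" using k by simp
  ultimately have "(cmod (unklein k))\<^sup>2 < 1"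
    using norm_unklein_sq[of k] unfolding r_def[symmetric] by (simp add: divide_less_eq)
  then show "unklein k \<in> hplane" by (simp add: abs_square_less_1)
qed

lemma klein_in_cball: "klein z \<in> cball 0 1"
proof -
  have "2 * cmod z \<le> 1 + (cmod z)\<^sup>2" using zero_le_power2[of "1 - cmod z"] by (simp add: power2_eq_square algebra_simps)
  moreover have "0 < 1 + (cmod z)\<^sup>2" by (simp add: add_pos_nonneg)
  ultimately show ?thesis by (simp add: klein_def)
qed

lemma klein_in_hplane: "z \<in> hplane \<Longrightarrow> klein z \<in> hplane"
proof -
  assume z: "z \<in> hplane"
  have "0 < (1 - cmod z)\<^sup>2" using z by simp
  then have "2 * cmod z < 1 + (cmod z)\<^sup>2" by (simp add: power2_eq_square algebra_simps)
  moreover have "0 < 1 + (cmod z)\<^sup>2" by (simp add: add_pos_nonneg)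
  ultimately show ?thesis by (simp add: klein_def)
qed

lemma continuous_on_klein: "continuous_on S klein"
proof -
  have "1 + (cmod z)\<^sup>2 \<noteq> 0" for z :: complex using add_pos_nonneg[of 1 "(cmod z)\<^sup>2"] by simp
  then show ?thesis unfolding klein_def by (intro continuous_intros) auto
qed

lemma continuous_on_unklein: "continuous_on (cball 0 1) unklein"
proof -
  have "1 + sqrt (1 - (cmod z)\<^sup>2) \<noteq> 0" if "z \<in> cball 0 1" for z
  proof -
    have "0 \<le> sqrt (1 - (cmod z)\<^sup>2)" using that by (auto simp: power_le_one)
    then show ?thesis by linarith
  qed
  then show ?thesis unfolding unklein_def by (intro continuous_intros) auto
qed

text \<open>
  The open triangle with vertices \<open>0\<close>, \<open>x\<close>, \<open>y\<close>, provided that these are not collinear.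
\<close>

definition tri :: "complex \<Rightarrow> complex \<Rightarrow> complex set" where
  "tri x y = {a *\<^sub>R x + b *\<^sub>R y | a b. 0 < a \<and> 0 < b \<and> a + b < (1::real)}"

definition htri :: "complex \<Rightarrow> complex \<Rightarrow> complex set" where
  "htri x y = {z \<in> hplane. klein z \<in> tri x y}"

abbreviation hdensity :: "complex \<Rightarrow> real" where
  "hdensity z \<equiv> 4 / (1 - (cmod z)\<^sup>2)\<^sup>2"

text \<open>
  Cramer's rule for the coordinates with respect to \<open>x\<close> and \<open>y\<close>.
\<close>

lemma tri_coords:
  assumes D: "Im (cnj x * y) \<noteq> 0"
  shows "tri x y = {k. 0 < Im (cnj k * y) / Im (cnj x * y) \<and> 0 < Im (cnj x * k) / Im (cnj x * y) \<and>
     Im (cnj k * y) / Im (cnj x * y) + Im (cnj x * k) / Im (cnj x * y) < 1}"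
proof -
  have 1: "Im (cnj (a *\<^sub>R x + b *\<^sub>R y) * y) = a * Im (cnj x * y)"
    "Im (cnj x * (a *\<^sub>R x + b *\<^sub>R y)) = b * Im (cnj x * y)" for a b
    by (simp_all add: algebra_simps)
  have 2: "k = (Im (cnj k * y) / Im (cnj x * y)) *\<^sub>R x + (Im (cnj x * k) / Im (cnj x * y)) *\<^sub>R y" for k
  proof -
    have "of_real (Im (cnj x * y)) * k = of_real (Im (cnj k * y)) * x + of_real (Im (cnj x * k)) * y"
      by (simp add: complex_eq_iff algebra_simps)
    then have "k = (of_real (Im (cnj k * y)) * x + of_real (Im (cnj x * k)) * y) / of_real (Im (cnj x * y))"
      using D by (metis nonzero_mult_div_cancel_left of_real_eq_0_iff)
    then show ?thesis by (simp only: scaleR_conv_of_real of_real_divide add_divide_distrib times_divide_eq_left)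
  qed
  show ?thesis
  proof (intro equalityI subsetI)
    fix k assume "k \<in> tri x y"
    then obtain a b where ab: "k = a *\<^sub>R x + b *\<^sub>R y" "0 < a" "0 < b" "a + b < 1" unfolding tri_def by blast
    have "Im (cnj k * y) / Im (cnj x * y) = a" "Im (cnj x * k) / Im (cnj x * y) = b"
      using D unfolding ab(1) 1 by (rule nonzero_mult_div_cancel_right)+
    then show "k \<in> {k. 0 < Im (cnj k * y) / Im (cnj x * y) \<and> 0 < Im (cnj x * k) / Im (cnj x * y) \<and>
     Im (cnj k * y) / Im (cnj x * y) + Im (cnj x * k) / Im (cnj x * y) < 1}"
      using ab(2-4) by (simp only: mem_Collect_eq)
  next
    fix k assume "k \<in> {k. 0 < Im (cnj k * y) / Im (cnj x * y) \<and> 0 < Im (cnj x * k) / Im (cnj x * y) \<and>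
     Im (cnj k * y) / Im (cnj x * y) + Im (cnj x * k) / Im (cnj x * y) < 1}"
    then show "k \<in> tri x y" unfolding tri_def mem_Collect_eq using 2[of k] by blast
  qed
qed

lemma open_tri: "Im (cnj x * y) \<noteq> 0 \<Longrightarrow> open (tri x y)"
  unfolding tri_coords by (intro open_Collect_conj open_Collect_less continuous_intros) auto

lemma open_htri: "Im (cnj x * y) \<noteq> 0 \<Longrightarrow> open (htri x y)"
proof -
  assume "Im (cnj x * y) \<noteq> 0"
  then have "open (hplane \<inter> klein -` tri x y)"
    by (intro continuous_open_preimage continuous_on_klein open_tri) auto
  moreover have "hplane \<inter> klein -` tri x y = htri x y" by (auto simp: htri_def)
  ultimately show ?thesis by simp
qed

lemma borel_measurable_hdensity [measurable]: "hdensity \<in> borel_measurable borel"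
  by measurable

text \<open>
  The integral of the hyperbolic density, with the Jacobian factor \<open>s\<close>, along a radius from \<open>0\<close>
  to a point of squared modulus \<open>m\<close>.
\<close>

lemma hdensity_inner_integral:
  fixes m :: real
  assumes m: "m < 1" "0 \<le> m"
  shows "((\<lambda>s. s * (4 / (1 - s\<^sup>2 * m)\<^sup>2)) has_integral (2 / (1 - m))) {0..1}"
proof -
  have "((\<lambda>s. s * (4 / (1 - s\<^sup>2 * m)\<^sup>2)) has_integral (2 * 1\<^sup>2 / (1 - 1\<^sup>2 * m) - 2 * 0\<^sup>2 / (1 - 0\<^sup>2 * m))) {0..1}"
  proof (rule fundamental_theorem_of_calculus)
    fix s :: real assume s: "s \<in> {0..1}"
    have "s\<^sup>2 * m \<le> 1 * m" using s m by (intro mult_right_mono) (auto simp: power_le_one)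
    then have nz: "1 - s\<^sup>2 * m \<noteq> 0" using m by simp
    have "((\<lambda>s. 2 * s\<^sup>2 / (1 - s\<^sup>2 * m)) has_real_derivative
       ((4 * s) * (1 - s\<^sup>2 * m) - (2 * s\<^sup>2) * (- (2 * s * m))) / ((1 - s\<^sup>2 * m) * (1 - s\<^sup>2 * m))) (at s within {0..1})"
      using nz by (auto intro!: derivative_eq_intros)
    also have "(4 * s) * (1 - s\<^sup>2 * m) - (2 * s\<^sup>2) * (- (2 * s * m)) = 4 * s"
      by (simp add: algebra_simps power2_eq_square)
    finally show "((\<lambda>s. 2 * s\<^sup>2 / (1 - s\<^sup>2 * m)) has_vector_derivative s * (4 / (1 - s\<^sup>2 * m)\<^sup>2)) (at s within {0..1})"
      by (simp add: has_real_derivative_iff_has_vector_derivative[symmetric] power2_eq_square mult.commute)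
  qed simp
  then show ?thesis by simp
qed

text \<open>
  The points \<open>x\<close> and \<open>y\<close> are vertices in the Klein disc. The side between them is \<open>L\<close> in the Klein
  disc and \<open>c\<close> in the Poincare disc, and \<open>R\<close> is the common square root in all formulas.
\<close>

locale klein_triangle =
  fixes x y :: complex
  assumes x: "x \<in> hplane" and y: "y \<in> hplane" and D: "Im (cnj x * y) \<noteq> 0"
begin

definition L where "L t = x + t *\<^sub>R (y - x)"
definition R where "R t = sqrt (1 - (cmod (L t))\<^sup>2)"
definition c where "c t = unklein (L t)"

lemma L_in_hplane: "t \<in> {0..1} \<Longrightarrow> L t \<in> hplane"
proof -
  assume t: "t \<in> {0..1}"
  have "L t = (1 - t) *\<^sub>R x + t *\<^sub>R y" by (simp add: L_def algebra_simps)
  then show ?thesis using convexD[OF convex_ball x y, of "1 - t" t] t by simp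
qed

lemma R_pos: "t \<in> {0..1} \<Longrightarrow> 0 < R t"
  using one_minus_norm_sq_pos[OF L_in_hplane] by (simp add: R_def)

lemma R_sq: "t \<in> {0..1} \<Longrightarrow> (R t)\<^sup>2 = 1 - (cmod (L t))\<^sup>2"
  using one_minus_norm_sq_pos[OF L_in_hplane, of t] by (simp add: R_def)

lemma c_eq: "c t = (1 / (1 + R t)) *\<^sub>R L t"
  by (simp add: c_def unklein_def R_def)

lemma Im_cnj_L: "Im (cnj (L t) * (y - x)) = Im (cnj x * y)"
  by (simp add: L_def algebra_simps)

lemma Im_cnj_L_L: "Im (cnj (L s) * L t) = (t - s) * Im (cnj x * y)"
  by (simp add: L_def algebra_simps)

lemma norm_L_sq: "(cmod (L t))\<^sup>2 = (cmod x)\<^sup>2 + 2 * t * Re (cnj x * (y - x)) + t\<^sup>2 * (cmod (y - x))\<^sup>2"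
  unfolding cmod_power2 by (simp add: L_def algebra_simps power2_eq_square)

lemma R_deriv: assumes t: "t \<in> {0..1}"
  shows "(R has_real_derivative (- (Re (cnj x * (y - x)) + t * (cmod (y - x))\<^sup>2) / R t)) (at t)"
proof -
  define q where "q t = 1 - ((cmod x)\<^sup>2 + 2 * t * Re (cnj x * (y - x)) + t\<^sup>2 * (cmod (y - x))\<^sup>2)" for t
  have R: "R = (\<lambda>t. sqrt (q t))" by (rule ext) (simp only: R_def norm_L_sq q_def)
  have p: "0 < q t"
    using one_minus_norm_sq_pos[OF L_in_hplane[OF t]] unfolding norm_L_sq q_def .
  have "(q has_real_derivative (- (2 * Re (cnj x * (y - x)) + 2 * t * (cmod (y - x))\<^sup>2))) (at t)"
    unfolding q_def by (rule derivative_eq_intros refl | simp)+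
  from DERIV_chain2[OF DERIV_real_sqrt[OF p] this]
  have "(R has_real_derivative inverse (R t) / 2 * (- (2 * Re (cnj x * (y - x)) + 2 * t * (cmod (y - x))\<^sup>2))) (at t)"
    unfolding R .
  also have "inverse (R t) / 2 * (- (2 * Re (cnj x * (y - x)) + 2 * t * (cmod (y - x))\<^sup>2)) = - (2 * Re (cnj x * (y - x)) + 2 * t * (cmod (y - x))\<^sup>2) * (inverse (R t) / 2)"
    by (rule mult.commute)
  also have "- (2 * Re (cnj x * (y - x)) + 2 * t * (cmod (y - x))\<^sup>2) * (inverse (R t) / 2) = - (Re (cnj x * (y - x)) + t * (cmod (y - x))\<^sup>2) / R t"
  proof -
    have "2 * X * (inverse r / 2) = X / r" for X r :: real by (simp add: inverse_eq_divide)
    from this[of "- (Re (cnj x * (y - x)) + t * (cmod (y - x))\<^sup>2)" "R t"] show ?thesis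
      by (simp only: distrib_left mult_minus_right minus_add_distrib mult.assoc)
  qed
  finally show ?thesis .
qed

lemma norm_c_sq: "t \<in> {0..1} \<Longrightarrow> (cmod (c t))\<^sup>2 = (1 - R t) / (1 + R t)"
  using norm_unklein_sq[of "L t"] L_in_hplane[of t] by (simp add: c_def R_def)

lemma one_minus_norm_c_sq: "t \<in> {0..1} \<Longrightarrow> 1 - (cmod (c t))\<^sup>2 = 2 * R t / (1 + R t)"
  using R_pos[of t] unfolding norm_c_sq by (simp add: field_simps)

definition dc where "dc t = (- (- (Re (cnj x * (y - x)) + t * (cmod (y - x))\<^sup>2) / R t) / (1 + R t)\<^sup>2) *\<^sub>R L t + (1 / (1 + R t)) *\<^sub>R (y - x)"

lemma c_deriv: assumes t: "t \<in> {0..1}" shows "(c has_vector_derivative dc t) (at t)"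
proof -
  have nz: "1 + R t \<noteq> 0" using R_pos[OF t] by simp
  have 1: "((\<lambda>t. 1 / (1 + R t)) has_real_derivative (- (- (Re (cnj x * (y - x)) + t * (cmod (y - x))\<^sup>2) / R t) / (1 + R t)\<^sup>2)) (at t)"
    using DERIV_divide[OF DERIV_const[of 1] DERIV_add[OF DERIV_const[of 1] R_deriv[OF t]] nz] by (simp add: power2_eq_square)
  have 2: "(L has_vector_derivative (y - x)) (at t)"
    unfolding L_def by (auto intro!: derivative_eq_intros)
  have "((\<lambda>t. (1 / (1 + R t)) *\<^sub>R L t) has_vector_derivative
     (1 / (1 + R t)) *\<^sub>R (y - x) + (- (- (Re (cnj x * (y - x)) + t * (cmod (y - x))\<^sup>2) / R t) / (1 + R t)\<^sup>2) *\<^sub>R L t) (at t)"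
    by (rule has_vector_derivative_scaleR[OF 1 2])
  then show ?thesis unfolding c_eq[abs_def] dc_def by (simp only: add.commute)
qed

lemma Im_cnj_c_dc: "t \<in> {0..1} \<Longrightarrow> Im (cnj (dc t) * c t) = - Im (cnj x * y) / (1 + R t)\<^sup>2"
proof -
  have "Im (cnj (u *\<^sub>R l + h *\<^sub>R d) * (h *\<^sub>R l)) = - h\<^sup>2 * Im (cnj l * d)" for u h :: real and l d :: complex
    by (simp add: algebra_simps power2_eq_square)
  then have "Im (cnj (dc t) * c t) = - (1 / (1 + R t))\<^sup>2 * Im (cnj (L t) * (y - x))"
    unfolding dc_def c_eq by blast
  moreover have "- (1 / r)\<^sup>2 * I = - I / r\<^sup>2" for r I :: real by (simp add: power_divide)
  ultimately show ?thesis unfolding Im_cnj_L by (simp only:)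
qed

text \<open>
  The antiderivative is the turning of the initial part of the side, that is \<open>- 2 Arg (N t)\<close>
  for the positive multiple \<open>N t\<close> of \<open>1 - cnj (unklein x) * c t\<close> that has no denominators. The
  remaining identity between rational functions in \<open>t\<close>, \<open>R 0\<close> and \<open>R t\<close> follows from
  \<open>(R t)\<^sup>2 = (R 0)\<^sup>2 - 2 t P - t\<^sup>2 Q\<close> and Lagrange's identity for \<open>DD\<^sup>2\<close>.
\<close>

lemma outer_integral:
  "((\<lambda>t. Im (cnj x * y) / (R t * (1 + R t))) has_integral (- turn (unklein x) (unklein y))) {0..1}"
proof -
  define d P Q R0 DD where "d = y - x" "P = Re (cnj x * d)" "Q = (cmod d)\<^sup>2" "R0 = R 0" "DD = Im (cnj x * y)"
  note defs = this
  have R0: "0 < R0" "R0\<^sup>2 = 1 - (cmod x)\<^sup>2" using R_pos[of 0] R_sq[of 0] by (auto simp: defs L_def)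
  define N where "N t = of_real ((1 + R0) * (1 + R t)) - cnj x * L t" for t
  have xL: "cnj x * L t = of_real ((cmod x)\<^sup>2 + t * P) + \<i> * of_real (t * DD)" for t
    unfolding cmod_power2 by (simp add: complex_eq_iff L_def defs power2_eq_square algebra_simps)
  have ReN: "Re (N t) = (1 + R0) * (R0 + R t) - t * P" for t
    unfolding N_def xL using R0(2) by (simp add: algebra_simps power2_eq_square)
  have ImN: "Im (N t) = - t * DD" for t unfolding N_def xL by simp
  have Rt: "(R t)\<^sup>2 = R0\<^sup>2 - 2 * t * P - t\<^sup>2 * Q" if "t \<in> {0..1}" for t
    using R_sq[OF that] R0(2) unfolding norm_L_sq by (simp add: defs)
  have DD: "DD\<^sup>2 = (1 - R0) * (1 + R0) * Q - P\<^sup>2"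
  proof -
    have "DD = Im (cnj x * d)" by (simp add: defs algebra_simps)
    then have "P\<^sup>2 + DD\<^sup>2 = (cmod (cnj x * d))\<^sup>2" by (simp only: defs cmod_power2)
    also have "\<dots> = (cmod x)\<^sup>2 * Q" by (simp add: norm_mult power_mult_distrib defs)
    also have "(cmod x)\<^sup>2 = (1 - R0) * (1 + R0)" using R0(2) by (simp add: algebra_simps power2_eq_square)
    finally show ?thesis by simp
  qed
  have Nform: "N t = of_real ((1 + R0) * (1 + R t)) * (1 - cnj (unklein x) * c t)" if "t \<in> {0..1}" for t
  proof -
    have "unklein x = (1 / (1 + R0)) *\<^sub>R x" using c_eq[of 0] by (simp add: c_def L_def defs)
    moreover have gen: "of_real (A * B) - cnj x * l = of_real (A * B) * (1 - cnj ((1 / A) *\<^sub>R x) * ((1 / B) *\<^sub>R l))"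
      if "A \<noteq> 0" "B \<noteq> 0" for A B :: real and l
      using that by (simp add: scaleR_conv_of_real right_diff_distrib)
    moreover have "1 + R0 \<noteq> 0" "1 + R t \<noteq> 0" using R0(1) R_pos[OF that] by auto
    ultimately show ?thesis unfolding N_def c_eq by (simp only:)
  qed
  have ReNpos: "0 < Re (N t)" if t: "t \<in> {0..1}" for t
  proof -
    have "unklein x \<in> hplane" "c t \<in> hplane" using unklein_in_hplane x L_in_hplane[OF t] by (auto simp: c_def)
    then have "cmod (cnj (unklein x) * c t) < 1"
      using mult_left_le[of "cmod (c t)" "cmod (unklein x)"] by (simp add: norm_mult)
    then have "0 < Re (1 - cnj (unklein x) * c t)" using complex_Re_le_cmod[of "cnj (unklein x) * c t"] by simp
    then show ?thesis unfolding Nform[OF t] using R0(1) R_pos[OF t] by (simp del: of_real_mult minus_complex.sel)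
  qed
  have ArgN: "Arg (N t) = Arg (1 - cnj (unklein x) * c t)" if t: "t \<in> {0..1}" for t
  proof -
    have p: "0 < (1 + R0) * (1 + R t)" using R0(1) R_pos[OF t] by simp
    show ?thesis unfolding Nform[OF t] using Arg_times_of_real[OF p] by blast
  qed
  have "((\<lambda>t. DD / (R t * (1 + R t))) has_integral (- 2 * Im (Ln (N 1)) - - 2 * Im (Ln (N 0)))) {0..1}"
  proof (rule fundamental_theorem_of_calculus)
    fix t :: real assume t: "t \<in> {0..1}"
    define R' where "R' = - (P + t * Q) / R t"
    have Rpos: "0 < R t" using R_pos[OF t] .
    have 1: "(R has_real_derivative R') (at t within {0..1})"
      using has_field_derivative_at_within[OF R_deriv[OF t]] unfolding R'_def defs .
    have NN: "N = (\<lambda>t. Complex ((1 + R0) * (R0 + R t) - t * P) (- t * DD))"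
      using ReN ImN by (simp add: complex_eq_iff fun_eq_iff)
    define N' where "N' = Complex ((1 + R0) * R' - P) (- DD)"
    have 2: "(N has_vector_derivative N') (at t within {0..1})"
    proof -
      have "((\<lambda>t. (1 + R0) * (R0 + R t) - t * P) has_real_derivative (1 + R0) * R' - P) (at t within {0..1})"
        using 1 by (auto intro!: derivative_eq_intros)
      moreover have "((\<lambda>t. - t * DD) has_real_derivative - DD) (at t within {0..1})"
        by (auto intro!: derivative_eq_intros)
      ultimately have "((\<lambda>t. of_real ((1 + R0) * (R0 + R t) - t * P) + \<i> * of_real (- t * DD)) has_vector_derivative
         of_real ((1 + R0) * R' - P) + \<i> * of_real (- DD)) (at t within {0..1})"
        by (intro has_vector_derivative_add has_vector_derivative_of_real
          bounded_linear.has_vector_derivative[OF bounded_linear_mult_right])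
      then show ?thesis unfolding NN N'_def Complex_eq .
    qed
    have "N t \<notin> \<real>\<^sub>\<le>\<^sub>0" using ReNpos[OF t] by (auto simp: complex_nonpos_Reals_iff)
    then have "(Ln has_field_derivative inverse (N t)) (at (N t))" by (rule has_field_derivative_Ln)
    from field_vector_diff_chain_within[OF 2 has_field_derivative_at_within[OF this]]
    have 3: "((Ln \<circ> N) has_vector_derivative N' * inverse (N t)) (at t within {0..1})" .
    have 4: "((\<lambda>t. - 2 * Im (Ln (N t))) has_vector_derivative - 2 * Im (N' * inverse (N t))) (at t within {0..1})"
      using bounded_linear.has_vector_derivative[OF bounded_linear_Im 3]
      by (auto intro!: derivative_eq_intros simp: comp_def)
    have "- 2 * Im (N' * inverse (N t)) = DD / (R t * (1 + R t))"
    proof -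
      have RR: "R t * R' = - (P + t * Q)" using Rpos by (simp add: R'_def)
      define M where "M = (Re (N t))\<^sup>2 + (Im (N t))\<^sup>2"
      have M0: "M > 0" using ReNpos[OF t] by (auto simp: M_def intro: add_pos_nonneg)
      define r where "r = R t"
      have e1: "t\<^sup>2 * Q = R0\<^sup>2 - r\<^sup>2 - 2 * t * P" using Rt[OF t] by (simp add: r_def)
      have "M = ((1 + R0) * (R0 + r) - t * P)\<^sup>2 + t\<^sup>2 * DD\<^sup>2"
        unfolding M_def ReN ImN r_def by (simp add: power_mult_distrib)
      also have "\<dots> = (1 + R0)\<^sup>2 * (R0 + r)\<^sup>2 - 2 * (1 + R0) * (R0 + r) * t * P + (1 - R0) * (1 + R0) * (t\<^sup>2 * Q)"
        unfolding DD by (simp add: power2_eq_square algebra_simps)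
      also have "\<dots> = 2 * (1 + R0) * (1 + r) * (R0 * (r + R0) - t * P)"
        unfolding e1 by (simp add: power2_eq_square algebra_simps)
      finally have M: "M = 2 * (1 + R0) * (1 + r) * (R0 * (r + R0) - t * P)" .
      have rr: "r * (r - t * R') = R0\<^sup>2 - t * P"
      proof -
        have "r * (r - t * R') = r\<^sup>2 - t * (R t * R')" by (simp add: r_def algebra_simps power2_eq_square)
        also have "\<dots> = r\<^sup>2 + t * P + t\<^sup>2 * Q" unfolding RR by (simp add: algebra_simps power2_eq_square)
        finally show ?thesis unfolding e1 by simp
      qed
      have "Im (N' * inverse (N t)) = (Im N' * Re (N t) - Re N' * Im (N t)) / M"
        unfolding M_def by (simp add: add_divide_distrib diff_divide_distrib)
      also have "Im N' * Re (N t) - Re N' * Im (N t) = - DD * (1 + R0) * (R0 + (r - t * R'))"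
        unfolding ReN ImN N'_def r_def by (simp add: algebra_simps)
      finally have "- 2 * Im (N' * inverse (N t)) * (R t * (1 + R t)) = 2 * DD * (1 + R0) * (1 + r) * (R0 * r + r * (r - t * R')) / M"
        by (simp add: r_def algebra_simps)
      also have "R0 * r + r * (r - t * R') = R0 * (r + R0) - t * P"
        unfolding rr by (simp add: algebra_simps power2_eq_square)
      also have "2 * DD * (1 + R0) * (1 + r) * (R0 * (r + R0) - t * P) / M = DD"
      proof -
        have "2 * DD * (1 + R0) * (1 + r) * (R0 * (r + R0) - t * P) = DD * M" unfolding M by (simp only: mult_ac)
        then show ?thesis using M0 by (simp only: nonzero_mult_div_cancel_right less_imp_neq[symmetric] not_False_eq_True)
      qed
      finally have "- 2 * Im (N' * inverse (N t)) * (R t * (1 + R t)) = DD" .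
      moreover have "R t * (1 + R t) \<noteq> 0" using Rpos by simp
      ultimately show ?thesis by (metis nonzero_mult_div_cancel_right)
    qed
    then show "((\<lambda>t. - 2 * Im (Ln (N t))) has_vector_derivative DD / (R t * (1 + R t))) (at t within {0..1})"
      using 4 by simp
  qed simp
  moreover have "Im (Ln (N t)) = Arg (1 - cnj (unklein x) * c t)" if t: "t \<in> {0..1}" for t
  proof -
    have "N t \<noteq> 0" using ReNpos[OF t] by auto
    then show ?thesis using ArgN[OF t] by (simp add: Arg_eq_Im_Ln)
  qed
  moreover have "c 0 = unklein x" "c 1 = unklein y" by (simp_all add: c_def L_def)
  moreover have "turn (unklein x) (unklein x) = 0"
  proof -
    have "Im (N 0) = 0" "0 < Re (N 0)" using ImN[of 0] ReNpos[of 0] by auto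
    then have "Arg (N 0) = 0" using Arg_eq_0[of "N 0"] by (simp add: complex_is_Real_iff)
    then show ?thesis using ArgN[of 0] \<open>c 0 = unklein x\<close> by (simp add: turn_def)
  qed
  ultimately show ?thesis by (simp add: turn_def defs)
qed

end

context klein_triangle
begin

lemma c_in_hplane: "t \<in> {0..1} \<Longrightarrow> c t \<in> hplane"
  using unklein_in_hplane[OF L_in_hplane] by (simp add: c_def)

lemma L_nonzero: "L t \<noteq> 0"
  using Im_cnj_L[of t] D by auto

lemma c_nonzero: "t \<in> {0..1} \<Longrightarrow> c t \<noteq> 0"
  using L_nonzero[of t] R_pos[of t] by (simp add: c_eq)

definition cone :: "real \<times> real \<Rightarrow> complex" where "cone p = snd p *\<^sub>R c (fst p)"

definition unit_square :: "(real \<times> real) set" where "unit_square = {0<..<1} \<times> {0<..<1}"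

lemma klein_cone:
  assumes "t \<in> {0..1}"
  shows "klein (s *\<^sub>R c t) = (s * (1 + (cmod (c t))\<^sup>2) / (1 + s\<^sup>2 * (cmod (c t))\<^sup>2)) *\<^sub>R L t"
proof -
  have "L t = klein (c t)" using klein_unklein[of "L t"] L_in_hplane[OF assms] by (simp add: c_def)
  then have L: "L t = (2 / (1 + (cmod (c t))\<^sup>2)) *\<^sub>R c t" by (simp add: klein_def)
  have "1 + (cmod (c t))\<^sup>2 \<noteq> 0" using add_pos_nonneg[of 1 "(cmod (c t))\<^sup>2"] by simp
  then show ?thesis unfolding L by (simp add: klein_def power_mult_distrib)
qed

text \<open>
  The map \<open>klein\<close> preserves rays from the origin and is increasing on each of them, so the open
  cone over the side in the Poincare disc is the triangle.
\<close>

lemma cone_image: "cone ` unit_square = htri x y"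
proof (intro equalityI subsetI)
  fix z assume "z \<in> cone ` unit_square"
  then obtain s t where st: "0 < s" "s < 1" "0 < t" "t < 1" "z = s *\<^sub>R c t" by (auto simp: cone_def unit_square_def)
  define m where "m = (cmod (c t))\<^sup>2"
  have m: "0 \<le> m" "m < 1" using one_minus_norm_sq_pos[OF c_in_hplane[of t]] st by (auto simp: m_def)
  define l where "l = s * (1 + m) / (1 + s\<^sup>2 * m)"
  have pos: "0 < 1 + s\<^sup>2 * m" using m by (simp add: add_pos_nonneg)
  have "s * m < 1" using st m mult_strict_mono'[of s 1 m 1] by simp
  then have "0 < (1 - s) * (1 - s * m)" using st by simp
  then have "s * (1 + m) < 1 + s\<^sup>2 * m" by (simp add: algebra_simps power2_eq_square)
  then have l: "0 < l" "l < 1" using st m pos by (simp_all add: l_def add_pos_nonneg)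
  have "klein z = l *\<^sub>R L t" using klein_cone[of t s] st by (simp add: l_def m_def)
  also have "\<dots> = (l * (1 - t)) *\<^sub>R x + (l * t) *\<^sub>R y" by (simp add: L_def algebra_simps)
  finally have "klein z \<in> tri x y"
    unfolding tri_def using l st by (intro CollectI exI[of _ "l * (1 - t)"] exI[of _ "l * t"]) (simp add: algebra_simps)
  moreover have "cmod z < 1"
    using st c_in_hplane[of t] mult_strict_mono'[of s 1 "cmod (c t)" 1] by simp
  ultimately show "z \<in> htri x y" by (simp add: htri_def)
next
  fix z assume "z \<in> htri x y"
  then obtain a b where z: "cmod z < 1" and ab: "klein z = a *\<^sub>R x + b *\<^sub>R y" "0 < a" "0 < b" "a + b < 1"
    by (auto simp: htri_def tri_def)
  define l t where "l = a + b" "t = b / (a + b)"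
  have l: "0 < l" "l < 1" and t: "0 < t" "t < 1" using ab by (auto simp: l_t_def)
  have "l * (1 - t) = a" "l * t = b" using ab by (simp_all add: l_t_def field_simps)
  moreover have "l *\<^sub>R L t = (l * (1 - t)) *\<^sub>R x + (l * t) *\<^sub>R y" by (simp add: L_def algebra_simps)
  ultimately have kz: "klein z = l *\<^sub>R L t" unfolding ab by (simp only:)
  define r where "r = (1 + (cmod z)\<^sup>2) / 2 * l * (1 + R t)"
  have p: "0 < 1 + (cmod z)\<^sup>2" by (simp add: add_pos_nonneg)
  have r: "0 < r" using l R_pos[of t] t p by (simp add: r_def add_pos_pos)
  have "z = ((1 + (cmod z)\<^sup>2) / 2) *\<^sub>R klein z" by (rule klein_rescale)
  also have "\<dots> = r *\<^sub>R c t"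
  proof -
    have *: "(q * l * u) *\<^sub>R ((1 / u) *\<^sub>R v) = q *\<^sub>R (l *\<^sub>R v)" if "u \<noteq> 0" for q l u :: real and v :: complex
      using that by simp
    have "1 + R t \<noteq> 0" using R_pos[of t] t by simp
    from *[OF this] show ?thesis unfolding kz c_eq r_def by (simp only:)
  qed
  finally have zr: "z = r *\<^sub>R c t" .
  define m where "m = (cmod (c t))\<^sup>2"
  have m: "0 \<le> m" "m < 1" using one_minus_norm_sq_pos[OF c_in_hplane[of t]] t by (auto simp: m_def)
  have "cmod (r *\<^sub>R c t) < 1" using z unfolding zr .
  then have "\<bar>r * cmod (c t)\<bar> < 1" by (simp add: abs_mult)
  then have rm: "r\<^sup>2 * m < 1" unfolding m_def power_mult_distrib[symmetric] abs_square_less_1 .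
  have pos: "0 < 1 + r\<^sup>2 * m" using m by (simp add: add_pos_nonneg)
  have "l *\<^sub>R L t = (r * (1 + m) / (1 + r\<^sup>2 * m)) *\<^sub>R L t"
  proof -
    have "t \<in> {0..1}" using t by simp
    from klein_cone[OF this, of r, folded zr m_def] kz show ?thesis by (simp only:)
  qed
  then have "r * (1 + m) / (1 + r\<^sup>2 * m) < 1" using l L_nonzero[of t] by simp
  then have "r * (1 + m) < 1 + r\<^sup>2 * m" using pos by (simp add: divide_less_eq)
  then have q: "0 < (1 - r) * (1 - r * m)" by (simp add: algebra_simps power2_eq_square)
  have "r < 1"
  proof (rule ccontr)
    assume "\<not> r < 1"
    then have "r * m \<le> r\<^sup>2 * m" using m r by (intro mult_right_mono) (auto simp: power2_eq_square)
    then have "0 < 1 - r * m" using rm by simp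
    then have "(1 - r) * (1 - r * m) \<le> 0" using \<open>\<not> r < 1\<close> by (intro mult_nonpos_nonneg) auto
    then show False using q by simp
  qed
  then show "z \<in> cone ` unit_square" using zr r t by (intro image_eqI[of _ _ "(t, r)"]) (auto simp: cone_def unit_square_def)
qed

lemma inj_on_cone: "inj_on cone unit_square"
proof (rule inj_onI)
  fix p q assume pq: "p \<in> unit_square" "q \<in> unit_square" "cone p = cone q"
  obtain s t s' t' where st: "p = (t, s)" "q = (t', s')" by fastforce
  have b: "0 < s" "0 < t" "t < 1" "0 < s'" "0 < t'" "t' < 1" using pq unfolding st unit_square_def by auto
  define h h' where "h = s / (1 + R t)" "h' = s' / (1 + R t')"
  have h: "0 < h" "0 < h'" using b R_pos[of t] R_pos[of t'] by (auto simp: h_h'_def)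
  have e: "h *\<^sub>R L t = h' *\<^sub>R L t'" using pq(3) unfolding st cone_def c_eq h_h'_def by simp
  have "Im (cnj (L t) * (h *\<^sub>R L t)) = 0" by (simp add: algebra_simps)
  moreover have "Im (cnj (L t) * (h' *\<^sub>R L t')) = h' * Im (cnj (L t) * L t')" by (simp add: algebra_simps)
  ultimately have "h' * ((t' - t) * Im (cnj x * y)) = 0" unfolding e Im_cnj_L_L by (simp only:)
  then have "t = t'" using h D by (simp only: mult_eq_0_iff) auto
  moreover from this have "s = s'" using pq(3) c_nonzero[of t] b unfolding st cone_def by simp
  ultimately show "p = q" using st by simp
qed

lemma cone_deriv:
  assumes "p \<in> unit_square"
  shows "(cone has_derivative (\<lambda>h. fst h *\<^sub>R (snd p *\<^sub>R dc (fst p)) + snd h *\<^sub>R c (fst p))) (at p)"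
proof -
  have "(c has_derivative (\<lambda>h. h *\<^sub>R dc (fst p))) (at (fst p))"
    using c_deriv[of "fst p"] assms by (auto simp: has_vector_derivative_def unit_square_def)
  from has_derivative_compose[OF has_derivative_fst[OF has_derivative_ident] this]
  have "((\<lambda>p. c (fst p)) has_derivative (\<lambda>h. fst h *\<^sub>R dc (fst p))) (at p)" .
  from has_derivative_scaleR[OF has_derivative_snd[OF has_derivative_ident] this]
  have "((\<lambda>p. snd p *\<^sub>R c (fst p)) has_derivative (\<lambda>h. snd p *\<^sub>R (fst h *\<^sub>R dc (fst p)) + snd h *\<^sub>R c (fst p))) (at p)" .
  then show ?thesis unfolding cone_def[abs_def] by (simp add: mult.commute)
qed

definition cone_density :: "real \<times> real \<Rightarrow> real" where
  "cone_density p = \<bar>Im (cnj x * y)\<bar> / (1 + R (fst p))\<^sup>2 * (snd p * (4 / (1 - (snd p)\<^sup>2 * (cmod (c (fst p)))\<^sup>2)\<^sup>2))"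

lemma cone_density_eq:
  assumes p: "p \<in> unit_square"
  shows "\<bar>Im (cnj (snd p *\<^sub>R dc (fst p)) * c (fst p))\<bar> * hdensity (cone p) = cone_density p"
proof -
  have t: "fst p \<in> {0..1}" "0 < snd p" using p by (auto simp: unit_square_def)
  have "Im (cnj (snd p *\<^sub>R dc (fst p)) * c (fst p)) = snd p * Im (cnj (dc (fst p)) * c (fst p))" by (simp add: algebra_simps)
  then have "\<bar>Im (cnj (snd p *\<^sub>R dc (fst p)) * c (fst p))\<bar> = snd p * (\<bar>Im (cnj x * y)\<bar> / (1 + R (fst p))\<^sup>2)"
  proof -
    have "\<bar>s * (- I / r\<^sup>2)\<bar> = s * (\<bar>I\<bar> / r\<^sup>2)" if "0 < s" for s I r :: real
      using that by (simp add: abs_mult)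
    then show ?thesis unfolding Im_cnj_c_dc[OF t(1)] using t(2)
      \<open>Im (cnj (snd p *\<^sub>R dc (fst p)) * c (fst p)) = snd p * Im (cnj (dc (fst p)) * c (fst p))\<close>
      Im_cnj_c_dc[OF t(1)] by presburger
  qed
  moreover have "(cmod (cone p))\<^sup>2 = (snd p)\<^sup>2 * (cmod (c (fst p)))\<^sup>2" by (simp add: cone_def power_mult_distrib)
  ultimately show ?thesis unfolding cone_density_def by simp
qed

lemma continuous_on_cone_density: "continuous_on ({0..1} \<times> {0..1}) cone_density"
proof -
  have R: "continuous_on {0..1} R"
    using R_deriv by (intro DERIV_continuous_on) (auto intro: has_field_derivative_at_within)
  have c: "continuous_on {0..1} c"
    using c_deriv by (intro continuous_at_imp_continuous_on ballI) (auto intro: has_vector_derivative_continuous)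
  have nz: "1 - (snd p)\<^sup>2 * (cmod (c (fst p)))\<^sup>2 \<noteq> 0" "1 + R (fst p) \<noteq> 0" if "p \<in> {0..1} \<times> {0..1}" for p
  proof -
    have t: "fst p \<in> {0..1}" "0 \<le> snd p" "snd p \<le> 1" using that by auto
    have "(snd p)\<^sup>2 * (cmod (c (fst p)))\<^sup>2 \<le> 1 * (cmod (c (fst p)))\<^sup>2"
      using t by (intro mult_right_mono) (auto simp: power_le_one)
    then show "1 - (snd p)\<^sup>2 * (cmod (c (fst p)))\<^sup>2 \<noteq> 0" using one_minus_norm_sq_pos[OF c_in_hplane[OF t(1)]] by simp
    show "1 + R (fst p) \<noteq> 0" using R_pos[OF t(1)] by simp
  qed
  show ?thesis unfolding cone_density_def using nz
    by (intro continuous_intros continuous_on_compose2[OF R] continuous_on_compose2[OF c]) auto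
qed

lemma integral_cone_density:
  "integral ({0..1} \<times> {0..1}) cone_density = - sgn (Im (cnj x * y)) * turn (unklein x) (unklein y)"
proof -
  have inner: "integral {0..1} (\<lambda>s. cone_density (t, s)) = sgn (Im (cnj x * y)) * (Im (cnj x * y) / (R t * (1 + R t)))" if t: "t \<in> {0..1}" for t
  proof -
    have m: "(cmod (c t))\<^sup>2 < 1" "0 \<le> (cmod (c t))\<^sup>2" using one_minus_norm_sq_pos[OF c_in_hplane[OF t]] by auto
    have "((\<lambda>s. \<bar>Im (cnj x * y)\<bar> / (1 + R t)\<^sup>2 * (s * (4 / (1 - s\<^sup>2 * (cmod (c t))\<^sup>2)\<^sup>2))) has_integral
      (\<bar>Im (cnj x * y)\<bar> / (1 + R t)\<^sup>2 * (2 / (1 - (cmod (c t))\<^sup>2)))) {0..1}"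
      by (intro has_integral_mult_right hdensity_inner_integral m)
    then have "integral {0..1} (\<lambda>s. cone_density (t, s)) = \<bar>Im (cnj x * y)\<bar> / (1 + R t)\<^sup>2 * (2 / (1 - (cmod (c t))\<^sup>2))"
      unfolding cone_density_def fst_conv snd_conv by (rule integral_unique)
    also have "\<dots> = \<bar>Im (cnj x * y)\<bar> / (R t * (1 + R t))"
    proof -
      have "I / (1 + r)\<^sup>2 * (2 / (2 * r / (1 + r))) = I / (r * (1 + r))" if "0 < r" for I r :: real
        using that by (simp add: power2_eq_square divide_simps)
      then show ?thesis unfolding one_minus_norm_c_sq[OF t] using R_pos[OF t] by (simp only:)
    qed
    finally show ?thesis by (simp add: sgn_mult_abs abs_sgn[symmetric] mult.commute flip: abs_sgn)
  qed
  have "integral (cbox (0, 0) (1, 1)) cone_density = integral (cbox 0 1) (\<lambda>t. integral (cbox 0 1) (\<lambda>s. cone_density (t, s)))"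
    using continuous_on_cone_density by (intro integral_prod_continuous) (simp add: cbox_Pair_eq)
  also have "\<dots> = integral {0..1} (\<lambda>t. sgn (Im (cnj x * y)) * (Im (cnj x * y) / (R t * (1 + R t))))"
    unfolding cbox_interval by (rule integral_cong) (rule inner)
  also have "\<dots> = sgn (Im (cnj x * y)) * (- turn (unklein x) (unklein y))"
    by (rule integral_unique[OF has_integral_mult_right[OF outer_integral]])
  finally show ?thesis by (simp add: cbox_Pair_eq)
qed

text \<open>
  Integration first along rays from the origin and then along the opposite side.
\<close>

lemma htri_area:
  "set_integrable lborel (htri x y) hdensity"
  "(LINT z:htri x y|lborel. hdensity z) = - sgn (Im (cnj x * y)) * turn (unklein x) (unklein y)"
proof -
  have S: "unit_square \<in> sets borel"
    unfolding unit_square_def by (intro borel_open open_Times) auto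
  have T: "cone ` unit_square \<in> sets borel" unfolding cone_image using open_htri[OF D] by (rule borel_open)
  have "set_integrable lborel ({0..1} \<times> {0..1}) cone_density"
    using borel_integrable_compact[OF _ continuous_on_cone_density]
    unfolding set_integrable_def by (simp add: compact_Times)
  then have int: "set_integrable lborel unit_square cone_density"
    by (rule set_integrable_subset) (use S in \<open>auto simp: unit_square_def\<close>)
  have eq: "set_integrable lborel unit_square (\<lambda>p. \<bar>Im (cnj (snd p *\<^sub>R dc (fst p)) * c (fst p))\<bar> * hdensity (cone p))"
    using int cone_density_eq by (simp cong: set_integrable_cong)
  note cov = change_of_variables_complex[OF S T inj_on_cone cone_deriv borel_measurable_hdensity eq]
  show "set_integrable lborel (htri x y) hdensity" using cov(1) unfolding cone_image by simp
  have "(LINT z:htri x y|lborel. hdensity z) = (LINT p:unit_square|lborel. cone_density p)"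
  proof -
    have "(LINT z:htri x y|lborel. hdensity z) =
        (LINT p:unit_square|lborel. \<bar>Im (cnj (snd p *\<^sub>R dc (fst p)) * c (fst p))\<bar> * hdensity (cone p))"
      using cov(2) unfolding cone_image by simp
    also have "\<dots> = (LINT p:unit_square|lborel. cone_density p)"
      by (rule set_lebesgue_integral_cong) (use S cone_density_eq in auto)
    finally show ?thesis .
  qed
  also have "\<dots> = integral unit_square cone_density"
    using set_borel_integral_eq_integral(2)[OF int] .
  also have "unit_square = box (0, 0) (1, 1)" by (auto simp: unit_square_def mem_box Basis_prod_def)
  also have "integral (box (0, 0) (1, 1)) cone_density = integral ({0..1} \<times> {0..1}) cone_density"
    unfolding integral_open_interval by (simp add: cbox_Pair_eq)
  finally show "(LINT z:htri x y|lborel. hdensity z) = - sgn (Im (cnj x * y)) * turn (unklein x) (unklein y)"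
    unfolding integral_cone_density .
qed

end


lemma tri_mono:
  assumes r: "0 < r" "r \<le> r'"
  shows "tri (r *\<^sub>R x) (r *\<^sub>R y) \<subseteq> tri (r' *\<^sub>R x) (r' *\<^sub>R y)"
proof
  fix k assume "k \<in> tri (r *\<^sub>R x) (r *\<^sub>R y)"
  then obtain a b where ab: "k = a *\<^sub>R (r *\<^sub>R x) + b *\<^sub>R (r *\<^sub>R y)" "0 < a" "0 < b" "a + b < 1" by (auto simp: tri_def)
  have "(a + b) * (r / r') \<le> (a + b) * 1" using ab r by (intro mult_left_mono) auto
  moreover have "a * (r / r') + b * (r / r') = (a + b) * (r / r')" by (simp only: distrib_right)
  ultimately have "a * (r / r') + b * (r / r') \<le> a + b" by (simp only: mult_1_right)
  then have "a * (r / r') + b * (r / r') < 1" using ab(4) by (rule le_less_trans)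
  then show "k \<in> tri (r' *\<^sub>R x) (r' *\<^sub>R y)" unfolding tri_def using ab r
    by (intro CollectI exI[of _ "a * (r / r')"] exI[of _ "b * (r / r')"]) auto
qed

text \<open>
  Triangles with ideal vertices are exhausted by the triangles with the vertices
  \<open>r *\<^sub>R x\<close> and \<open>r *\<^sub>R y\<close>, to which monotone convergence for \<open>r \<rightarrow> 1\<close> applies.
\<close>

lemma htri_area_closed:
  assumes x: "x \<in> cball 0 1" and y: "y \<in> cball 0 1" and D: "Im (cnj x * y) \<noteq> 0"
  shows "set_integrable lborel (htri x y) hdensity"
    "(LINT z:htri x y|lborel. hdensity z) = - sgn (Im (cnj x * y)) * turn (unklein x) (unklein y)"
proof -
  define r :: "nat \<Rightarrow> real" where "r n = 1 - inverse (real (Suc (Suc n)))" for n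
  have r: "0 < r n" "r n < 1" for n
  proof -
    have "inverse (real (Suc (Suc n))) < 1" by (simp add: field_simps)
    then show "0 < r n" by (simp add: r_def)
    show "r n < 1" by (simp add: r_def)
  qed
  have r_mono: "r n \<le> r m" if "n \<le> m" for n m using that unfolding r_def by (simp add: field_simps)
  have r_lim: "r \<longlonglongrightarrow> 1"
  proof -
    have "(\<lambda>n. 1 - inverse (real (Suc (Suc n)))) \<longlonglongrightarrow> 1 - 0"
      by (intro tendsto_diff tendsto_const LIMSEQ_Suc[OF LIMSEQ_inverse_real_of_nat])
    then show ?thesis by (simp add: r_def[abs_def])
  qed
  have kt: "klein_triangle (r n *\<^sub>R x) (r n *\<^sub>R y)" for n
  proof
    have "r n * cmod x < 1" "r n * cmod y < 1"
      using r[of n] x y by (auto intro!: le_less_trans[OF mult_left_le])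
    then show "r n *\<^sub>R x \<in> hplane" "r n *\<^sub>R y \<in> hplane" using r[of n] by auto
    have "Im (cnj (r n *\<^sub>R x) * (r n *\<^sub>R y)) = (r n)\<^sup>2 * Im (cnj x * y)" by (simp add: algebra_simps power2_eq_square)
    then show "Im (cnj (r n *\<^sub>R x) * (r n *\<^sub>R y)) \<noteq> 0" using D r[of n] by simp
  qed
  have sg: "sgn (Im (cnj (r n *\<^sub>R x) * (r n *\<^sub>R y))) = sgn (Im (cnj x * y))" for n
  proof -
    have "Im (cnj (r n *\<^sub>R x) * (r n *\<^sub>R y)) = (r n)\<^sup>2 * Im (cnj x * y)" by (simp add: algebra_simps power2_eq_square)
    then show ?thesis using r[of n] by (simp only: sgn_mult) simp
  qed
  define T where "T n = htri (r n *\<^sub>R x) (r n *\<^sub>R y)" for n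
  have Tmono: "T n \<subseteq> T m" if "n \<le> m" for n m
    using tri_mono[OF r(1) r_mono[OF that], of x y] by (auto simp: T_def htri_def)
  have Tsub: "T n \<subseteq> htri x y" for n
    using tri_mono[of "r n" 1 x y] r[of n] by (auto simp: T_def htri_def)
  have Tall: "\<forall>\<^sub>F n in sequentially. z \<in> T n" if z: "z \<in> htri x y" for z
  proof -
    obtain a b where ab: "klein z = a *\<^sub>R x + b *\<^sub>R y" "0 < a" "0 < b" "a + b < 1" "z \<in> hplane"
      using z by (auto simp: htri_def tri_def)
    have "\<forall>\<^sub>F n in sequentially. a + b < r n" using order_tendstoD(1)[OF r_lim ab(4)] .
    then show ?thesis
    proof eventually_elim
      case (elim n)
      then have "a / r n + b / r n < 1" using r[of n] by (simp add: add_divide_distrib[symmetric])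
      then show ?case unfolding T_def htri_def tri_def using ab r[of n]
        by (intro CollectI conjI exI[of _ "a / r n"] exI[of _ "b / r n"]) auto
    qed
  qed
  have int: "integrable lborel (\<lambda>z. indicator (T n) z *\<^sub>R hdensity z)" for n
    using klein_triangle.htri_area(1)[OF kt[of n]] by (simp add: T_def set_integrable_def)
  have val: "(\<integral>z. indicator (T n) z *\<^sub>R hdensity z \<partial>lborel) =
      - sgn (Im (cnj x * y)) * turn (unklein (r n *\<^sub>R x)) (unklein (r n *\<^sub>R y))" for n
    using klein_triangle.htri_area(2)[OF kt[of n]] unfolding sg by (simp add: T_def set_lebesgue_integral_def)
  have mono: "AE z in lborel. mono (\<lambda>n. indicator (T n) z *\<^sub>R hdensity z)"
    using Tmono by (intro AE_I2 monoI) (auto simp: indicator_def)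
  have lim: "AE z in lborel. (\<lambda>n. indicator (T n) z *\<^sub>R hdensity z) \<longlonglongrightarrow> indicator (htri x y) z *\<^sub>R hdensity z"
  proof (intro AE_I2)
    fix z
    show "(\<lambda>n. indicator (T n) z *\<^sub>R hdensity z) \<longlonglongrightarrow> indicator (htri x y) z *\<^sub>R hdensity z"
    proof (cases "z \<in> htri x y")
      case True
      have "\<forall>\<^sub>F n in sequentially. indicator (T n) z *\<^sub>R hdensity z = indicator (htri x y) z *\<^sub>R hdensity z"
        using Tall[OF True] by eventually_elim (use True in simp)
      then show ?thesis by (rule tendsto_eventually)
    next
      case False
      then have "z \<notin> T n" for n using Tsub by blast
      then show ?thesis using False by simp
    qed
  qed
  have ucont: "(\<lambda>n. unklein (r n *\<^sub>R w)) \<longlonglongrightarrow> unklein w" if w: "w \<in> cball 0 1" for w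
  proof (rule continuous_on_tendsto_compose[OF continuous_on_unklein _ w])
    have "(\<lambda>n. r n *\<^sub>R w) \<longlonglongrightarrow> 1 *\<^sub>R w" using r_lim by (intro tendsto_intros)
    then show "(\<lambda>n. r n *\<^sub>R w) \<longlonglongrightarrow> w" by simp
    have "r n * cmod w \<le> 1" for n using r[of n] w by (intro mult_le_one) auto
    then show "\<forall>\<^sub>F n in sequentially. r n *\<^sub>R w \<in> cball 0 1" using r by (simp add: abs_of_pos)
  qed
  have ne: "unklein x \<noteq> unklein y"
  proof
    assume "unklein x = unklein y"
    then have "x = y" using klein_unklein[OF x] klein_unklein[OF y] by metis
    then show False using D by simp
  qed
  have ilim: "(\<lambda>n. \<integral>z. indicator (T n) z *\<^sub>R hdensity z \<partial>lborel) \<longlonglongrightarrow> - sgn (Im (cnj x * y)) * turn (unklein x) (unklein y)"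
    unfolding val
    by (intro tendsto_mult_left tendsto_turn ucont unklein_in_cball x y ne)
  have meas: "(\<lambda>z. indicator (htri x y) z *\<^sub>R hdensity z) \<in> borel_measurable lborel"
    using borel_open[OF open_htri[OF D]] by (intro borel_measurable_scaleR borel_measurable_indicator) auto
  show "set_integrable lborel (htri x y) hdensity"
    unfolding set_integrable_def by (rule integrable_monotone_convergence[OF int mono lim ilim meas])
  show "(LINT z:htri x y|lborel. hdensity z) = - sgn (Im (cnj x * y)) * turn (unklein x) (unklein y)"
    unfolding set_lebesgue_integral_def by (rule integral_monotone_convergence[OF int mono lim ilim meas])
qed

section \<open>Geodesic arcs are Klein chords\<close>

lemma geodesic_arc_in_cball:
  assumes "geodesic_arc c x y" "t \<in> {0..1}"
  shows "c t \<in> cball 0 1"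
proof -
  have cont: "continuous_on {0..1} c" using assms by (simp add: geodesic_arc_def arc_def path_def)
  have "c ` closure {0<..<1} \<subseteq> closure (c ` {0<..<1})"
    using cont by (intro image_closure_subset[OF _ closed_closure closure_subset]) auto
  also have "\<dots> \<subseteq> closure hplane" using assms by (intro closure_mono) (simp add: geodesic_arc_def)
  finally have "c ` {0..1} \<subseteq> cball 0 1" by simp
  then show ?thesis using assms(2) by blast
qed

text \<open>
  In the interior of the arc this is \<open>klein_between\<close>. It extends to the possibly ideal ends
  because betweenness is an equation between distances, which passes to limits.
\<close>

lemma geodesic_arc_klein:
  assumes c: "geodesic_arc c x y" and t: "t \<in> {0..1}"
  shows "klein (c t) \<in> closed_segment (klein x) (klein y)"
proof (cases "t = 0 \<or> t = 1")
  case True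
  then show ?thesis using c by (auto simp: geodesic_arc_def pathstart_def pathfinish_def)
next
  case False
  then have t: "0 < t" "t < 1" using t by auto
  define k where "k = klein \<circ> c"
  have "continuous_on {0..1} c" using c by (simp add: geodesic_arc_def arc_def path_def)
  then have k: "continuous_on {0..1} k" unfolding k_def by (intro continuous_on_compose continuous_on_klein)
  have k01: "k 0 = klein x" "k 1 = klein y" using c by (auto simp: k_def geodesic_arc_def pathstart_def pathfinish_def)
  have cin: "c s \<in> hplane" if "0 < s" "s < 1" for s
    using c that by (simp add: geodesic_arc_def image_subset_iff)
  have b: "dist (k s) (k u) = dist (k s) (k t) + dist (k t) (k u)" if s: "0 < s" "s < t" and u: "t < u" "u < 1" for s u
  proof -
    have "hdist (c s) (c u) = hdist (c s) (c t) + hdist (c t) (c u)" using c s u by (auto simp: geodesic_arc_def)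
    then have "k t \<in> closed_segment (k s) (k u)"
      unfolding k_def comp_apply using s u t by (intro klein_between cin) auto
    then show ?thesis using between between_mem_segment by metis
  qed
  have lim0: "(k \<longlongrightarrow> k 0) (at_right 0)" using continuous_on_Icc_at_rightD[OF k] by simp
  have lim1: "(k \<longlongrightarrow> k 1) (at_left 1)" using continuous_on_Icc_at_leftD[OF k] by simp
  have b0: "dist (k 0) (k u) = dist (k 0) (k t) + dist (k t) (k u)" if u: "t < u" "u < 1" for u
  proof (rule tendsto_unique[of "at_right (0::real)"])
    show "((\<lambda>s. dist (k s) (k u)) \<longlongrightarrow> dist (k 0) (k u)) (at_right 0)" by (intro tendsto_intros lim0)
    have "((\<lambda>s. dist (k s) (k t) + dist (k t) (k u)) \<longlongrightarrow> dist (k 0) (k t) + dist (k t) (k u)) (at_right 0)"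
      by (intro tendsto_intros lim0)
    moreover have "\<forall>\<^sub>F s in at_right 0. dist (k s) (k t) + dist (k t) (k u) = dist (k s) (k u)"
      using eventually_at_right_less[of 0] eventually_at_right_field[of "\<lambda>s. s < t" 0] t
      by (auto simp: eventually_at_right_field intro!: exI[of _ t] b[symmetric] u)
    ultimately show "((\<lambda>s. dist (k s) (k u)) \<longlongrightarrow> dist (k 0) (k t) + dist (k t) (k u)) (at_right 0)"
      by (rule Lim_transform_eventually)
  qed simp
  have "dist (k 0) (k 1) = dist (k 0) (k t) + dist (k t) (k 1)"
  proof (rule tendsto_unique[of "at_left (1::real)"])
    show "((\<lambda>u. dist (k 0) (k u)) \<longlongrightarrow> dist (k 0) (k 1)) (at_left 1)" by (intro tendsto_intros lim1)
    have "((\<lambda>u. dist (k 0) (k t) + dist (k t) (k u)) \<longlongrightarrow> dist (k 0) (k t) + dist (k t) (k 1)) (at_left 1)"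
      by (intro tendsto_intros lim1)
    moreover have "\<forall>\<^sub>F u in at_left 1. dist (k 0) (k t) + dist (k t) (k u) = dist (k 0) (k u)"
      using t by (auto simp: eventually_at_left_field intro!: exI[of _ t] b0[symmetric])
    ultimately show "((\<lambda>u. dist (k 0) (k u)) \<longlongrightarrow> dist (k 0) (k t) + dist (k t) (k 1)) (at_left 1)"
      by (rule Lim_transform_eventually)
  qed simp
  then show ?thesis unfolding k01[symmetric] using between between_mem_segment by (metis comp_apply k_def)
qed

section \<open>Winding numbers in the Klein model\<close>

text \<open>
  Deforms the identity to \<open>klein\<close>.
\<close>

definition radial_homotopy :: "real \<Rightarrow> complex \<Rightarrow> complex" where
  "radial_homotopy t z = ((1 - t) + t * (2 / (1 + (cmod z)\<^sup>2))) *\<^sub>R z"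

lemma radial_homotopy_inj:
  assumes t: "t \<in> {0..1}" and z: "z \<in> cball 0 1" and w: "w \<in> cball 0 1"
    and eq: "radial_homotopy t z = radial_homotopy t w"
  shows "z = w"
proof -
  define f where "f z = (1 - t) + t * (2 / (1 + (cmod z)\<^sup>2))" for z
  have p: "1 + (cmod z)\<^sup>2 > 0" for z :: complex by (simp add: add_pos_nonneg)
  have f: "f z > 0" for z
  proof (cases "t = 0")
    case False
    then have "0 < t * (2 / (1 + (cmod z)\<^sup>2))" using t p[of z] by simp
    then show ?thesis using t by (simp add: f_def)
  qed (simp add: f_def)
  have strict: "f a * cmod a < f b * cmod b" if ab: "cmod a < cmod b" "cmod b \<le> 1" for a b
  proof -
    have "0 < (cmod b - cmod a) * (1 - cmod a * cmod b)"
    proof -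
      have "cmod a * cmod b \<le> cmod a * 1" using ab by (intro mult_left_mono) auto
      then have "cmod a * cmod b < 1" using ab by linarith
      then show ?thesis using ab by simp
    qed
    then have "cmod a * (1 + (cmod b)\<^sup>2) < cmod b * (1 + (cmod a)\<^sup>2)"
      by (simp add: algebra_simps power2_eq_square)
    then have k: "2 / (1 + (cmod a)\<^sup>2) * cmod a < 2 / (1 + (cmod b)\<^sup>2) * cmod b"
    proof -
      have "2 / A * r = 2 * (r * B) / (A * B)" if "0 < A" "0 < B" for A B r :: real using that by simp
      from this[OF p[of a] p[of b]] this[OF p[of b] p[of a]] show ?thesis
        using p[of a] p[of b] \<open>cmod a * (1 + (cmod b)\<^sup>2) < cmod b * (1 + (cmod a)\<^sup>2)\<close>
        by (simp only: mult.commute[of "1 + (cmod b)\<^sup>2" "1 + (cmod a)\<^sup>2"])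
          (intro divide_strict_right_mono mult_strict_left_mono mult_pos_pos; simp)
    qed
    have e: "f z * cmod z = (1 - t) * cmod z + t * (2 / (1 + (cmod z)\<^sup>2) * cmod z)" for z
      by (simp add: f_def algebra_simps)
    show ?thesis
    proof (cases "t = 0")
      case True then show ?thesis using ab by (simp add: f_def)
    next
      case False
      then have "t * (2 / (1 + (cmod a)\<^sup>2) * cmod a) < t * (2 / (1 + (cmod b)\<^sup>2) * cmod b)"
        using t by (intro mult_strict_left_mono[OF k]) auto
      moreover have "(1 - t) * cmod a \<le> (1 - t) * cmod b" using t ab by (intro mult_left_mono) auto
      ultimately show ?thesis unfolding e by linarith
    qed
  qed
  have h: "f z *\<^sub>R z = f w *\<^sub>R w" using eq by (simp add: radial_homotopy_def f_def)
  then have "f z * cmod z = f w * cmod w" using f by (metis norm_scaleR abs_of_pos)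
  then have "cmod z = cmod w" using strict[of z w] strict[of w z] z w by (cases "cmod z" "cmod w" rule: linorder_cases) auto
  then have "f z = f w" by (simp add: f_def)
  then show ?thesis using h f[of w] by simp
qed

text \<open>
  Each map of the radial homotopy is injective on the closed disc, so the image of the loop never
  meets the image of the point.
\<close>

lemma winding_number_klein:
  assumes b: "path b" "pathfinish b = pathstart b" "path_image b \<subseteq> cball 0 1"
    and z: "z \<in> cball 0 1" "z \<notin> path_image b"
  shows "winding_number b z = winding_number (klein \<circ> b) (klein z)"
proof -
  have "winding_number b z = winding_number (\<lambda>s. b s - z) 0" by (rule winding_number_offset)
  also have "\<dots> = winding_number (\<lambda>s. (klein \<circ> b) s - klein z) 0"
  proof (rule winding_number_homotopic_loops)
    let ?h = "\<lambda>p. radial_homotopy (fst p) (b (snd p)) - radial_homotopy (fst p) z"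
    show "homotopic_loops (- {0}) (\<lambda>s. b s - z) (\<lambda>s. (klein \<circ> b) s - klein z)"
      unfolding homotopic_loops
    proof (intro exI[of _ ?h] conjI ballI)
      have c: "continuous_on {0..1} b" using b by (simp add: path_def)
      have "1 + (cmod w)\<^sup>2 \<noteq> 0" for w :: complex using add_pos_nonneg[of 1 "(cmod w)\<^sup>2"] by simp
      then show "continuous_on ({0..1} \<times> {0..1}) ?h"
        unfolding radial_homotopy_def by (intro continuous_intros continuous_on_compose2[OF c]) auto
      show "?h \<in> {0..1} \<times> {0..1} \<rightarrow> - {0}"
      proof
        fix p :: "real \<times> real" assume p: "p \<in> {0..1} \<times> {0..1}"
        then have "b (snd p) \<in> path_image b" by (auto simp: path_image_def)
        then have "b (snd p) \<noteq> z" "b (snd p) \<in> cball 0 1" using z b by auto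
        then show "?h p \<in> - {0}" using radial_homotopy_inj[of "fst p" "b (snd p)" z] p z by auto
      qed
    qed (use b in \<open>auto simp: radial_homotopy_def klein_def pathstart_def pathfinish_def\<close>)
  qed
  also have "\<dots> = winding_number (klein \<circ> b) (klein z)" by (rule winding_number_offset[symmetric])
  finally show ?thesis .
qed

lemma winding_number_subpaths:
  assumes K: "path K" "z \<notin> path_image K" and N: "0 < N"
  shows "(\<Sum>i<N. winding_number (subpath (real i / real N) (real (Suc i) / real N) K) z) = winding_number K z"
proof -
  have "m \<le> N \<Longrightarrow> (\<Sum>i<m. winding_number (subpath (real i / real N) (real (Suc i) / real N) K) z)
      = winding_number (subpath 0 (real m / real N) K) z" for m
  proof (induction m)
    case 0
    have "K 0 \<noteq> z" using K(2) by (auto simp: path_image_def)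
    then show ?case by (simp add: winding_number_subpath_trivial)
  next
    case (Suc m)
    then show ?case using N
      by (simp add: winding_number_subpath_combine[OF K, of 0 "real m / real N" "real (Suc m) / real N", symmetric] del: of_nat_Suc)
  qed
  from this[of N] show ?thesis using N by simp
qed

lemma winding_number_segment_path:
  assumes "path g" "path_image g \<subseteq> closed_segment a b" "pathstart g = a" "pathfinish g = b" "z \<notin> closed_segment a b"
  shows "winding_number g z = winding_number (linepath a b) z"
proof (rule winding_number_homotopic_paths, rule homotopic_paths_linear)
  fix t :: real assume t: "t \<in> {0..1}"
  have "g t \<in> closed_segment a b" using assms(2) t by (auto simp: path_image_def)
  moreover have "linepath a b t \<in> closed_segment a b" using t by (rule linepath_in_path)
  ultimately have "closed_segment (g t) (linepath a b t) \<subseteq> closed_segment a b"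
    by (rule subset_closed_segment[THEN iffD2, OF conjI])
  then show "closed_segment (g t) (linepath a b t) \<subseteq> - {z}" using assms(5) by blast
qed (use assms in auto)

definition tri_loop :: "complex \<Rightarrow> complex \<Rightarrow> real \<Rightarrow> complex" where
  "tri_loop a b = linepath 0 a +++ linepath a b +++ linepath b 0"

definition tri_edges :: "complex \<Rightarrow> complex \<Rightarrow> complex set" where
  "tri_edges a b = closed_segment 0 a \<union> closed_segment a b \<union> closed_segment b 0"

text \<open>
  The null set off which the winding number of \<open>tri_loop a b\<close> is the signed indicator function of
  the triangle. If the triangle is degenerate, \<open>tri a b\<close> need not be empty, but then it is
  contained in the hull, which is a null set.
\<close>

definition tri_exceptional :: "complex \<Rightarrow> complex \<Rightarrow> complex set" where
  "tri_exceptional a b = tri_edges a b \<union> (if Im (cnj a * b) = 0 then convex hull {0, a, b} else {})"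

text \<open>
  Adding and subtracting the spokes from the origin turns a side into the loop around a triangle.
\<close>

lemma winding_number_linepath_tri:
  assumes "z \<notin> tri_edges a b"
  shows "winding_number (linepath a b) z =
    winding_number (tri_loop a b) z + (winding_number (linepath 0 b) z - winding_number (linepath 0 a) z)"
proof -
  have z: "z \<notin> closed_segment 0 a" "z \<notin> closed_segment a b" "z \<notin> closed_segment b 0" "z \<notin> closed_segment 0 b"
    using assms by (auto simp: tri_edges_def closed_segment_commute)
  have "winding_number (tri_loop a b) z =
      winding_number (linepath 0 a) z + (winding_number (linepath a b) z + winding_number (linepath b 0) z)"
    unfolding tri_loop_def using z by (simp add: winding_number_join path_image_join not_in_path_image_join)
  moreover have "winding_number (linepath b 0) z = - winding_number (linepath 0 b) z"
    using winding_number_reversepath[of "linepath 0 b" z] z by simp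
  ultimately show ?thesis by simp
qed

lemma convex_hull_3_cases:
  assumes "z \<in> convex hull {0, a, b}" "z \<notin> tri_edges a b"
  shows "z \<in> tri a b"
proof -
  obtain u v w where uvw: "z = u *\<^sub>R 0 + v *\<^sub>R a + w *\<^sub>R b" "0 \<le> u" "0 \<le> v" "0 \<le> w" "u + v + w = 1"
    using assms(1) unfolding convex_hull_3 by blast
  have "u \<noteq> 0"
  proof
    assume "u = 0"
    then have "v = 1 - w" using uvw by simp
    then have "z = (1 - w) *\<^sub>R a + w *\<^sub>R b" "w \<le> 1" using uvw by simp_all
    then have "z \<in> closed_segment a b" using uvw unfolding closed_segment_def by blast
    then show False using assms(2) by (simp add: tri_edges_def)
  qed
  moreover have "v \<noteq> 0"
  proof
    assume "v = 0"
    then have "w = 1 - u" using uvw by simp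
    then have "z = (1 - u) *\<^sub>R b + u *\<^sub>R 0" "u \<le> 1" using uvw \<open>v = 0\<close> by simp_all
    then have "z \<in> closed_segment b 0" using uvw unfolding closed_segment_def by blast
    then show False using assms(2) by (simp add: tri_edges_def)
  qed
  moreover have "w \<noteq> 0"
  proof
    assume "w = 0"
    then have "z = (1 - v) *\<^sub>R 0 + v *\<^sub>R a" "v \<le> 1" using uvw by simp_all
    then have "z \<in> closed_segment 0 a" using uvw unfolding closed_segment_def by blast
    then show False using assms(2) by (simp add: tri_edges_def)
  qed
  ultimately show ?thesis unfolding tri_def using uvw by (intro CollectI exI[of _ v] exI[of _ w]) auto
qed

lemma tri_subset_hull: "tri a b \<subseteq> convex hull {0, a, b}"
proof
  fix z assume "z \<in> tri a b"
  then obtain v w where "z = v *\<^sub>R a + w *\<^sub>R b" "0 < v" "0 < w" "v + w < 1" unfolding tri_def by blast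
  then show "z \<in> convex hull {0, a, b}" unfolding convex_hull_3
    by (intro CollectI exI[of _ "1 - v - w"] exI[of _ v] exI[of _ w]) auto
qed

text \<open>
  A loop around a nondegenerate triangle has winding number \<open>\<plusminus>1\<close> in the interior and \<open>0\<close>
  outside; the sign of the determinant is the orientation.
\<close>

lemma winding_number_tri_loop:
  assumes z: "z \<notin> tri_exceptional a b"
  shows "winding_number (tri_loop a b) z = of_real (sgn (Im (cnj a * b)) * indicator (tri a b) z)"
proof (cases "z \<in> convex hull {0, a, b}")
  case True
  have D: "Im (cnj a * b) \<noteq> 0" using True z by (auto simp: tri_exceptional_def split: if_splits)
  have zt: "z \<in> tri a b" using convex_hull_3_cases[OF True] z by (auto simp: tri_exceptional_def)
  have "tri a b \<subseteq> interior (convex hull {0, a, b})" using tri_subset_hull open_tri[OF D] by (rule interior_maximal)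
  then have "winding_number (tri_loop a b) z = (if 0 < Im ((a - 0) * cnj (a - z)) then 1 else - 1)"
    unfolding tri_loop_def using zt by (intro winding_number_triangle) auto
  moreover obtain v w where vw: "z = v *\<^sub>R a + w *\<^sub>R b" "0 < w" using zt unfolding tri_def by blast
  have "Im ((a - 0) * cnj (a - z)) = w * Im (cnj a * b)" unfolding vw(1) by (simp add: algebra_simps)
  ultimately show ?thesis using zt D vw(2) by (auto simp: zero_less_mult_iff sgn_if)
next
  case False
  then have "z \<notin> tri a b" using tri_subset_hull by blast
  moreover have "winding_number (tri_loop a b) z = 0"
  proof (rule winding_number_zero_outside[OF _ convex_convex_hull _ False])
    have "closed_segment 0 a \<subseteq> convex hull {0, a, b}" "closed_segment a b \<subseteq> convex hull {0, a, b}" "closed_segment b 0 \<subseteq> convex hull {0, a, b}"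
      unfolding segment_convex_hull by (intro hull_mono; auto)+
    then show "path_image (tri_loop a b) \<subseteq> convex hull {0, a, b}"
      unfolding tri_loop_def by (simp add: path_image_join)
  qed (auto simp: tri_loop_def)
  ultimately show ?thesis by simp
qed

lemma negligible_closed_segment_complex: "negligible (closed_segment a (b::complex))"
proof -
  have "interior (closed_segment a b) = {}" by (simp add: interior_closed_segment_ge2)
  then show ?thesis using negligible_convex_interior[of "closed_segment a b"] by simp
qed

lemma negligible_tri_exceptional:
  assumes "a \<noteq> b" shows "negligible (tri_exceptional a b)"
proof -
  have "negligible (convex hull {0, a, b})" if D: "Im (cnj a * b) = 0"
  proof -
    define n where "n = (if a = 0 then \<i> * b else \<i> * a)"
    have n: "n \<noteq> 0" using assms by (auto simp: n_def)
    have "convex hull {0, a, b} \<subseteq> {k. n \<bullet> k = 0}"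
    proof (rule hull_minimal)
      show "{0, a, b} \<subseteq> {k. n \<bullet> k = 0}" using D by (auto simp: n_def inner_complex_def algebra_simps)
      show "convex {k. n \<bullet> k = 0}" by (rule convex_hyperplane)
    qed
    then show ?thesis using negligible_hyperplane[of n 0] n negligible_subset by blast
  qed
  then show ?thesis unfolding tri_exceptional_def tri_edges_def
    by (simp add: negligible_closed_segment_complex negligible_Un)
qed

lemma unklein_differentiable_on: "unklein differentiable_on hplane"
proof (rule differentiable_at_imp_differentiable_on)
  fix k :: complex assume k: "k \<in> hplane"
  have p: "0 < 1 - k \<bullet> k" using one_minus_norm_sq_pos[OF k] by (simp add: power2_norm_eq_inner)
  have e: "unklein = (\<lambda>k. (1 / (1 + sqrt (1 - k \<bullet> k))) *\<^sub>R k)" by (simp add: unklein_def fun_eq_iff power2_norm_eq_inner)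
  have "(\<lambda>k. 1 - k \<bullet> k) differentiable (at k)" by simp
  moreover have "sqrt differentiable (at (1 - k \<bullet> k))"
    using DERIV_real_sqrt[OF p] by (auto simp: real_differentiable_def)
  ultimately have "(\<lambda>k. sqrt (1 - k \<bullet> k)) differentiable (at k)"
    using differentiable_chain_at[of "\<lambda>k. 1 - k \<bullet> k" k sqrt] by (simp add: comp_def)
  moreover have "1 + sqrt (1 - k \<bullet> k) \<noteq> 0" using p real_sqrt_gt_zero[OF p] by linarith
  ultimately have "(\<lambda>k. 1 / (1 + sqrt (1 - k \<bullet> k))) differentiable (at k)"
    by (intro differentiable_divide differentiable_add differentiable_const) auto
  then show "unklein differentiable (at k)" unfolding e by (intro differentiable_scaleR) auto
qed

lemma negligible_klein_preimage:
  assumes "negligible Z" shows "negligible {z \<in> hplane. klein z \<in> Z}"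
proof -
  have "negligible (unklein ` (Z \<inter> hplane))"
    using assms unklein_differentiable_on
    by (intro negligible_differentiable_image_negligible) (auto intro: negligible_subset differentiable_on_subset)
  moreover have "{z \<in> hplane. klein z \<in> Z} \<subseteq> unklein ` (Z \<inter> hplane)"
  proof
    fix z assume z: "z \<in> {z \<in> hplane. klein z \<in> Z}"
    then have "unklein (klein z) = z" by (intro unklein_klein) auto
    then show "z \<in> unklein ` (Z \<inter> hplane)" using z klein_in_hplane[of z] by (metis (no_types, lifting) IntI image_eqI mem_Collect_eq)
  qed
  ultimately show ?thesis by (rule negligible_subset)
qed

section \<open>The area of a geodesic polygon\<close>

text \<open>
  Geodesics on a diameter are straight.
\<close>

lemma turn_eq_0_of_collinear:
  assumes "x \<in> cball 0 1" "y \<in> cball 0 1" "Im (cnj x * y) = 0"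
  shows "turn x y = 0"
proof -
  have "1 - cnj x * y = of_real (Re (1 - cnj x * y))" using assms(3) by (simp add: complex_eq_iff)
  moreover have "0 \<le> Re (1 - cnj x * y)" by (rule Re_one_minus_nonneg[OF assms(1,2)])
  ultimately have "Arg (1 - cnj x * y) = 0" by (metis Arg_of_real not_less)
  then show ?thesis by (simp add: turn_def)
qed

lemma sum_cyclic_shift:
  fixes f :: "nat \<Rightarrow> 'a::ab_group_add"
  assumes "0 < N" shows "(\<Sum>i<N. f (Suc i mod N)) = (\<Sum>i<N. f i)"
proof -
  obtain m where N: "N = Suc m" using assms gr0_implies_Suc by blast
  have "(\<Sum>i<m. f (Suc i mod Suc m)) = (\<Sum>i<m. f (Suc i))" by (rule sum.cong) auto
  then have "(\<Sum>i<N. f (Suc i mod N)) = (\<Sum>i<m. f (Suc i)) + f 0" by (simp add: N)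
  also have "\<dots> = (\<Sum>i<N. f i)" unfolding N by (simp only: sum.lessThan_Suc_shift add.commute)
  finally show ?thesis .
qed

lemma unit_interval_subdivision:
  assumes t: "t \<in> {0..1::real}" and N: "0 < N"
  obtains i s where "i < N" "s \<in> {0..1}" "t = (real (Suc i) / real N - real i / real N) * s + real i / real N"
proof (cases "t = 1")
  case True
  have "real (N - 1) = real N - 1" using N by simp
  then show ?thesis using True N by (intro that[of "N - 1" 1]) (auto simp: field_simps)
next
  case False
  define i where "i = nat \<lfloor>t * real N\<rfloor>"
  have i: "real i \<le> t * real N" "t * real N < real i + 1"
    using t unfolding i_def by (simp_all add: of_nat_floor)
  have "t * real N < 1 * real N" using False t N by (intro mult_strict_right_mono) auto
  then have "i < N" using i(1) by linarith
  then show ?thesis using i N by (intro that[of i "t * real N - real i"]) (auto simp: field_simps)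
qed

text \<open>
  The \<open>i\<close>-th side runs from \<open>v i\<close> to \<open>w i\<close>, and \<open>k i\<close> and \<open>l i\<close> are its ends in the Klein disc.
\<close>

locale simple_geodesic_polygon =
  fixes vs :: "complex list" and b :: "real \<Rightarrow> complex"
  assumes geo: "geodesic_polygon vs b" and simple: "simple_path b"
begin

definition N where "N = length vs"
definition v where "v i = vs ! i"
definition w where "w i = vs ! (Suc i mod N)"
definition k where "k i = klein (v i)"
definition l where "l i = klein (w i)"

abbreviation "edge i \<equiv> subpath (real i / real N) (real (Suc i) / real N) b"

lemma N_pos: "0 < N" using geo by (simp add: geodesic_polygon_def N_def)

lemma edge: "i < N \<Longrightarrow> geodesic_arc (edge i) (v i) (w i)"
  using geo by (simp add: geodesic_polygon_def N_def v_def w_def del: of_nat_Suc)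

lemma path_b: "path b" using simple by (rule simple_path_imp_path)

lemma closed_b: "pathfinish b = pathstart b"
proof -
  have "pathstart (edge 0) = v 0" using edge[OF N_pos] by (simp add: geodesic_arc_def)
  then have "b 0 = v 0" by (simp add: pathstart_def subpath_def)
  moreover have "pathfinish (edge (N - 1)) = w (N - 1)" using edge[of "N - 1"] N_pos by (simp add: geodesic_arc_def)
  then have "b 1 = w (N - 1)" using N_pos by (simp add: pathfinish_def subpath_def)
  moreover have "w (N - 1) = v 0" using N_pos by (simp add: w_def v_def)
  ultimately show ?thesis by (simp add: pathstart_def pathfinish_def)
qed

lemma b_point:
  assumes "t \<in> {0..1}"
  obtains i s where "i < N" "s \<in> {0..1}" "b t = edge i s"
proof -
  obtain i s where "i < N" "s \<in> {0..1}" "t = (real (Suc i) / real N - real i / real N) * s + real i / real N"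
    using unit_interval_subdivision[OF assms N_pos] by blast
  then show ?thesis using that by (metis subpath_def)
qed

lemma b_in_cball: "path_image b \<subseteq> cball 0 1"
proof
  fix z assume "z \<in> path_image b"
  then obtain t where "t \<in> {0..1}" "z = b t" by (auto simp: path_image_def)
  then show "z \<in> cball 0 1" using b_point geodesic_arc_in_cball edge by metis
qed

lemma vertices_in_cball: "i < N \<Longrightarrow> v i \<in> cball 0 1" "i < N \<Longrightarrow> w i \<in> cball 0 1"
  using geodesic_arc_in_cball[OF edge, of i 0] geodesic_arc_in_cball[OF edge, of i 1] edge[of i]
  by (auto simp: geodesic_arc_def pathstart_def pathfinish_def)

lemma vertices_distinct: "i < N \<Longrightarrow> k i \<noteq> l i"
proof
  assume i: "i < N" and "k i = l i"
  then have "v i = w i" using unklein_klein vertices_in_cball unfolding k_def l_def by metis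
  moreover have "arc (edge i)" "pathstart (edge i) = v i" "pathfinish (edge i) = w i"
    using edge[OF i] unfolding geodesic_arc_def by blast+
  ultimately show False using arc_distinct_ends by metis
qed

definition exceptional where "exceptional = (\<Union>i<N. tri_exceptional (k i) (l i))"

lemma negligible_exceptional: "negligible {z \<in> hplane. klein z \<in> exceptional}"
  unfolding exceptional_def using negligible_tri_exceptional[OF vertices_distinct]
  by (intro negligible_klein_preimage negligible_Union) auto

lemma klein_edge: "i < N \<Longrightarrow> s \<in> {0..1} \<Longrightarrow> klein (edge i s) \<in> closed_segment (k i) (l i)"
  unfolding k_def l_def by (rule geodesic_arc_klein[OF edge])

lemma klein_b_exceptional: "path_image (klein \<circ> b) \<subseteq> exceptional"
proof
  fix z assume "z \<in> path_image (klein \<circ> b)"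
  then obtain t where t: "t \<in> {0..1}" "z = klein (b t)" by (auto simp: path_image_def)
  obtain i s where "i < N" "s \<in> {0..1}" "b t = edge i s" using b_point[OF t(1)] by blast
  then have "z \<in> closed_segment (k i) (l i)" using klein_edge t(2) by metis
  then show "z \<in> exceptional" using \<open>i < N\<close> by (auto simp: exceptional_def tri_exceptional_def tri_edges_def)
qed

text \<open>
  In the Klein disc every side may be replaced by its chord. Summed over all sides the
  contributions of the spokes from the origin cancel, and the loops around the triangles remain.
\<close>

lemma winding_number_b:
  assumes z: "z \<in> hplane" "klein z \<notin> exceptional"
  shows "winding_number b z = of_real (\<Sum>i<N. sgn (Im (cnj (k i) * l i)) * indicator (htri (k i) (l i)) z)"
proof -
  let ?K = "klein \<circ> b" and ?z = "klein z"
  have pK: "path ?K" using path_b continuous_on_klein by (simp add: path_continuous_image)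
  have zK: "?z \<notin> path_image ?K" using z klein_b_exceptional by blast
  have zb: "z \<notin> path_image b" using zK by (auto simp: path_image_def)
  have zi: "?z \<notin> tri_exceptional (k i) (l i)" if "i < N" for i using z that by (auto simp: exceptional_def)
  then have ze: "?z \<notin> tri_edges (k i) (l i)" if "i < N" for i using that by (auto simp: tri_exceptional_def)
  define f where "f i = winding_number (linepath 0 (k i)) ?z" for i
  have fl: "winding_number (linepath 0 (l i)) ?z = f (Suc i mod N)" for i
    by (simp add: f_def k_def l_def v_def w_def)
  have "winding_number b z = winding_number ?K ?z"
    using winding_number_klein[OF path_b closed_b b_in_cball _ zb] z by simp
  also have "\<dots> = (\<Sum>i<N. winding_number (subpath (real i / real N) (real (Suc i) / real N) ?K) ?z)"
    using winding_number_subpaths[OF pK zK N_pos] by simp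
  also have "\<dots> = (\<Sum>i<N. winding_number (tri_loop (k i) (l i)) ?z + (f (Suc i mod N) - f i))"
  proof (rule sum.cong[OF refl])
    fix i assume "i \<in> {..<N}"
    then have i: "i < N" by simp
    let ?e = "subpath (real i / real N) (real (Suc i) / real N) ?K"
    have e: "?e = klein \<circ> edge i" by (simp add: subpath_def comp_def)
    have seg: "?z \<notin> closed_segment (k i) (l i)" using ze[OF i] by (simp add: tri_edges_def)
    have "winding_number ?e ?z = winding_number (linepath (k i) (l i)) ?z"
    proof (rule winding_number_segment_path[OF _ _ _ _ seg])
      have "path (edge i)" using edge[OF i] by (simp add: geodesic_arc_def arc_imp_path)
      then show "path ?e" unfolding e using continuous_on_klein by (simp add: path_continuous_image)
      show "path_image ?e \<subseteq> closed_segment (k i) (l i)" unfolding e using klein_edge[OF i] by (auto simp: path_image_def simp del: of_nat_Suc)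
      have "pathstart (edge i) = v i" "pathfinish (edge i) = w i" using edge[OF i] by (auto simp: geodesic_arc_def)
      then show "pathstart ?e = k i" "pathfinish ?e = l i" unfolding e by (simp_all add: pathstart_compose pathfinish_compose k_def l_def del: of_nat_Suc)
    qed
    then show "winding_number ?e ?z = winding_number (tri_loop (k i) (l i)) ?z + (f (Suc i mod N) - f i)"
      unfolding winding_number_linepath_tri[OF ze[OF i]] fl by (simp add: f_def)
  qed
  also have "\<dots> = (\<Sum>i<N. winding_number (tri_loop (k i) (l i)) ?z)"
    using sum_cyclic_shift[OF N_pos, of f] by (simp add: sum.distrib sum_subtractf)
  also have "\<dots> = (\<Sum>i<N. of_real (sgn (Im (cnj (k i) * l i)) * indicator (htri (k i) (l i)) z))"
    using z(1) by (intro sum.cong refl) (simp add: winding_number_tri_loop[OF zi] htri_def indicator_def)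
  finally show ?thesis by (simp only: of_real_sum)
qed

text \<open>
  The factor \<open>sgn\<close> turns the area of the triangle into its signed area. In the degenerate case
  the sign vanishes, and so does the turning.
\<close>

lemma triangle_integral:
  assumes i: "i < N"
  shows "integrable lborel (\<lambda>z. sgn (Im (cnj (k i) * l i)) * (indicator (htri (k i) (l i)) z * hdensity z)) \<and>
    (\<integral>z. sgn (Im (cnj (k i) * l i)) * (indicator (htri (k i) (l i)) z * hdensity z) \<partial>lborel) = - turn (v i) (w i)"
proof -
  have kl: "k i \<in> cball 0 1" "l i \<in> cball 0 1" unfolding k_def l_def by (rule klein_in_cball)+
  have un: "unklein (k i) = v i" "unklein (l i) = w i"
    unfolding k_def l_def using unklein_klein vertices_in_cball i by auto
  show ?thesis
  proof (cases "Im (cnj (k i) * l i) = 0")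
    case True
    have "Im (cnj (k i) * l i) = (2 / (1 + (cmod (v i))\<^sup>2)) * (2 / (1 + (cmod (w i))\<^sup>2)) * Im (cnj (v i) * w i)"
      unfolding k_def l_def klein_def by (simp add: algebra_simps)
    moreover have "1 + (cmod z)\<^sup>2 \<noteq> 0" for z :: complex using add_pos_nonneg[of 1 "(cmod z)\<^sup>2"] by simp
    ultimately have "Im (cnj (v i) * w i) = 0" using True by (simp only: mult_eq_0_iff divide_eq_0_iff) auto
    then have "turn (v i) (w i) = 0" using turn_eq_0_of_collinear vertices_in_cball i by blast
    then show ?thesis unfolding True by simp
  next
    case False
    note A = htri_area_closed[OF kl False, unfolded un set_integrable_def set_lebesgue_integral_def real_scaleR_def]
    have "sgn (Im (cnj (k i) * l i)) * sgn (Im (cnj (k i) * l i)) = 1" using False by (simp add: sgn_if)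
    then have sg: "sgn (Im (cnj (k i) * l i)) * (- sgn (Im (cnj (k i) * l i)) * turn (v i) (w i)) = - turn (v i) (w i)"
      by (simp add: mult.assoc[symmetric] del: minus_complex.sel times_complex.sel)
    have "(\<integral>z. sgn (Im (cnj (k i) * l i)) * (indicator (htri (k i) (l i)) z * hdensity z) \<partial>lborel) = - turn (v i) (w i)"
      unfolding integral_mult_right_zero A(2) by (rule sg)
    then show ?thesis using integrable_mult_right[OF A(1), of "sgn (Im (cnj (k i) * l i))"] by blast
  qed
qed

lemma inside_subset: "inside (path_image b) \<subseteq> hplane"
proof -
  have "inside (path_image b) \<subseteq> cball 0 1"
  proof
    fix z assume "z \<in> inside (path_image b)"
    then have "z \<notin> outside (path_image b)" using inside_Int_outside by blast
    then have "z \<notin> outside (cball 0 1)" using outside_mono[OF b_in_cball] by blast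
    then show "z \<in> cball 0 1" using convex_in_outside[OF convex_cball] by blast
  qed
  moreover have "open (inside (path_image b))" using path_b closed_path_image open_inside by blast
  ultimately have "inside (path_image b) \<subseteq> interior (cball 0 1)" by (rule interior_maximal)
  then show ?thesis by simp
qed

text \<open>
  The Gauss-Bonnet formula for a simple geodesic polygon. The winding number of the boundary is
  \<open>\<plusminus>1\<close> inside and \<open>0\<close> outside, so its integral against the hyperbolic density is the signed area.
  By \<open>winding_number_b\<close> it is also the sum of the signed areas of the triangles with apex \<open>0\<close>.
\<close>

theorem oriented_area:
  "(if anticlockwise b then harea (inside (path_image b)) else - harea (inside (path_image b))) =
    - (\<Sum>i<N. turn (v i) (w i))"
proof -
  let ?I = "inside (path_image b)"
  define \<epsilon> :: real where "\<epsilon> = (if anticlockwise b then 1 else -1)"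
  have in_I: "winding_number b z = of_real \<epsilon>" if "z \<in> ?I" for z
    using simple
  proof (rule simple_closed_path_winding_number_inside)
    assume "\<And>z. z \<in> ?I \<Longrightarrow> winding_number b z = 1"
    then show ?thesis using that by (auto simp: anticlockwise_def \<epsilon>_def)
  next
    assume m: "\<And>z. z \<in> ?I \<Longrightarrow> winding_number b z = - 1"
    then have "winding_number b z \<noteq> 1" using that by simp
    then have "\<not> anticlockwise b" using that by (auto simp: anticlockwise_def)
    then show ?thesis using m that by (simp add: \<epsilon>_def)
  qed
  have out_I: "winding_number b z = 0" if "z \<notin> ?I" "z \<notin> path_image b" for z
  proof -
    have "z \<in> outside (path_image b)" using that inside_Un_outside by blast
    then show ?thesis by (rule winding_number_zero_in_outside[OF path_b closed_b])
  qed
  define F where "F z = \<epsilon> * (indicator ?I z * hdensity z)" for z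
  define G where "G z = (\<Sum>i<N. sgn (Im (cnj (k i) * l i)) * (indicator (htri (k i) (l i)) z * hdensity z))" for z
  have FG: "F z = G z" if "z \<notin> {z \<in> hplane. klein z \<in> exceptional}" for z
  proof (cases "z \<in> hplane")
    case True
    then have ne: "klein z \<notin> exceptional" using that by blast
    then have zb: "z \<notin> path_image b" using klein_b_exceptional by (auto simp: path_image_def)
    have "of_real (\<epsilon> * indicator ?I z) = winding_number b z"
      using in_I[of z] out_I[of z] zb by (cases "z \<in> ?I") auto
    then have "\<epsilon> * indicator ?I z = (\<Sum>i<N. sgn (Im (cnj (k i) * l i)) * indicator (htri (k i) (l i)) z)"
      unfolding winding_number_b[OF True ne] of_real_eq_iff .
    then have "F z = (\<Sum>i<N. sgn (Im (cnj (k i) * l i)) * indicator (htri (k i) (l i)) z) * hdensity z"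
      unfolding F_def by (metis mult.assoc)
    then show ?thesis unfolding G_def sum_distrib_right by (simp only: mult.assoc)
  next
    case False
    then show ?thesis using inside_subset by (auto simp: F_def G_def htri_def indicator_def)
  qed
  have "{z \<in> hplane. klein z \<in> exceptional} \<in> null_sets lebesgue"
    using negligible_exceptional by (simp add: negligible_iff_null_sets)
  then have "AE z in lebesgue. z \<notin> {z \<in> hplane. klein z \<in> exceptional}" by (rule AE_not_in)
  then have "AE z in lborel. z \<notin> {z \<in> hplane. klein z \<in> exceptional}" by (simp only: AE_completion_iff)
  then have AE: "AE z in lborel. F z = G z" by eventually_elim (rule FG)
  have I: "?I \<in> sets borel" using path_b closed_path_image open_inside by (blast intro: borel_open)
  have Fm: "F \<in> borel_measurable lborel"
    unfolding F_def using I by (intro borel_measurable_times borel_measurable_indicator borel_measurable_const) auto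
  have Gm: "G \<in> borel_measurable lborel"
    unfolding G_def
    by (intro borel_measurable_sum borel_measurable_integrable triangle_integral[THEN conjunct1]) auto
  have "\<epsilon> * harea ?I = (\<integral>z. F z \<partial>lborel)"
    unfolding harea_def set_lebesgue_integral_def F_def integral_mult_right_zero real_scaleR_def ..
  also have "\<dots> = (\<integral>z. G z \<partial>lborel)" using Fm Gm AE by (rule integral_cong_AE)
  also have "\<dots> = (\<Sum>i<N. - turn (v i) (w i))"
    unfolding G_def using triangle_integral by (subst Bochner_Integration.integral_sum) auto
  finally show ?thesis by (simp add: \<epsilon>_def sum_negf split: if_splits)
qed

end

lemma signed_area_eq:
  assumes "convex_polygon vs"
  shows "signed_area vs = - (\<Sum>i<length vs. turn (vs ! i) (vs ! (Suc i mod length vs)))"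
proof -
  interpret simple_geodesic_polygon vs "polygon_boundary vs"
    using assms by unfold_locales (auto simp: convex_polygon_def)
  show ?thesis using oriented_area by (simp add: signed_area_def N_def v_def w_def)
qed

section \<open>Sums over closed polygons\<close>

text \<open>
  For a list which ends with its first entry this is the sum over the sides of a closed polygon.
\<close>

fun edge_sum :: "complex list \<Rightarrow> real" where
  "edge_sum (x # y # zs) = turn x y + edge_sum (y # zs)"
| "edge_sum _ = 0"

lemma edge_sum_nth: "edge_sum xs = (\<Sum>i<length xs - 1. turn (xs ! i) (xs ! Suc i))"
  by (induction xs rule: edge_sum.induct) (simp_all add: sum.lessThan_Suc_shift del: sum.lessThan_Suc)

lemma edge_sum_cyclic:
  assumes "vs \<noteq> []"
  shows "(\<Sum>i<length vs. turn (vs ! i) (vs ! (Suc i mod length vs))) = edge_sum (vs @ [hd vs])"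
proof -
  have "turn (vs ! i) (vs ! (Suc i mod length vs)) = turn ((vs @ [hd vs]) ! i) ((vs @ [hd vs]) ! Suc i)" if "i < length vs" for i
    using that assms by (cases "Suc i = length vs") (auto simp: nth_append hd_conv_nth)
  then show ?thesis unfolding edge_sum_nth by simp
qed

lemma edge_sum_quads:
  "edge_sum (q 0 # concat (map (\<lambda>i. [b i, a i, c i, q i]) [1..<Suc m]) @ zs) =
    (\<Sum>i = 1..m. edge_sum [q (i - 1), b i, a i, c i, q i]) + edge_sum (q m # zs)"
proof (induction m arbitrary: zs)
  case (Suc m)
  have "concat (map (\<lambda>i. [b i, a i, c i, q i]) [1..<Suc (Suc m)]) =
    concat (map (\<lambda>i. [b i, a i, c i, q i]) [1..<Suc m]) @ [b (Suc m), a (Suc m), c (Suc m), q (Suc m)]" by simp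
  then show ?case using Suc.IH[of "[b (Suc m), a (Suc m), c (Suc m), q (Suc m)] @ zs"] by simp
qed simp

lemma edge_sum_map: "edge_sum (x 0 # map x [1..<Suc n]) = (\<Sum>i = 1..n. turn (x (i - 1)) (x i))"
proof -
  have "x 0 # map x [1..<Suc n] = map x [0..<Suc n]" by (simp add: upt_conv_Cons del: upt_Suc)
  then have "edge_sum (x 0 # map x [1..<Suc n]) = (\<Sum>i<n. turn (map x [0..<Suc n] ! i) (map x [0..<Suc n] ! Suc i))"
    by (simp add: edge_sum_nth del: upt_Suc)
  also have "\<dots> = (\<Sum>i<n. turn (x i) (x (Suc i)))" by (rule sum.cong) (auto simp: nth_append simp del: upt_Suc)
  finally show ?thesis by (simp add: sum.atLeast1_atMost_eq)
qed

section \<open>Twists of products\<close>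

lemma turn_swap: "x \<in> cball 0 1 \<Longrightarrow> y \<in> cball 0 1 \<Longrightarrow> turn y x = - turn x y"
proof -
  assume a: "x \<in> cball 0 1" "y \<in> cball 0 1"
  have e: "1 - cnj y * x = cnj (1 - cnj x * y)" by (simp add: mult.commute)
  show ?thesis
  proof (cases "1 - cnj x * y \<in> \<real>")
    case True
    then have "Im (cnj x * y) = 0" by (simp add: complex_is_Real_iff)
    moreover from this have "Im (cnj y * x) = 0" by (simp add: algebra_simps)
    ultimately show ?thesis using turn_eq_0_of_collinear a by simp
  next
    case False
    then show ?thesis unfolding turn_def e Arg_cnj by auto
  qed
qed

lemma oprod_empty: "oprod G f (Suc n) n = \<one>\<^bsub>G\<^esub>"
  by (simp add: oprod_def)

lemma oprod_Cons: "i \<le> n \<Longrightarrow> oprod G f i n = f i \<otimes>\<^bsub>G\<^esub> oprod G f (Suc i) n"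
  unfolding oprod_def by (subst upt_conv_Cons) auto

lemma angle_one: "y \<in> cball 0 1 \<Longrightarrow> angle \<one>\<^bsub>cover_PSL2R\<^esub> y = 0"
proof -
  assume y: "y \<in> cball 0 1"
  have "angle (\<one>\<^bsub>cover_PSL2R\<^esub> \<otimes>\<^bsub>cover_PSL2R\<^esub> \<one>\<^bsub>cover_PSL2R\<^esub>) y =
    angle \<one>\<^bsub>cover_PSL2R\<^esub> (cover_image \<one>\<^bsub>cover_PSL2R\<^esub> y) + angle \<one>\<^bsub>cover_PSL2R\<^esub> y"
    using y by (intro angle_mult) auto
  then show ?thesis using COVH.hom_one by simp
qed

lemma cover_image_isom: "A \<in> carrier cover_PSL2R \<Longrightarrow> cover_image A \<in> isom_plus"
  using COVH.hom_closed by simp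

lemma cover_image_mult: "A \<in> carrier cover_PSL2R \<Longrightarrow> B \<in> carrier cover_PSL2R \<Longrightarrow>
    cover_image (A \<otimes>\<^bsub>cover_PSL2R\<^esub> B) = cover_image A \<circ> cover_image B"
  using COVH.hom_mult by simp

lemma cover_image_inv: "A \<in> carrier cover_PSL2R \<Longrightarrow>
    cover_image (inv\<^bsub>cover_PSL2R\<^esub> A) = inv\<^bsub>PSL2R\<^esub> (cover_image A)"
  by (rule COVH.hom_inv)

lemma inv_PSL2R_cball: "f \<in> isom_plus \<Longrightarrow> y \<in> cball 0 1 \<Longrightarrow> (inv\<^bsub>PSL2R\<^esub> f) y \<in> cball 0 1"
  using PSL.inv_closed isom_plus_cball by simp

lemma angle_inv:
  assumes A: "A \<in> carrier cover_PSL2R" and y: "y \<in> cball 0 1"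
  shows "angle (inv\<^bsub>cover_PSL2R\<^esub> A) y = - angle A ((inv\<^bsub>PSL2R\<^esub> (cover_image A)) y)"
  using angle_mult[OF A COV.inv_closed[OF A] y] angle_one[OF y] COV.r_inv[OF A] cover_image_inv[OF A] by simp

lemma cover_image_commutator:
  assumes "A \<in> carrier cover_PSL2R" "B \<in> carrier cover_PSL2R"
  shows "commutator cover_PSL2R A B \<in> carrier cover_PSL2R"
    "cover_image (commutator cover_PSL2R A B) = commutator PSL2R (cover_image A) (cover_image B)"
  using assms unfolding commutator_def by (auto simp: COVH.hom_mult cover_image_inv simp del: mult_PSL2R)

text \<open>
  Conjugate terms combine to the differences \<open>angle A c - angle A a\<close> and \<open>angle B a - angle B b\<close>,
  which by \<open>angle_diff\<close> depend on turnings only. Together these are the turnings of the four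
  sides of the polygon contributed by the commutator.
\<close>

lemma angle_commutator:
  assumes A: "A \<in> carrier cover_PSL2R" and B: "B \<in> carrier cover_PSL2R" and q: "q \<in> cball 0 1"
  defines "b \<equiv> (inv\<^bsub>PSL2R\<^esub> (cover_image B)) q"
  defines "a \<equiv> (inv\<^bsub>PSL2R\<^esub> (cover_image A)) b"
  defines "c \<equiv> cover_image B a"
  shows "angle (commutator cover_PSL2R A B) q =
    - edge_sum [commutator PSL2R (cover_image A) (cover_image B) q, b, a, c, q]"
proof -
  note fA = cover_image_isom[OF A] and fB = cover_image_isom[OF B]
  define q' where "q' = commutator PSL2R (cover_image A) (cover_image B) q"
  have q': "q' = cover_image A c" by (simp add: q'_def commutator_def a_def b_def c_def)
  have cb: "b \<in> cball 0 1" "a \<in> cball 0 1" "c \<in> cball 0 1" "q' \<in> cball 0 1"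
    unfolding q' unfolding a_def b_def c_def using inv_PSL2R_cball isom_plus_cball fA fB q by auto
  have Ba: "cover_image B b = q" "cover_image A a = b" unfolding a_def b_def using inv_PSL2R_apply fA fB by auto
  have iA: "inv\<^bsub>cover_PSL2R\<^esub> A \<in> carrier cover_PSL2R" and iB: "inv\<^bsub>cover_PSL2R\<^esub> B \<in> carrier cover_PSL2R"
    and AB: "A \<otimes>\<^bsub>cover_PSL2R\<^esub> B \<in> carrier cover_PSL2R" and ABA: "A \<otimes>\<^bsub>cover_PSL2R\<^esub> B \<otimes>\<^bsub>cover_PSL2R\<^esub> inv\<^bsub>cover_PSL2R\<^esub> A \<in> carrier cover_PSL2R"
    using A B by auto
  have "angle (commutator cover_PSL2R A B) q = angle A c + angle B a + angle (inv\<^bsub>cover_PSL2R\<^esub> A) b + angle (inv\<^bsub>cover_PSL2R\<^esub> B) q"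
    unfolding commutator_def angle_mult[OF ABA iB q] cover_image_inv[OF B] b_def[symmetric]
      angle_mult[OF AB iA cb(1)] cover_image_inv[OF A] a_def[symmetric] angle_mult[OF A B cb(2)] c_def[symmetric] ..
  also have "\<dots> = (angle A c - angle A a) + (angle B a - angle B b)"
    using angle_inv[OF A cb(1)] angle_inv[OF B q] by (simp add: a_def[symmetric] b_def[symmetric])
  also have "\<dots> = turn b q' - turn a c + turn q c - turn b a"
    using angle_diff[OF A cb(2,3)] angle_diff[OF B cb(1,2)] by (simp add: Ba q' c_def[symmetric])
  also have "\<dots> = - edge_sum [q', b, a, c, q]"
    using turn_swap[OF cb(1,4)] turn_swap[OF q cb(3)] by simp
  finally show ?thesis unfolding q'_def .
qed

text \<open>
  The cocycle identity, iterated along an ordered product.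
\<close>

lemma oprod_cover:
  assumes "\<And>k. i \<le> k \<Longrightarrow> k \<le> n \<Longrightarrow> f k \<in> carrier cover_PSL2R" and "i \<le> Suc n" and x: "x \<in> cball 0 1"
  shows "oprod cover_PSL2R f i n \<in> carrier cover_PSL2R \<and>
    cover_image (oprod cover_PSL2R f i n) = oprod PSL2R (\<lambda>k. cover_image (f k)) i n \<and>
    oprod PSL2R (\<lambda>k. cover_image (f k)) i n x \<in> cball 0 1 \<and>
    angle (oprod cover_PSL2R f i n) x =
      (\<Sum>k = i..n. angle (f k) (oprod PSL2R (\<lambda>k. cover_image (f k)) (Suc k) n x))"
  using assms(2,1)
proof (induction i rule: inc_induct)
  case base
  then show ?case using x angle_one[OF x] COVH.hom_one by (simp add: oprod_empty)
next
  case (step i)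
  then have i: "i \<le> n" "f i \<in> carrier cover_PSL2R" by auto
  have IH: "oprod cover_PSL2R f (Suc i) n \<in> carrier cover_PSL2R"
    "cover_image (oprod cover_PSL2R f (Suc i) n) = oprod PSL2R (\<lambda>k. cover_image (f k)) (Suc i) n"
    "oprod PSL2R (\<lambda>k. cover_image (f k)) (Suc i) n x \<in> cball 0 1"
    "angle (oprod cover_PSL2R f (Suc i) n) x =
      (\<Sum>k = Suc i..n. angle (f k) (oprod PSL2R (\<lambda>k. cover_image (f k)) (Suc k) n x))"
    using step by auto
  show ?case
    unfolding oprod_Cons[OF i(1)] angle_mult[OF i(2) IH(1) x] IH(2,4) sum.atLeast_Suc_atMost[OF i(1)]
    using IH i(2) isom_plus_cball[OF cover_image_isom[OF i(2)]] by (simp add: cover_image_mult)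
qed

lemma convex_polygon_not_singleton: "\<not> convex_polygon [p]"
proof
  assume "convex_polygon [p]"
  then obtain e where "geodesic_arc e p p" by (auto simp: convex_polygon_def geodesic_polygon_def)
  then show False using arc_distinct_ends by (auto simp: geodesic_arc_def)
qed

theorem theorem3p18:
  fixes g n :: nat
    and \<alpha> \<beta> \<gamma> :: "nat \<Rightarrow> isom_path_class"
    and p :: complex
  assumes "\<And>i. i \<in> {1..g} \<Longrightarrow> \<alpha> i \<in> carrier cover_PSL2R"
    and "\<And>i. i \<in> {1..g} \<Longrightarrow> \<beta> i \<in> carrier cover_PSL2R"
    and "\<And>i. i \<in> {1..n} \<Longrightarrow> \<gamma> i \<in> carrier cover_PSL2R"
    and "p \<in> cball 0 1"
    and "convex_polygon
      (polygon_D g n (\<lambda>i. cover_image (\<alpha> i)) (\<lambda>i. cover_image (\<beta> i)) (\<lambda>i. cover_image (\<gamma> i)) p)"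
  shows "Tw (oprod cover_PSL2R (\<lambda>i. commutator cover_PSL2R (\<alpha> i) (\<beta> i)) 1 g
            \<otimes>\<^bsub>cover_PSL2R\<^esub> oprod cover_PSL2R \<gamma> 1 n) p =
      (\<Sum>i = 1..n. Tw (\<gamma> i) (oprod PSL2R (\<lambda>j. cover_image (\<gamma> j)) (Suc i) n p)) +
      signed_area
        (polygon_D g n (\<lambda>i. cover_image (\<alpha> i)) (\<lambda>i. cover_image (\<beta> i)) (\<lambda>i. cover_image (\<gamma> i)) p)"
proof -
  note p = assms(4)
  define C where "C i = commutator cover_PSL2R (\<alpha> i) (\<beta> i)" for i
  \<comment> \<open>The vertices: \<open>x i\<close> is \<open>\<gamma>\<^bsub>i+1\<^esub> \<dots> \<gamma>\<^bsub>n\<^esub> p\<close>, and \<open>q i\<close> is the vertex of this name.\<close>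
  define x where "x i = oprod PSL2R (\<lambda>j. cover_image (\<gamma> j)) (Suc i) n p" for i
  define q where "q i = oprod PSL2R (\<lambda>j. cover_image (C j)) (Suc i) g (x 0)" for i
  have Cc: "C i \<in> carrier cover_PSL2R"
    and Ci: "cover_image (C i) = commutator PSL2R (cover_image (\<alpha> i)) (cover_image (\<beta> i))" if "i \<in> {1..g}" for i
    using cover_image_commutator[OF assms(1,2)[OF that]] by (simp_all add: C_def)
  have gc: "\<gamma> k \<in> carrier cover_PSL2R" if "Suc i \<le> k" "k \<le> n" for i k using assms(3)[of k] that by simp
  have cc: "C k \<in> carrier cover_PSL2R" if "Suc i \<le> k" "k \<le> g" for i k using Cc[of k] that by simp
  have x_in: "x i \<in> cball 0 1" if "i \<le> n" for i
    unfolding x_def using oprod_cover[of "Suc i" n \<gamma> p] gc that p by auto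
  have q_in: "q i \<in> cball 0 1" if "i \<le> g" for i
    unfolding q_def using oprod_cover[of "Suc i" g C "x 0"] cc that x_in by auto
  have x_step: "cover_image (\<gamma> i) (x i) = x (i - 1)" if "i \<in> {1..n}" for i
    using that oprod_Cons[of i n PSL2R "\<lambda>j. cover_image (\<gamma> j)"] by (simp add: x_def)
  have q_step: "cover_image (C i) (q i) = q (i - 1)" if "i \<in> {1..g}" for i
    using that oprod_Cons[of i g PSL2R "\<lambda>j. cover_image (C j)"] by (simp add: q_def)
  have x_last: "x n = p" by (simp add: x_def oprod_empty)
  have q_last: "q g = x 0" by (simp add: q_def oprod_empty)
  let ?P = "oprod cover_PSL2R C 1 g" and ?G = "oprod cover_PSL2R \<gamma> 1 n"
  have P: "?P \<in> carrier cover_PSL2R" "cover_image ?P = oprod PSL2R (\<lambda>j. cover_image (C j)) 1 g"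
    "angle ?P (x 0) = (\<Sum>k = 1..g. angle (C k) (q k))"
    using oprod_cover[of 1 g C "x 0"] cc[of 0] x_in[of 0] by (auto simp: q_def)
  have G: "?G \<in> carrier cover_PSL2R" "cover_image ?G p = x 0"
    "angle ?G p = (\<Sum>k = 1..n. angle (\<gamma> k) (x k))"
    using oprod_cover[of 1 n \<gamma> p] gc[of 0] p by (auto simp: x_def)
  have PG: "?P \<otimes>\<^bsub>cover_PSL2R\<^esub> ?G \<in> carrier cover_PSL2R" using P(1) G(1) by (rule COV.m_closed)
  have total_image: "cover_image (?P \<otimes>\<^bsub>cover_PSL2R\<^esub> ?G) p = q 0"
    using cover_image_mult[OF P(1) G(1)] G(2) P(2) by (simp add: q_def)
  define b a c where bac: "b i = (inv\<^bsub>PSL2R\<^esub> (cover_image (\<beta> i))) (q i)" "a i = (inv\<^bsub>PSL2R\<^esub> (cover_image (\<alpha> i))) (b i)"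
    "c i = cover_image (\<beta> i) (a i)" for i
  have com: "angle (C i) (q i) = - edge_sum [q (i - 1), b i, a i, c i, q i]" if i: "i \<in> {1..g}" for i
    using angle_commutator[OF assms(1,2)[OF i] q_in[of i]] i q_step[OF i] Ci[OF i]
    by (simp add: bac C_def[symmetric])
  have tw: "Tw (\<gamma> i) (x i) = angle (\<gamma> i) (x i) + turn (x (i - 1)) (x i)" if i: "i \<in> {1..n}" for i
    using Tw_eq[OF assms(3)[OF i] x_in[of i]] turn_swap[OF x_in[of i] x_in[of "i - 1"]] i
    by (auto simp: x_step[OF i])
  define L where "L = concat (map (\<lambda>i. [b i, a i, c i, q i]) [1..<Suc g]) @ map x [1..<Suc n]"
  have "Tw (?P \<otimes>\<^bsub>cover_PSL2R\<^esub> ?G) p - (\<Sum>i = 1..n. Tw (\<gamma> i) (x i)) =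
      - turn p (q 0) - (\<Sum>i = 1..g. edge_sum [q (i - 1), b i, a i, c i, q i]) - (\<Sum>i = 1..n. turn (x (i - 1)) (x i))"
    using Tw_eq[OF PG p] angle_mult[OF P(1) G(1) p] G(2,3) P(3) total_image tw com
    by (simp add: sum.distrib sum_negf del: edge_sum.simps)
  also have "\<dots> = - edge_sum (p # q 0 # L)"
    unfolding L_def using edge_sum_quads[of q b a c g "map x [1..<Suc n]"] edge_sum_map[of x n] q_last
    by (simp del: upt_Suc)
  \<comment> \<open>All angles cancel; what remains are the turnings of the sides.\<close>
  finally have main: "Tw (?P \<otimes>\<^bsub>cover_PSL2R\<^esub> ?G) p - (\<Sum>i = 1..n. Tw (\<gamma> i) (x i)) = - edge_sum (p # q 0 # L)" .
  let ?D = "polygon_D g n (\<lambda>i. cover_image (\<alpha> i)) (\<lambda>i. cover_image (\<beta> i)) (\<lambda>i. cover_image (\<gamma> i)) p"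
  have pq: "polygon_q g n (\<lambda>i. cover_image (\<alpha> i)) (\<lambda>i. cover_image (\<beta> i)) (\<lambda>i. cover_image (\<gamma> i)) p i = q i" for i
  proof -
    have "oprod PSL2R (\<lambda>j. commutator PSL2R (cover_image (\<alpha> j)) (cover_image (\<beta> j))) (Suc i) g =
        oprod PSL2R (\<lambda>j. cover_image (C j)) (Suc i) g"
      unfolding oprod_def using Ci by (intro foldr_cong) auto
    then show ?thesis by (simp add: polygon_q_def q_def x_def)
  qed
  have D: "?D = p # (if q 0 = p then [] else [q 0]) @ butlast L"
    unfolding polygon_D_def Let_def pq L_def x_def bac ..
  have "L \<noteq> []"
  proof
    assume "L = []"
    then have "n = 0" "g = 0" by (auto simp: L_def split: if_splits)
    then have "q 0 = p" using q_last x_last by simp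
    then have "?D = [p]" unfolding D \<open>L = []\<close> by simp
    then show False using assms(5) convex_polygon_not_singleton by simp
  qed
  have "last L = p"
  proof (cases "n = 0")
    case False
    then show ?thesis using x_last by (simp add: L_def last_append)
  next
    case True
    then have "g \<noteq> 0" using \<open>L \<noteq> []\<close> by (auto simp: L_def)
    then show ?thesis using True q_last x_last by (simp add: L_def)
  qed
  \<comment> \<open>The entry dropped by \<open>butlast\<close> closes the polygon.\<close>
  then have bl: "butlast L @ [p] = L" using \<open>L \<noteq> []\<close> append_butlast_last_id by metis
  have "edge_sum (?D @ [hd ?D]) = edge_sum (p # q 0 # L)"
  proof (cases "q 0 = p")
    case True
    then show ?thesis unfolding D using bl turn_refl[OF p] by simp
  next
    case False
    then show ?thesis unfolding D using bl by simp
  qed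
  moreover have "?D \<noteq> []" unfolding D by simp
  ultimately have "signed_area ?D = - edge_sum (p # q 0 # L)"
    using signed_area_eq[OF assms(5)] edge_sum_cyclic[of ?D] by simp
  then show ?thesis using main unfolding C_def x_def by simp
qed

end
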